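(* Assume $\Omega_1$ and $\Omega_2$ are bounded, connected open sets with Lipschitz boundary in $\mathbb{R}^d$ if $d\geq 2$, or bounded open intervals if $d=1$. Let $U:C(\overline{\Omega}_1)\to C(\overline{\Omega}_2)$ be a bounded linear operator satisfying the assumptions (a) $f\cdot g=0$ implies $(Uf)\cdot(Ug)=0$ for all $f,g\in C(\overline{\Omega}_1)$; and (b) $U(C_c^\infty(\Omega_1))\subset D(\Delta^\beta_{\Omega_2})$ for some $\beta\in C(\partial\Omega_2)$, and $U(\Delta f)=\Delta(Uf)$ for all $f\in C_c^\infty(\Omega_1)$; and (c) if $\omega\subset\Omega_2$ is open and $(Uf)|_\omega=0$ for all $f\in C_c^\infty(\Omega_1)$, then $\omega=\emptyset$. Suppose in addition that one of the following conditions holds: (d) $|\Omega_1|=|\Omega_2|$; or (e) $U:C(\overline\Omega_1)\to C(\overline\Omega_2)$ has dense range. Then there exist an isometry $\tau:\mathbb{R}^d\to\mathbb{R}^d$ with $\tau(\Omega_2)=\Omega_1$ and a constant $c\in\mathbb{C}\setminus\{0\}$ such that $$Uf=c\,f\circ\tau\qquad\text{for all } f\in C(\overline\Omega_1).$$ In particular, $\Omega_1$ and $\Omega_2$ are congruent.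
   Context: Functions are complex-valued (the Robin coefficient $\beta$ is real-valued); $\Omega_1,\Omega_2$ are non-empty; $|\cdot|$ is Lebesgue measure. $C(\overline\Omega)$ carries the supremum norm. For a bounded open set $\Omega\subset\mathbb{R}^d$ with Lipschitz boundary (a bounded interval if $d=1$), let $\sigma$ be surface measure on $\partial\Omega$ (counting measure if $d=1$). For $u\in H^1(\Omega)$ with distributional Laplacian $\Delta u\in L^2(\Omega)$, the distributional outer normal derivative $\frac{\partial u}{\partial\nu}$ is the unique $h\in L^2(\partial\Omega)$, if it exists, with $\int_\Omega(\nabla u\cdot\overline{\nabla v}+\Delta u\,\overline v)\,dx=\int_{\partial\Omega}h\overline v\,d\sigma$ for all $v\in H^1(\Omega)$. For $\beta\in C(\partial\Omega)$ the Robin Laplacian on $C(\overline\Omega)$ is given by $D(\Delta^\beta_\Omega)=\{u\in H^1(\Omega)\cap C(\overline\Omega):\Delta u\in C(\overline\Omega),\ \frac{\partial u}{\partial\nu}\text{ exists in }L^2(\partial\Omega)\text{ and equals }-\beta u\}$, $\Delta^\beta_\Omega u=\Delta u$; $\beta\equiv0$ gives the Neumann Laplacian. Congruent means one set is the image of the other under an isometry of $\mathbb{R}^d$. *)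

theory Defs
  imports "HOL-Analysis.Analysis"
begin

text \<open>
  The space R^d is rendered by an arbitrary type of class \<open>euclidean_space\<close>, so \<open>d = DIM('a)\<close>;
  \<open>Basis\<close> is its orthonormal coordinate basis. Elements of L2 and H1 are represented by
  functions on the whole type of which only the values on the domain matter.
\<close>

subsection \<open>Domains\<close>

text \<open>
  Near every boundary point the set is, in suitable Cartesian coordinates (last axis \<open>e\<close>),
  the strict epigraph of a Lipschitz function \<open>\<phi>\<close> on the hyperplane orthogonal to \<open>e\<close>. For open
  \<open>\<Omega>\<close> the equivalence below also forces the boundary inside \<open>V\<close> to be the graph of \<open>\<phi>\<close>.
\<close>

definition lipschitz_boundary :: "'a::euclidean_space set \<Rightarrow> bool" where
  "lipschitz_boundary \<Omega> \<longleftrightarrow>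
    (\<forall>z\<in>frontier \<Omega>. \<exists>V e L \<phi>. open V \<and> z \<in> V \<and> norm e = 1 \<and>
      L-lipschitz_on {y. y \<bullet> e = 0} (\<phi> :: 'a \<Rightarrow> real) \<and>
      (\<forall>y\<in>V. y \<in> \<Omega> \<longleftrightarrow> \<phi> (y - (y \<bullet> e) *\<^sub>R e) < y \<bullet> e))"

definition lipschitz_domain :: "'a::euclidean_space set \<Rightarrow> bool" where
  "lipschitz_domain \<Omega> \<longleftrightarrow> \<Omega> \<noteq> {} \<and> open \<Omega> \<and> bounded \<Omega> \<and>
    (if DIM('a) = 1 then \<exists>a b. \<Omega> = box a b
     else connected \<Omega> \<and> lipschitz_boundary \<Omega>)"

definition isometry :: "('a::metric_space \<Rightarrow> 'b::metric_space) \<Rightarrow> bool" where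
  "isometry \<tau> \<longleftrightarrow> (\<forall>x y. dist (\<tau> x) (\<tau> y) = dist x y)"

definition congruent_sets :: "'a::metric_space set \<Rightarrow> 'a set \<Rightarrow> bool" where
  "congruent_sets S T \<longleftrightarrow> (\<exists>\<tau>::'a \<Rightarrow> 'a. isometry \<tau> \<and> \<tau> ` S = T)"


subsection \<open>Surface measure\<close>

text \<open>
  Surface measure on the boundary is the (d-1)-dimensional Hausdorff measure, normalised by the
  volume of the unit ball of that dimension so that it agrees with Lebesgue measure on
  hyperplanes. Since \<open>x ^ 0 = 1\<close> also for \<open>x = 0\<close> and \<open>unit_ball_vol 0 = 1\<close>, in dimension
  \<open>d = 1\<close> it is counting measure (this is why empty covering sets are treated separately).
  The Hausdorff outer measure is a metric outer measure, hence countably additive on the Borel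
  sets, so that \<open>measure_of\<close> does yield its restriction to them.
\<close>

definition hausdorff_content :: "nat \<Rightarrow> real \<Rightarrow> 'a::metric_space set \<Rightarrow> ennreal" where
  "hausdorff_content s \<delta> A =
    (INF C\<in>{C :: nat \<Rightarrow> 'a set. A \<subseteq> (\<Union>i. C i) \<and> (\<forall>i. bounded (C i) \<and> diameter (C i) \<le> \<delta>)}.
      \<Sum>i. if C i = {} then 0
          else ennreal (unit_ball_vol (real s) * (diameter (C i) / 2) ^ s))"

definition hausdorff_outer :: "nat \<Rightarrow> 'a::metric_space set \<Rightarrow> ennreal" where
  "hausdorff_outer s A = (SUP \<delta>\<in>{0<..}. hausdorff_content s \<delta> A)"

definition hausdorff_measure :: "nat \<Rightarrow> 'a::metric_space measure" where
  "hausdorff_measure s = measure_of UNIV (sets borel) (hausdorff_outer s)"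

definition surface_measure :: "'a::euclidean_space set \<Rightarrow> 'a measure" where
  "surface_measure \<Omega> = restrict_space (hausdorff_measure (DIM('a) - 1)) (frontier \<Omega>)"


subsection \<open>Continuous functions and test functions\<close>

text \<open>
  An element of \<open>C(closure \<Omega>)\<close> is represented by its extension by zero to the whole space, which
  makes the representing function unique, so that equality, sums and multiples in \<open>C(closure \<Omega>)\<close>
  are those of functions.
\<close>

definition C_closure :: "'a::euclidean_space set \<Rightarrow> ('a \<Rightarrow> complex) set" where
  "C_closure \<Omega> = {f. continuous_on (closure \<Omega>) f \<and> (\<forall>x. x \<notin> closure \<Omega> \<longrightarrow> f x = 0)}"

definition sup_norm :: "'a::euclidean_space set \<Rightarrow> ('a \<Rightarrow> complex) \<Rightarrow> real" where
  "sup_norm \<Omega> f = (SUP x\<in>closure \<Omega>. norm (f x))"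

definition bounded_linear_C ::
  "'a::euclidean_space set \<Rightarrow> 'b::euclidean_space set \<Rightarrow>
    (('a \<Rightarrow> complex) \<Rightarrow> ('b \<Rightarrow> complex)) \<Rightarrow> bool" where
  "bounded_linear_C \<Omega>1 \<Omega>2 U \<longleftrightarrow>
    (\<forall>f\<in>C_closure \<Omega>1. U f \<in> C_closure \<Omega>2) \<and>
    (\<forall>f\<in>C_closure \<Omega>1. \<forall>g\<in>C_closure \<Omega>1. U (\<lambda>x. f x + g x) = (\<lambda>y. U f y + U g y)) \<and>
    (\<forall>f\<in>C_closure \<Omega>1. \<forall>a::complex. U (\<lambda>x. a * f x) = (\<lambda>y. a * U f y)) \<and>
    (\<exists>K. \<forall>f\<in>C_closure \<Omega>1. sup_norm \<Omega>2 (U f) \<le> K * sup_norm \<Omega>1 f)"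

definition dense_range_C ::
  "'a::euclidean_space set \<Rightarrow> 'b::euclidean_space set \<Rightarrow>
    (('a \<Rightarrow> complex) \<Rightarrow> ('b \<Rightarrow> complex)) \<Rightarrow> bool" where
  "dense_range_C \<Omega>1 \<Omega>2 U \<longleftrightarrow>
    (\<forall>g\<in>C_closure \<Omega>2. \<forall>\<epsilon>>0. \<exists>f\<in>C_closure \<Omega>1. sup_norm \<Omega>2 (\<lambda>y. U f y - g y) < \<epsilon>)"

definition pderiv_dir :: "'a::euclidean_space \<Rightarrow> ('a \<Rightarrow> complex) \<Rightarrow> 'a \<Rightarrow> complex" where
  "pderiv_dir b f x = frechet_derivative f (at x) b"

text \<open>
  A function is smooth iff all its iterated partial derivatives (\<open>bs\<close> is the list of directions,
  the empty list giving the function itself) are differentiable everywhere.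
\<close>

definition smooth :: "('a::euclidean_space \<Rightarrow> complex) \<Rightarrow> bool" where
  "smooth f \<longleftrightarrow> (\<forall>bs\<in>lists Basis. \<forall>x. (foldr pderiv_dir bs f) differentiable (at x))"

definition test_functions :: "'a::euclidean_space set \<Rightarrow> ('a \<Rightarrow> complex) set" where
  "test_functions \<Omega> =
    {\<phi>. smooth \<phi> \<and> compact (closure {x. \<phi> x \<noteq> 0}) \<and> closure {x. \<phi> x \<noteq> 0} \<subseteq> \<Omega>}"

definition laplacian :: "('a::euclidean_space \<Rightarrow> complex) \<Rightarrow> 'a \<Rightarrow> complex" where
  "laplacian \<phi> x = (\<Sum>b\<in>Basis. pderiv_dir b (pderiv_dir b \<phi>) x)"


subsection \<open>Sobolev space, traces and the normal derivative\<close>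

definition L2 :: "'a measure \<Rightarrow> ('a \<Rightarrow> complex) \<Rightarrow> bool" where
  "L2 M f \<longleftrightarrow> f \<in> borel_measurable M \<and> integrable M (\<lambda>x. (norm (f x))\<^sup>2)"

text \<open>\<open>G b\<close> is the distributional partial derivative of \<open>u\<close> in the coordinate direction \<open>b\<close>.\<close>

definition has_H1_gradient ::
  "'a::euclidean_space set \<Rightarrow> ('a \<Rightarrow> complex) \<Rightarrow> ('a \<Rightarrow> 'a \<Rightarrow> complex) \<Rightarrow> bool" where
  "has_H1_gradient \<Omega> u G \<longleftrightarrow> L2 (lebesgue_on \<Omega>) u \<and>
    (\<forall>b\<in>Basis. L2 (lebesgue_on \<Omega>) (G b) \<and>
      (\<forall>\<phi>\<in>test_functions \<Omega>.
        (LINT x|lebesgue_on \<Omega>. u x * pderiv_dir b \<phi> x) = - (LINT x|lebesgue_on \<Omega>. G b x * \<phi> x)))"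

definition H1 :: "'a::euclidean_space set \<Rightarrow> ('a \<Rightarrow> complex) set" where
  "H1 \<Omega> = {u. \<exists>G. has_H1_gradient \<Omega> u G}"

definition has_dist_laplacian ::
  "'a::euclidean_space set \<Rightarrow> ('a \<Rightarrow> complex) \<Rightarrow> ('a \<Rightarrow> complex) \<Rightarrow> bool" where
  "has_dist_laplacian \<Omega> u w \<longleftrightarrow>
    (\<forall>\<phi>\<in>test_functions \<Omega>.
      (LINT x|lebesgue_on \<Omega>. u x * laplacian \<phi> x) = (LINT x|lebesgue_on \<Omega>. w x * \<phi> x))"

text \<open>
  The trace operator from \<open>H1 \<Omega>\<close> to L2 of the boundary is the continuous extension of
  restriction to the boundary, defined on those functions in \<open>H1 \<Omega>\<close> that are continuous on the
  closure. On a Lipschitz domain every \<open>v\<close> in \<open>H1 \<Omega>\<close> has a trace, unique up to null sets.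
\<close>

definition has_trace ::
  "'a::euclidean_space set \<Rightarrow> ('a \<Rightarrow> complex) \<Rightarrow> ('a \<Rightarrow> complex) \<Rightarrow> bool" where
  "has_trace \<Omega> v g \<longleftrightarrow> L2 (surface_measure \<Omega>) g \<and>
    (\<exists>G vs Gs. has_H1_gradient \<Omega> v G \<and>
      (\<forall>n::nat. continuous_on (closure \<Omega>) (vs n) \<and> has_H1_gradient \<Omega> (vs n) (Gs n) \<and>
        L2 (surface_measure \<Omega>) (vs n)) \<and>
      (\<lambda>n. LINT x|lebesgue_on \<Omega>. (norm (vs n x - v x))\<^sup>2) \<longlonglongrightarrow> 0 \<and>
      (\<forall>b\<in>Basis. (\<lambda>n. LINT x|lebesgue_on \<Omega>. (norm (Gs n b x - G b x))\<^sup>2) \<longlonglongrightarrow> 0) \<and>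
      (\<lambda>n. LINT z|surface_measure \<Omega>. (norm (vs n z - g z))\<^sup>2) \<longlonglongrightarrow> 0)"

definition has_normal_derivative ::
  "'a::euclidean_space set \<Rightarrow> ('a \<Rightarrow> complex) \<Rightarrow> ('a \<Rightarrow> complex) \<Rightarrow> bool" where
  "has_normal_derivative \<Omega> u h \<longleftrightarrow> L2 (surface_measure \<Omega>) h \<and>
    (\<exists>G w. has_H1_gradient \<Omega> u G \<and> L2 (lebesgue_on \<Omega>) w \<and> has_dist_laplacian \<Omega> u w \<and>
      (\<forall>v G' g. has_H1_gradient \<Omega> v G' \<and> has_trace \<Omega> v g \<longrightarrow>
        (LINT x|lebesgue_on \<Omega>. (\<Sum>b\<in>Basis. G b x * cnj (G' b x)) + w x * cnj (v x)) =
        (LINT z|surface_measure \<Omega>. h z * cnj (g z))))"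

definition robin_domain ::
  "'a::euclidean_space set \<Rightarrow> ('a \<Rightarrow> real) \<Rightarrow> ('a \<Rightarrow> complex) set" where
  "robin_domain \<Omega> \<beta> = {u. u \<in> H1 \<Omega> \<and> u \<in> C_closure \<Omega> \<and>
    (\<exists>w\<in>C_closure \<Omega>. has_dist_laplacian \<Omega> u w) \<and>
    has_normal_derivative \<Omega> u (\<lambda>z. - complex_of_real (\<beta> z) * u z)}"

end

theory Submission
  imports Defs
begin

text \<open>
  A bounded disjointness preserving functional on \<open>C(closure \<Omega>1)\<close> is a multiple of a point
  evaluation, so \<open>U f y = h y * f (\<tau> y)\<close>. On the open set \<open>R\<close> of those \<open>y\<close> in \<open>\<Omega>2\<close> with
  \<open>h y \<noteq> 0\<close> and \<open>\<tau> y \<in> \<Omega>1\<close>, applying the intertwining relation to test functions that are locally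
  \<open>1\<close>, \<open>x \<bullet> e\<close> and \<open>(x \<bullet> e)\<^sup>2\<close> shows that \<open>h\<close> and \<open>h (\<tau> \<bullet> e)\<close> are weakly harmonic and that
  \<open>h (\<tau> \<bullet> e)\<^sup>2\<close> has weak Laplacian \<open>2 \<bar>e\<bar>\<^sup>2 h\<close>. Exact mean value formulas with radial bumps then give
  that \<open>h\<close> and \<open>\<tau>\<close> are differentiable, that \<open>D\<tau>\<close> is orthogonal, hence \<open>\<tau>\<close> is locally 1-Lipschitz, and
  finally, as \<open>\<bar>\<tau> z - \<tau> y\<bar>\<^sup>2\<close> and \<open>\<bar>z - y\<bar>\<^sup>2\<close> have the same weighted means, that \<open>\<tau>\<close> is locally an affine
  isometry and \<open>h\<close> is locally constant.

  The Robin condition forbids a boundary point \<open>y\<close> of \<open>\<Omega>2\<close> with \<open>h y \<noteq> 0\<close> from being mapped into \<open>\<Omega>1\<close>: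
  otherwise it would hold near \<open>y\<close> for a constant and for a linear function with nonzero normal
  component. Hence every component of \<open>R\<close> is mapped onto the connected set \<open>\<Omega>1\<close>. Equality of volumes,
  or injectivity of \<open>\<tau>\<close> in the case of dense range, leaves room for one component only; it is dense in
  \<open>\<Omega>2\<close> by (c), and \<open>\<Omega>1\<close> equals the interior of its closure.
\<close>

subsection \<open>Smooth functions\<close>

text \<open>\<open>h\<close> is known only through weak equations, and \<open>\<tau>\<close>
  satisfies none by itself. One computation replaces regularity theory: if \<open>F' = f\<close>,
  then the Laplacian in z of \<open>F (|z - y|^2 / \<epsilon>^2)\<close> is, up to an explicit
  factor, the derivative in \<open>\<epsilon>\<close> of the kernel
  \<open>f (|z - y|^2 / \<epsilon>^2) / \<epsilon>^d\<close>. The weak equation thus yields the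
  \<open>\<epsilon>\<close>-derivative of a mean of u from a mean of its Laplacian, and u is never
  differentiated. That \<open>\<tau>\<close> is affine comes from rigidity in an inequality, not
  from second derivatives: the 1-Lipschitz bound makes |z - y|^2 - |\<tau> z - \<tau> y|^2
  nonnegative, and a continuous nonnegative function whose weighted integral is zero vanishes. As
  \<open>h\<close> is complex, the weight must first be made positive, whence the condition on
  \<open>Re (h z / h y)\<close> in a chart. At the boundary neither a divergence theorem nor a
  pointwise normal enters: the constant and the linear solution produce the same boundary integral
  for suitable test functions, and eliminating it would make the integral over
  \<open>\<Omega>2\<close> of a derivative transversal to the boundary vanish for every test
  function near the point.\<close>

definition smooth_real :: "(real \<Rightarrow> real) \<Rightarrow> bool" where
  "smooth_real f \<longleftrightarrow> (\<exists>D. D 0 = f \<and> (\<forall>k::nat. \<forall>t. (D k has_real_derivative D (Suc k) t) (at t)))"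

text \<open>Iterating a choice of derivatives inside \<open>S\<close> yields the sequence
  \<open>D\<close>. Closure properties of smooth functions are thereby reduced to finding a class
  stable under one differentiation, and formulas for higher derivatives are avoided.\<close>

lemma smooth_realI:
  assumes "f \<in> S" and step: "\<And>g. g \<in> S \<Longrightarrow> \<exists>g'\<in>S. \<forall>t. (g has_real_derivative g' t) (at t)"
  shows "smooth_real f"
proof -
  obtain d where d: "\<And>g. g \<in> S \<Longrightarrow> d g \<in> S \<and> (\<forall>t. (g has_real_derivative d g t) (at t))"
    using step by metis
  have "(d ^^ k) f \<in> S" for k
    by (induction k) (use assms(1) d in auto)
  then show ?thesis
    unfolding smooth_real_def using d by (intro exI[of _ "\<lambda>k. (d ^^ k) f"]) simp
qed

lemma smooth_real_deriv_ex:
  assumes "smooth_real f"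
  obtains f' where "smooth_real f'" "\<And>t. (f has_real_derivative f' t) (at t)"
proof -
  obtain D where D: "D 0 = f" "\<And>k t. (D k has_real_derivative D (Suc k) t) (at t)"
    using assms unfolding smooth_real_def by auto
  have "smooth_real (D 1)"
    unfolding smooth_real_def by (rule exI[of _ "\<lambda>k. D (Suc k)"]) (use D in auto)
  with that D show ?thesis by (metis One_nat_def)
qed

lemma smooth_real_antideriv:
  assumes "smooth_real f'" "\<And>t. (f has_real_derivative f' t) (at t)"
  shows "smooth_real f"
proof -
  obtain D where D: "D 0 = f'" "\<And>k t. (D k has_real_derivative D (Suc k) t) (at t)"
    using assms unfolding smooth_real_def by auto
  show ?thesis
    unfolding smooth_real_def
    by (rule exI[of _ "\<lambda>k. case k of 0 \<Rightarrow> f | Suc j \<Rightarrow> D j"]) (use D assms(2) in \<open>auto split: nat.split\<close>)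
qed

lemma smooth_real_continuous: "smooth_real f \<Longrightarrow> continuous_on S f"
  by (metis DERIV_continuous_on has_field_derivative_at_within smooth_real_deriv_ex)

lemma smooth_real_add:
  assumes "smooth_real f" "smooth_real g"
  shows "smooth_real (\<lambda>t. f t + g t)"
proof (rule smooth_realI[where S="{\<lambda>t. f t + g t | f g. smooth_real f \<and> smooth_real g}"], goal_cases)
  case 1
  then show ?case using assms by blast
next
  case (2 k)
  then obtain f g where k: "k = (\<lambda>t. f t + g t)" "smooth_real f" "smooth_real g" by blast
  obtain f' where f': "smooth_real f'" "\<And>t. (f has_real_derivative f' t) (at t)"
    using k smooth_real_deriv_ex by blast
  obtain g' where g': "smooth_real g'" "\<And>t. (g has_real_derivative g' t) (at t)"
    using k smooth_real_deriv_ex by blast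
  show ?case unfolding k
    by (rule bexI[of _ "\<lambda>t. f' t + g' t"]) (use f' g' in \<open>auto intro!: derivative_eq_intros\<close>)
qed

lemma smooth_real_times_ident:
  assumes "smooth_real f"
  shows "smooth_real (\<lambda>t. t * f t)"
\<comment> \<open>The extra summand \<open>g\<close> takes up the term \<open>f t\<close> in the
  derivative \<open>t * f' t + f t\<close>, so the class is stable.\<close>
proof (rule smooth_realI[where S="{\<lambda>t. t * f t + g t | f g. smooth_real f \<and> smooth_real g}"], goal_cases)
  case 1
  have "smooth_real (\<lambda>_. 0)"
    unfolding smooth_real_def by (rule exI[of _ "\<lambda>_ _. 0"]) auto
  then show ?case using assms by force
next
  case (2 k)
  then obtain f g where k: "k = (\<lambda>t. t * f t + g t)" "smooth_real f" "smooth_real g" by blast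
  obtain f' where f': "smooth_real f'" "\<And>t. (f has_real_derivative f' t) (at t)"
    using k smooth_real_deriv_ex by blast
  obtain g' where g': "smooth_real g'" "\<And>t. (g has_real_derivative g' t) (at t)"
    using k smooth_real_deriv_ex by blast
  have "smooth_real (\<lambda>t. f t + g' t)" using k g' smooth_real_add by blast
  then show ?case unfolding k
    by (intro bexI[of _ "\<lambda>t. t * f' t + (f t + g' t)"])
       (use f' g' in \<open>auto intro!: derivative_eq_intros\<close>)
qed

lemma smooth_real_affine:
  assumes "smooth_real f"
  shows "smooth_real (\<lambda>t. f (a + c * t))"
proof -
  obtain D where D: "D 0 = f" "\<And>k t. (D k has_real_derivative D (Suc k) t) (at t)"
    using assms unfolding smooth_real_def by auto
  have "((\<lambda>t. c ^ k * D k (a + c * t)) has_real_derivative c ^ Suc k * D (Suc k) (a + c * t)) (at t)"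
    for k t
    by (auto intro!: derivative_eq_intros DERIV_chain2[OF D(2)])
  then show ?thesis
    unfolding smooth_real_def by (intro exI[of _ "\<lambda>k t. c ^ k * D k (a + c * t)"]) (simp add: D(1))
qed

section \<open>The flat exponential\<close>

definition flat_exp :: "real \<Rightarrow> real" where
  "flat_exp t = (if t > 0 then exp (- (1 / t)) else 0)"

lemma tendsto_poly_times_exp_minus:
  "((\<lambda>x::real. poly p x * exp (- x)) \<longlongrightarrow> 0) at_top"
proof -
  have "((\<lambda>x. \<Sum>i\<le>degree p. coeff p i * (x ^ i / exp x)) \<longlongrightarrow> (\<Sum>i\<le>degree p. coeff p i * 0)) at_top"
    by (intro tendsto_sum tendsto_mult tendsto_const tendsto_power_div_exp_0)
  moreover have "(\<lambda>x. \<Sum>i\<le>degree p. coeff p i * (x ^ i / exp x)) = (\<lambda>x. poly p x * exp (- x))"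
    by (simp add: fun_eq_iff poly_altdef sum_distrib_right exp_minus divide_inverse mult.assoc)
  ultimately show ?thesis by simp
qed

lemma smooth_flat_exp: "smooth_real flat_exp"
proof (rule smooth_realI[where S="range (\<lambda>p t. if t > 0 then poly p (1 / t) * exp (- (1 / t)) else 0)"], goal_cases)
  case 1
  have "flat_exp = (\<lambda>p t. if t > 0 then poly p (1 / t) * exp (- (1 / t)) else 0) 1"
    by (auto simp: flat_exp_def fun_eq_iff)
  then show ?case by blast
next
  case (2 g)
  then obtain p where g: "g = (\<lambda>t. if t > 0 then poly p (1 / t) * exp (- (1 / t)) else 0)" by blast
  \<comment> \<open>With s = 1/t, the derivative of \<open>poly p s * exp (- s)\<close> with respect
    to t is s^2 (p - p')(s) exp (- s).\<close>
  define q where "q = [:0,0,1:] * (p - pderiv p)"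
  define g' where "g' = (\<lambda>t::real. if t > 0 then poly q (1 / t) * exp (- (1 / t)) else 0)"
  have "(g has_real_derivative g' t) (at t)" for t
  proof (cases t "0::real" rule: linorder_cases)
    case greater
    have "((\<lambda>t. poly p (1 / t) * exp (- (1 / t))) has_real_derivative g' t) (at t)"
    proof -
      have i: "((\<lambda>t. 1 / t) has_real_derivative - (1 / t) * (1 / t)) (at t)"
        using greater by (auto intro!: derivative_eq_intros simp: divide_inverse)
      have "((\<lambda>t. poly p (1 / t) * exp (- (1 / t))) has_real_derivative
        poly p (1 / t) * (exp (- (1 / t)) * - (- (1 / t) * (1 / t))) +
        (poly (pderiv p) (1 / t) * (- (1 / t) * (1 / t))) * exp (- (1 / t))) (at t)"
        by (rule DERIV_mult'[OF DERIV_chain2[OF poly_DERIV i] DERIV_chain2[OF DERIV_exp DERIV_minus[OF i]]])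
      then show ?thesis
        using greater by (simp add: g'_def q_def algebra_simps)
    qed
    moreover have "eventually (\<lambda>t. g t = poly p (1 / t) * exp (- (1 / t))) (nhds t)"
      using eventually_nhds_in_open[of "{0<..}" t] greater by (auto simp: g elim!: eventually_mono)
    ultimately show ?thesis by (subst DERIV_cong_ev[OF refl _ refl])
  next
    case less
    have "eventually (\<lambda>t. g t = 0) (nhds t)"
      using eventually_nhds_in_open[of "{..<0}" t] less by (auto simp: g elim!: eventually_mono)
    then show ?thesis using less DERIV_cong_ev[of t t g "\<lambda>_. 0" 0 "g' t"] by (simp add: g'_def)
  next
    case equal
    \<comment> \<open>With s = 1/t the right difference quotient at 0 is s p(s) exp (- s), which
      tends to 0 as s grows.\<close>
    have "((\<lambda>x. poly ([:0,1:] * p) x * exp (- x)) \<longlongrightarrow> 0) at_top"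
      by (rule tendsto_poly_times_exp_minus)
    then have "((\<lambda>t. poly ([:0,1:] * p) (inverse t) * exp (- (inverse t))) \<longlongrightarrow> 0) (at_right 0)"
      using filterlim_inverse_at_top_right filterlim_compose by blast
    then have R: "((\<lambda>t. g t / t) \<longlongrightarrow> 0) (at_right 0)"
      by (rule Lim_transform_eventually)
         (auto simp: g eventually_at_filter divide_inverse)
    have L: "((\<lambda>t. g t / t) \<longlongrightarrow> 0) (at_left 0)"
      by (rule Lim_transform_eventually[OF tendsto_const])
         (auto simp: g eventually_at_filter)
    have "((\<lambda>t. g t / t) \<longlongrightarrow> 0) (at 0)"
      using L R filterlim_split_at by blast
    then show ?thesis
      unfolding equal DERIV_def add_0 by (simp add: g g'_def)
  qed
  moreover have "g' \<in> range (\<lambda>p t. if t > 0 then poly p (1 / t) * exp (- (1 / t)) else 0)"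
    unfolding g'_def by blast
  ultimately show ?case by (intro bexI[of _ g'] allI)
qed

lemma flat_exp_pos: "t > 0 \<Longrightarrow> flat_exp t > 0" and flat_exp_nonneg: "flat_exp t \<ge> 0"
  and flat_exp_eq_0: "t \<le> 0 \<Longrightarrow> flat_exp t = 0"
  by (auto simp: flat_exp_def)

section \<open>Partial derivatives and smooth functions of several variables\<close>

lemma pderiv_dir_eq:
  assumes "(f has_derivative f') (at x)"
  shows "pderiv_dir b f x = f' b"
  using frechet_derivative_at[OF assms] by (simp add: pderiv_dir_def)

lemma pderiv_dir_has_derivative:
  assumes "f differentiable (at x)"
  shows "(f has_derivative (\<lambda>k. pderiv_dir k f x)) (at x)"
  using assms unfolding pderiv_dir_def frechet_derivative_works by simp

lemma pderiv_dir_cong_open: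
  assumes "open S" "x \<in> S" "\<And>y. y \<in> S \<Longrightarrow> f y = g y"
  shows "pderiv_dir b f x = pderiv_dir b g x"
proof -
  have "(f has_derivative D) (at x) \<longleftrightarrow> (g has_derivative D) (at x)" for D
    using has_derivative_transform_within_open[OF _ assms(1,2)] assms(3) by metis
  then show ?thesis unfolding pderiv_dir_def frechet_derivative_def by simp
qed

lemma laplacian_cong_open:
  assumes "open S" "x \<in> S" "\<And>y. y \<in> S \<Longrightarrow> f y = g y"
  shows "laplacian f x = laplacian g x"
  unfolding laplacian_def
  using assms by (intro sum.cong refl pderiv_dir_cong_open[of S] pderiv_dir_cong_open[of S]) auto

text \<open>As in one variable, a class stable under the coordinate derivatives is exhibited instead
  of computing iterated ones.\<close>

lemma smoothI:
  assumes "f \<in> S" and diff: "\<And>g x. g \<in> S \<Longrightarrow> g differentiable (at x)"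
    and step: "\<And>g b. g \<in> S \<Longrightarrow> b \<in> Basis \<Longrightarrow> pderiv_dir b g \<in> S"
  shows "smooth f"
proof -
  have "foldr pderiv_dir bs f \<in> S" if "bs \<in> lists Basis" for bs
    using that by (induction bs) (use assms(1) step in auto)
  then show ?thesis unfolding smooth_def using diff by blast
qed

lemma smooth_differentiable: "smooth f \<Longrightarrow> f differentiable (at x)"
  unfolding smooth_def by (metis foldr.simps(1) id_apply lists.Nil)

lemma smooth_pderiv_dir:
  assumes "smooth f" "b \<in> Basis"
  shows "smooth (pderiv_dir b f)"
  unfolding smooth_def
proof (intro ballI allI)
  fix bs x assume "bs \<in> lists (Basis :: 'a set)"
  then have "bs @ [b] \<in> lists Basis" using assms(2) by simp
  then have "foldr pderiv_dir (bs @ [b]) f differentiable (at x)"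
    using assms(1) unfolding smooth_def by blast
  then show "foldr pderiv_dir bs (pderiv_dir b f) differentiable (at x)" by simp
qed

lemma smooth_has_derivative:
  "smooth f \<Longrightarrow> (f has_derivative (\<lambda>k. pderiv_dir k f x)) (at x)"
  using pderiv_dir_has_derivative smooth_differentiable by blast

lemma pderiv_dir_sum_Basis:
  assumes "smooth f"
  shows "pderiv_dir a f x = (\<Sum>b\<in>Basis. of_real (a \<bullet> b) * pderiv_dir b f x)"
proof -
  have lin: "linear (\<lambda>k. pderiv_dir k f x)"
    using has_derivative_linear[OF smooth_has_derivative[OF assms]] .
  have "pderiv_dir a f x = pderiv_dir (\<Sum>b\<in>Basis. (a \<bullet> b) *\<^sub>R b) f x"
    by (simp add: euclidean_representation)
  also have "\<dots> = (\<Sum>b\<in>Basis. of_real (a \<bullet> b) * pderiv_dir b f x)"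
    using linear_sum[OF lin, of "\<lambda>b. (a \<bullet> b) *\<^sub>R b" Basis] linear_scale[OF lin]
    by (simp add: scaleR_conv_of_real)
  finally show ?thesis .
qed

lemma smooth_continuous_on: "smooth f \<Longrightarrow> continuous_on S f"
  by (meson continuous_at_imp_continuous_on differentiable_imp_continuous_within smooth_differentiable)

lemma smooth_borel [measurable_dest]: "smooth f \<Longrightarrow> f \<in> borel_measurable borel"
  using borel_measurable_continuous_onI smooth_continuous_on by blast

lemma pderiv_dir_const [simp]: "pderiv_dir b (\<lambda>_. c) = (\<lambda>_. 0)"
  by (rule ext, rule pderiv_dir_eq[OF has_derivative_const])

lemma smooth_const: "smooth (\<lambda>_. c)"
  by (rule smoothI[where S="range (\<lambda>c _. c)"]) auto

lemma pderiv_dir_inner: "pderiv_dir b (\<lambda>x. complex_of_real (x \<bullet> e)) = (\<lambda>_. complex_of_real (b \<bullet> e))"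
  by (rule ext, rule pderiv_dir_eq) (auto intro!: derivative_eq_intros)

lemma smooth_inner: "smooth (\<lambda>x. complex_of_real (x \<bullet> e))"
proof (rule smoothI[where S="insert (\<lambda>x. complex_of_real (x \<bullet> e)) (range (\<lambda>c _. c))"], goal_cases)
  case (2 g x)
  have "((\<lambda>x. complex_of_real (x \<bullet> e)) has_derivative (\<lambda>k. complex_of_real (k \<bullet> e))) (at x)"
    by (auto intro!: derivative_eq_intros)
  then have "(\<lambda>x. complex_of_real (x \<bullet> e)) differentiable (at x)"
    unfolding differentiable_def by blast
  with 2 show ?case by auto
qed (auto simp: pderiv_dir_inner)

lemma pderiv_dir_add:
  assumes "smooth f" "smooth g"
  shows "pderiv_dir b (\<lambda>x. f x + g x) = (\<lambda>x. pderiv_dir b f x + pderiv_dir b g x)"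
  by (rule ext, rule pderiv_dir_eq) (auto intro!: derivative_eq_intros smooth_has_derivative assms)

lemma smooth_add:
  assumes "smooth f" "smooth g"
  shows "smooth (\<lambda>x. f x + g x)"
proof (rule smoothI[where S="{\<lambda>x. f x + g x | f g. smooth f \<and> smooth g}"], goal_cases)
  case 1
  then show ?case using assms by blast
next
  case (2 k x)
  then show ?case by (auto intro!: differentiable_add intro: smooth_differentiable)
next
  case (3 k b)
  then obtain f g where "k = (\<lambda>x. f x + g x)" "smooth f" "smooth g" by blast
  then show ?case using pderiv_dir_add[of f g b] smooth_pderiv_dir[OF _ 3(2)] by blast
qed

lemma pderiv_dir_mult:
  assumes "smooth f" "smooth g"
  shows "pderiv_dir b (\<lambda>x. f x * g x) = (\<lambda>x. f x * pderiv_dir b g x + pderiv_dir b f x * g x)"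
  by (rule ext, rule pderiv_dir_eq) (auto intro!: derivative_eq_intros smooth_has_derivative assms)

text \<open>Products alone are not stable under the product rule, but their finite sums are. This is
  the class handed to \<open>smoothI\<close> in \<open>smooth_mult\<close>.\<close>

inductive_set prod_span :: "('a::euclidean_space \<Rightarrow> complex) set" where
  "smooth f \<Longrightarrow> smooth g \<Longrightarrow> (\<lambda>x. f x * g x) \<in> prod_span"
| "f \<in> prod_span \<Longrightarrow> g \<in> prod_span \<Longrightarrow> (\<lambda>x. f x + g x) \<in> prod_span"

lemma smooth_mult:
  assumes "smooth f" "smooth g"
  shows "smooth (\<lambda>x. f x * g x)"
proof (rule smoothI[where S=prod_span], goal_cases)
  case 1
  then show ?case using assms by (rule prod_span.intros)
next
  case (2 k x)
  then show ?case
    by induction (auto intro!: differentiable_add differentiable_mult intro: smooth_differentiable)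
next
  case (3 k b)
  then have "pderiv_dir b k \<in> prod_span \<and> (\<forall>x. k differentiable (at x))"
  proof induction
    case (1 f g)
    then show ?case unfolding pderiv_dir_mult[OF 1(1,2)] using smooth_pderiv_dir
      by (auto intro!: prod_span.intros differentiable_mult intro: smooth_differentiable)
  next
    case (2 f g)
    then have "pderiv_dir b (\<lambda>x. f x + g x) = (\<lambda>x. pderiv_dir b f x + pderiv_dir b g x)"
      by (intro ext pderiv_dir_eq) (auto intro!: derivative_eq_intros pderiv_dir_has_derivative)
    then show ?case using 2 by (auto intro!: prod_span.intros differentiable_add)
  qed
  then show ?case by blast
qed

text \<open>The product and chain rules turn a term with factors \<open>g\<close> and
  \<open>f (q x)\<close> into two terms of the same kind: one with \<open>f'\<close> and
  \<open>g\<close> times a derivative of \<open>q\<close>, one with a derivative of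
  \<open>g\<close>. Finite sums of such terms are therefore stable.\<close>

inductive_set comp_span :: "('a::euclidean_space \<Rightarrow> real) \<Rightarrow> ('a \<Rightarrow> complex) set"
  for q where
  "smooth g \<Longrightarrow> smooth_real f \<Longrightarrow> (\<lambda>x. g x * complex_of_real (f (q x))) \<in> comp_span q"
| "f \<in> comp_span q \<Longrightarrow> g \<in> comp_span q \<Longrightarrow> (\<lambda>x. f x + g x) \<in> comp_span q"

text \<open>By uniqueness, the derivative of the embedded function is the embedded derivative of
  \<open>q\<close>, so its partial derivatives are real. This makes the real chain rule applicable
  to complex test functions built from real profiles.\<close>

lemma smooth_of_real_has_derivative:
  assumes "smooth (\<lambda>x. complex_of_real (q x))"
  shows "(q has_derivative (\<lambda>k. Re (pderiv_dir k (\<lambda>x. complex_of_real (q x)) x))) (at x)"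
    "complex_of_real (Re (pderiv_dir k (\<lambda>x. complex_of_real (q x)) x)) = pderiv_dir k (\<lambda>x. complex_of_real (q x)) x"
proof -
  have *: "((\<lambda>x. complex_of_real (q x)) has_derivative (\<lambda>k. pderiv_dir k (\<lambda>x. complex_of_real (q x)) x)) (at x)"
    using assms smooth_has_derivative by blast
  from has_derivative_Re[OF this] show q: "(q has_derivative (\<lambda>k. Re (pderiv_dir k (\<lambda>x. complex_of_real (q x)) x))) (at x)"
    by simp
  from has_derivative_of_real[OF this]
  show "complex_of_real (Re (pderiv_dir k (\<lambda>x. complex_of_real (q x)) x)) = pderiv_dir k (\<lambda>x. complex_of_real (q x)) x"
    using pderiv_dir_eq by metis
qed

lemma has_derivative_smooth_compose:
  assumes q: "smooth (\<lambda>x. complex_of_real (q x))" and f': "\<And>t. (f has_real_derivative f' t) (at t)"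
  shows "((\<lambda>x. complex_of_real (f (q x))) has_derivative
     (\<lambda>k. complex_of_real (f' (q x)) * pderiv_dir k (\<lambda>x. complex_of_real (q x)) x)) (at x)"
proof -
  have "((\<lambda>x. f (q x)) has_derivative (\<lambda>k. f' (q x) * Re (pderiv_dir k (\<lambda>x. complex_of_real (q x)) x))) (at x)"
    using has_derivative_compose[OF smooth_of_real_has_derivative(1)[OF q] f'[unfolded has_field_derivative_def]]
    by simp
  then have "((\<lambda>x. complex_of_real (f (q x))) has_derivative (\<lambda>k. complex_of_real (f' (q x) * Re (pderiv_dir k (\<lambda>x. complex_of_real (q x)) x)))) (at x)"
    by (rule has_derivative_of_real)
  then show ?thesis unfolding of_real_mult smooth_of_real_has_derivative(2)[OF q] .
qed

lemma pderiv_dir_compose: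
  assumes "smooth (\<lambda>x. complex_of_real (q x))" and "\<And>t. (f has_real_derivative f' t) (at t)"
  shows "pderiv_dir b (\<lambda>x. complex_of_real (f (q x))) =
    (\<lambda>x. complex_of_real (f' (q x)) * pderiv_dir b (\<lambda>x. complex_of_real (q x)) x)"
  by (rule ext, rule pderiv_dir_eq, rule has_derivative_smooth_compose[OF assms])

lemma smooth_compose:
  assumes q: "smooth (\<lambda>x. complex_of_real (q x))" and f: "smooth_real f"
  shows "smooth (\<lambda>x. complex_of_real (f (q x)))"
proof (rule smoothI[where S="comp_span q"])
  have *: "pderiv_dir b k \<in> comp_span q \<and> (\<forall>x. k differentiable (at x))"
    if "k \<in> comp_span q" "b \<in> Basis" for k b
    using that
  proof induction
    case (1 g f)
    obtain f' where f': "smooth_real f'" "\<And>t. (f has_real_derivative f' t) (at t)"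
      using smooth_real_deriv_ex 1 by metis
    note hd = has_derivative_mult[OF smooth_has_derivative[OF 1(1)] has_derivative_smooth_compose[OF q f'(2)]]
    have "pderiv_dir b (\<lambda>x. g x * complex_of_real (f (q x))) =
      (\<lambda>x. (g x * pderiv_dir b (\<lambda>x. complex_of_real (q x)) x) * complex_of_real (f' (q x)) + pderiv_dir b g x * complex_of_real (f (q x)))"
      using pderiv_dir_eq[OF hd] by (intro ext) (simp add: algebra_simps)
    then have "pderiv_dir b (\<lambda>x. g x * complex_of_real (f (q x))) \<in> comp_span q"
      using 1 f' q smooth_pderiv_dir by (auto intro!: comp_span.intros smooth_mult)
    then show ?case using hd unfolding differentiable_def by blast
  next
    case (2 f g)
    then have "pderiv_dir b (\<lambda>x. f x + g x) = (\<lambda>x. pderiv_dir b f x + pderiv_dir b g x)"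
      by (intro ext pderiv_dir_eq) (auto intro!: derivative_eq_intros pderiv_dir_has_derivative)
    then show ?case using 2 by (auto intro!: comp_span.intros differentiable_add)
  qed
  show "\<And>g b. g \<in> comp_span q \<Longrightarrow> b \<in> Basis \<Longrightarrow> pderiv_dir b g \<in> comp_span q" using * by blast
  show "\<And>g x. g \<in> comp_span q \<Longrightarrow> g differentiable (at x)" using * nonempty_Basis by blast
  show "(\<lambda>x. complex_of_real (f (q x))) \<in> comp_span q"
    using comp_span.intros(1)[OF smooth_const[of 1] f] by simp
qed

lemma smooth_sum: "finite I \<Longrightarrow> (\<And>i. i \<in> I \<Longrightarrow> smooth (f i)) \<Longrightarrow> smooth (\<lambda>x. \<Sum>i\<in>I. f i x)"
  by (induction I rule: finite_induct) (auto intro: smooth_const smooth_add)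

lemma smooth_prod: "finite I \<Longrightarrow> (\<And>i. i \<in> I \<Longrightarrow> smooth (f i)) \<Longrightarrow> smooth (\<lambda>x. \<Prod>i\<in>I. f i x)"
  by (induction I rule: finite_induct) (auto intro: smooth_const smooth_mult)

lemma smooth_diff: "smooth f \<Longrightarrow> smooth g \<Longrightarrow> smooth (\<lambda>x. f x - g x)"
  using smooth_add[of f "\<lambda>x. (-1) * g x"] smooth_mult[OF smooth_const[of "-1"], of g] by simp

lemma smooth_laplacian: "smooth f \<Longrightarrow> smooth (laplacian f)"
  unfolding laplacian_def[abs_def] by (intro smooth_sum smooth_pderiv_dir) auto

lemma norm_power2_sum_Basis: "(norm (x::'a::euclidean_space))\<^sup>2 = (\<Sum>b\<in>Basis. (x \<bullet> b)\<^sup>2)"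
  by (subst power2_norm_eq_inner, subst euclidean_inner) (simp add: power2_eq_square)

lemma smooth_norm_sq: "smooth (\<lambda>x. complex_of_real ((norm (x - y))\<^sup>2))"
proof -
  have "(\<lambda>x. complex_of_real ((norm (x - y))\<^sup>2)) =
    (\<lambda>x. \<Sum>b\<in>Basis. (complex_of_real (x \<bullet> b) - complex_of_real (y \<bullet> b)) * (complex_of_real (x \<bullet> b) - complex_of_real (y \<bullet> b)))"
    unfolding power2_norm_eq_inner
    by (subst euclidean_inner) (auto simp: fun_eq_iff inner_diff_left)
  moreover have "smooth \<dots>"
    by (intro smooth_sum smooth_mult smooth_diff smooth_inner smooth_const) auto
  ultimately show ?thesis by simp
qed

lemma pderiv_dir_norm_sq: "pderiv_dir b (\<lambda>x. complex_of_real ((norm (x - y))\<^sup>2)) = (\<lambda>x. complex_of_real (2 * ((x - y) \<bullet> b)))"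
proof (rule ext, rule pderiv_dir_eq)
  fix x
  show "((\<lambda>x. complex_of_real ((norm (x - y))\<^sup>2)) has_derivative (\<lambda>b. complex_of_real (2 * ((x - y) \<bullet> b)))) (at x)"
    unfolding power2_norm_eq_inner by (auto intro!: derivative_eq_intros simp: inner_commute)
qed

subsection \<open>Test functions and differentiation under the integral\<close>

lemma test_functionsI:
  assumes "smooth \<phi>" "compact K" "K \<subseteq> \<Omega>" "\<And>x. x \<notin> K \<Longrightarrow> \<phi> x = 0"
  shows "\<phi> \<in> test_functions \<Omega>"
proof -
  have "closure {x. \<phi> x \<noteq> 0} \<subseteq> K"
    using assms by (intro closure_minimal) (auto dest: compact_imp_closed)
  then show ?thesis
    using assms unfolding test_functions_def by (auto simp: compact_eq_bounded_closed intro: bounded_subset)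
qed

lemma test_functions_smooth: "\<phi> \<in> test_functions \<Omega> \<Longrightarrow> smooth \<phi>"
  by (simp add: test_functions_def)

lemma test_functionsE:
  assumes "\<phi> \<in> test_functions \<Omega>"
  obtains K where "compact K" "K \<subseteq> \<Omega>" "\<And>x. x \<notin> K \<Longrightarrow> \<phi> x = 0"
  using assms closure_subset[of "{x. \<phi> x \<noteq> 0}"] unfolding test_functions_def by blast

lemma test_functions_mono: "S \<subseteq> T \<Longrightarrow> test_functions S \<subseteq> test_functions T"
  by (auto simp: test_functions_def)

lemma test_functions_zero: "\<phi> \<in> test_functions \<Omega> \<Longrightarrow> x \<notin> \<Omega> \<Longrightarrow> \<phi> x = 0"
  using test_functionsE by blast

lemma test_functions_mult:
  assumes "\<phi> \<in> test_functions \<Omega>" "smooth f"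
  shows "(\<lambda>x. \<phi> x * f x) \<in> test_functions \<Omega>" "(\<lambda>x. f x * \<phi> x) \<in> test_functions \<Omega>"
proof -
  obtain K where K: "compact K" "K \<subseteq> \<Omega>" "\<And>x. x \<notin> K \<Longrightarrow> \<phi> x = 0"
    using assms test_functionsE by blast
  show "(\<lambda>x. \<phi> x * f x) \<in> test_functions \<Omega>" "(\<lambda>x. f x * \<phi> x) \<in> test_functions \<Omega>"
    by (rule test_functionsI[OF _ K(1,2)]; use assms K in \<open>auto simp: test_functions_smooth smooth_mult\<close>)+
qed

lemma pderiv_dir_zero_outside:
  assumes "compact K" "\<And>x. x \<notin> K \<Longrightarrow> \<phi> x = 0" "x \<notin> K"
  shows "pderiv_dir b \<phi> x = 0"
proof -
  have "pderiv_dir b \<phi> x = pderiv_dir b (\<lambda>_. 0) x"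
    using assms by (intro pderiv_dir_cong_open[of "- K"]) (auto simp: compact_imp_closed)
  then show ?thesis by simp
qed

lemma test_functions_pderiv_dir:
  assumes "\<phi> \<in> test_functions \<Omega>" "b \<in> Basis"
  shows "pderiv_dir b \<phi> \<in> test_functions \<Omega>"
proof -
  obtain K where K: "compact K" "K \<subseteq> \<Omega>" "\<And>x. x \<notin> K \<Longrightarrow> \<phi> x = 0"
    using assms test_functionsE by blast
  show ?thesis
    using assms by (intro test_functionsI[OF _ K(1,2)] smooth_pderiv_dir test_functions_smooth pderiv_dir_zero_outside[OF K(1,3)])
qed

lemma test_functions_laplacian:
  assumes "\<phi> \<in> test_functions \<Omega>"
  shows "laplacian \<phi> \<in> test_functions \<Omega>"
proof -
  obtain K where K: "compact K" "K \<subseteq> \<Omega>" "\<And>x. x \<notin> K \<Longrightarrow> \<phi> x = 0"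
    using assms test_functionsE by blast
  have "laplacian \<phi> x = 0" if "x \<notin> K" for x
    unfolding laplacian_def using that pderiv_dir_zero_outside[OF K(1)] K(3) by (intro sum.neutral) blast
  then show ?thesis
    using assms by (intro test_functionsI[OF _ K(1,2)] smooth_laplacian test_functions_smooth)
qed

section \<open>Radial test functions and cutoffs\<close>

lemma smooth_radial:
  assumes "smooth_real f"
  shows "smooth (\<lambda>x. complex_of_real (f ((norm (x - y))\<^sup>2 / r\<^sup>2)))"
  using smooth_compose[OF smooth_norm_sq smooth_real_affine[OF assms, of 0 "1 / r\<^sup>2"]] by simp

lemma radial_zero:
  assumes "\<And>s. s \<ge> 1 \<Longrightarrow> f s = (0::real)" "r > 0" "x \<notin> cball y r"
  shows "f ((norm (x - y))\<^sup>2 / r\<^sup>2) = 0"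
proof -
  have "r \<le> norm (x - y)" using assms by (simp add: dist_norm norm_minus_commute)
  then have "r\<^sup>2 \<le> (norm (x - y))\<^sup>2" using assms(2) by (intro power_mono) auto
  then show ?thesis using assms by (intro assms(1)) (simp add: field_simps)
qed

lemma radial_test:
  assumes "smooth_real f" "\<And>s. s \<ge> 1 \<Longrightarrow> f s = 0" "r > 0" "cball y r \<subseteq> \<Omega>"
  shows "(\<lambda>x. complex_of_real (f ((norm (x - y))\<^sup>2 / r\<^sup>2))) \<in> test_functions \<Omega>"
proof (rule test_functionsI[of _ "cball y r"])
  show "complex_of_real (f ((norm (x - y))\<^sup>2 / r\<^sup>2)) = 0" if "x \<notin> cball y r" for x
    using radial_zero[of f r x y, OF assms(2,3) that] by (simp only: of_real_0)
qed (use assms smooth_radial in auto)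

lemma flat_exp_mono: "s \<le> t \<Longrightarrow> flat_exp s \<le> flat_exp t"
  by (auto simp: flat_exp_def divide_simps)

lemma smooth_flat_exp_minus: "smooth_real (\<lambda>s. flat_exp (1 - s))"
  using smooth_real_affine[OF smooth_flat_exp, of 1 "-1"] by simp

lemma smooth_cutoff:
  fixes y :: "'a::euclidean_space"
  assumes "r > 0"
  obtains \<eta> :: "'a \<Rightarrow> real" where "smooth (\<lambda>x. complex_of_real (\<eta> x))" "\<And>x. 0 \<le> \<eta> x" "\<And>x. \<eta> x \<le> 1"
    "\<And>x. x \<in> ball y (r/2) \<Longrightarrow> \<eta> x = 1" "\<And>x. x \<notin> cball y r \<Longrightarrow> \<eta> x = 0"
proof -
  define R where "R x = flat_exp (1 - (norm (x - y))\<^sup>2 / r\<^sup>2)" for x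
  \<comment> \<open>\<open>v\<close> is the value of \<open>R\<close> on the sphere of radius r/2,
    since 1 - (1/2)^2 = 3/4. Hence \<open>v - R x \<le> 0\<close> on the half ball, which makes
    \<open>\<eta>\<close> equal to 1 there, while \<open>R x = 0\<close> outside the ball makes it
    0.\<close>
  define v where "v = flat_exp (3/4)"
  have v: "v > 0" and fv: "flat_exp v > 0" by (auto simp: v_def flat_exp_pos)
  define \<eta> where "\<eta> x = 1 - flat_exp (v - R x) / flat_exp v" for x
  have R0: "R x \<ge> 0" for x by (simp add: R_def flat_exp_nonneg)
  have sR: "smooth (\<lambda>x. complex_of_real (R x))"
    unfolding R_def by (rule smooth_radial[OF smooth_flat_exp_minus])
  have "smooth (\<lambda>x. complex_of_real (flat_exp (v + (-1) * R x)))"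
    by (rule smooth_compose[OF sR smooth_real_affine[OF smooth_flat_exp]])
  then have "smooth (\<lambda>x. 1 - complex_of_real (1 / flat_exp v) * complex_of_real (flat_exp (v + (-1) * R x)))"
    by (intro smooth_diff smooth_const smooth_mult)
  then have 1: "smooth (\<lambda>x. complex_of_real (\<eta> x))" by (simp add: \<eta>_def)
  have 2: "0 \<le> \<eta> x" "\<eta> x \<le> 1" for x
    using fv flat_exp_mono[of "v - R x" v] R0[of x] flat_exp_nonneg[of "v - R x"] by (auto simp: \<eta>_def)
  have 3: "\<eta> x = 1" if "x \<in> ball y (r/2)" for x
  proof -
    have "norm (x - y) \<le> r / 2" using that by (simp add: dist_norm norm_minus_commute)
    then have "(norm (x - y))\<^sup>2 \<le> (r / 2)\<^sup>2" by (intro power_mono) auto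
    then have "3/4 \<le> 1 - (norm (x - y))\<^sup>2 / r\<^sup>2" using assms by (simp add: field_simps)
    then have "v \<le> R x" unfolding v_def R_def by (rule flat_exp_mono)
    then show ?thesis by (simp add: \<eta>_def flat_exp_eq_0)
  qed
  have 4: "\<eta> x = 0" if "x \<notin> cball y r" for x
  proof -
    have "R x = 0" unfolding R_def
      by (rule radial_zero[of "\<lambda>s. flat_exp (1 - s)", OF _ assms that]) (simp add: flat_exp_eq_0)
    then show ?thesis using fv by (simp add: \<eta>_def)
  qed
  show ?thesis using that 1 2 3 4 by blast
qed

lemma smooth_Urysohn:
  fixes K :: "'a::euclidean_space set"
  assumes "compact K" "open \<Omega>" "K \<subseteq> \<Omega>"
  obtains \<kappa> :: "'a \<Rightarrow> real" where "(\<lambda>x. complex_of_real (\<kappa> x)) \<in> test_functions \<Omega>"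
    "\<And>x. 0 \<le> \<kappa> x" "\<And>x. \<kappa> x \<le> 1" "\<And>x. x \<in> K \<Longrightarrow> \<kappa> x = 1"
proof -
  define P where "P y r \<eta> \<longleftrightarrow> r > 0 \<and> cball y r \<subseteq> \<Omega> \<and> smooth (\<lambda>x. complex_of_real (\<eta> x)) \<and>
    (\<forall>x. 0 \<le> \<eta> x \<and> \<eta> x \<le> 1) \<and> (\<forall>x\<in>ball y (r/2). \<eta> x = (1::real)) \<and> (\<forall>x. x \<notin> cball y r \<longrightarrow> \<eta> x = 0)"
    for y :: 'a and r \<eta>
  have "\<exists>r \<eta>. P y r \<eta>" if "y \<in> K" for y
  proof -
    obtain r where r: "r > 0" "cball y r \<subseteq> \<Omega>"
      using assms \<open>y \<in> K\<close> open_contains_cball by blast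
    obtain \<eta> :: "'a \<Rightarrow> real" where "smooth (\<lambda>x. complex_of_real (\<eta> x))" "\<And>x. 0 \<le> \<eta> x" "\<And>x. \<eta> x \<le> 1"
      "\<And>x. x \<in> ball y (r/2) \<Longrightarrow> \<eta> x = 1" "\<And>x. x \<notin> cball y r \<Longrightarrow> \<eta> x = 0"
      using smooth_cutoff[OF r(1), of y] by blast
    then have "P y r \<eta>" using r by (simp add: P_def)
    then show ?thesis by blast
  qed
  then obtain r \<eta> where P: "\<And>y. y \<in> K \<Longrightarrow> P y (r y) (\<eta> y)" by metis
  then have r: "\<And>y. y \<in> K \<Longrightarrow> r y > 0" "\<And>y. y \<in> K \<Longrightarrow> cball y (r y) \<subseteq> \<Omega>"
    and \<eta>: "\<And>y. y \<in> K \<Longrightarrow> smooth (\<lambda>x. complex_of_real (\<eta> y x))"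
      "\<And>y x. y \<in> K \<Longrightarrow> 0 \<le> \<eta> y x" "\<And>y x. y \<in> K \<Longrightarrow> \<eta> y x \<le> 1"
      "\<And>y x. y \<in> K \<Longrightarrow> x \<in> ball y (r y/2) \<Longrightarrow> \<eta> y x = (1::real)"
      "\<And>y x. y \<in> K \<Longrightarrow> x \<notin> cball y (r y) \<Longrightarrow> \<eta> y x = 0"
    unfolding P_def by blast+
  have "K \<subseteq> (\<Union>y\<in>K. ball y (r y / 2))" using r by force
  then obtain F where F: "F \<subseteq> K" "finite F" "K \<subseteq> (\<Union>y\<in>F. ball y (r y / 2))"
    using compactE_image[OF assms(1), of K "\<lambda>y. ball y (r y / 2)"] by blast
  \<comment> \<open>A single vanishing factor gives \<open>\<kappa> x = 1\<close>, so overlapping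
    cutoffs require no normalisation by their sum.\<close>
  define \<kappa> where "\<kappa> x = 1 - (\<Prod>y\<in>F. 1 - \<eta> y x)" for x
  have "(\<lambda>x. complex_of_real (\<kappa> x)) \<in> test_functions \<Omega>"
  proof (rule test_functionsI[of _ "\<Union>y\<in>F. cball y (r y)"])
    have "smooth (\<lambda>x. 1 - (\<Prod>y\<in>F. 1 - complex_of_real (\<eta> y x)))"
      using F \<eta>(1) by (intro smooth_diff smooth_const smooth_prod) auto
    then show "smooth (\<lambda>x. complex_of_real (\<kappa> x))" by (simp add: \<kappa>_def)
    show "compact (\<Union>y\<in>F. cball y (r y))" using F by auto
    show "(\<Union>y\<in>F. cball y (r y)) \<subseteq> \<Omega>" using F r by blast
    fix x assume "x \<notin> (\<Union>y\<in>F. cball y (r y))"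
    then have "\<eta> y x = 0" if "y \<in> F" for y using \<eta>(5)[of y x] F that by blast
    then show "complex_of_real (\<kappa> x) = 0" by (simp add: \<kappa>_def)
  qed
  moreover have "0 \<le> \<kappa> x" "\<kappa> x \<le> 1" for x
  proof -
    show "0 \<le> \<kappa> x" unfolding \<kappa>_def using \<eta> F by (auto intro!: prod_le_1 simp: subset_iff)
    show "\<kappa> x \<le> 1" unfolding \<kappa>_def using \<eta> F by (auto intro!: prod_nonneg simp: subset_iff)
  qed
  moreover have "\<kappa> x = 1" if "x \<in> K" for x
  proof -
    obtain y where "y \<in> F" "x \<in> ball y (r y / 2)" using F \<open>x \<in> K\<close> by blast
    then have "1 - \<eta> y x = 0" using \<eta> F by auto
    then show ?thesis using F \<open>y \<in> F\<close> by (auto simp: \<kappa>_def)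
  qed
  ultimately show ?thesis using that by blast
qed

text \<open>The mean value inequality on the ball turns the bound on the derivative into the bound
  \<open>2 * g\<close> for the normalised remainder; dominated convergence along sequences finishes.
  The parameter lies in a normed space because it will be a shift or a radius in some applications
  and the centre of a kernel in another.\<close>

lemma has_derivative_integral_dominated:
  fixes k :: "'p::real_normed_vector \<Rightarrow> 'x \<Rightarrow> 'c::{banach, second_countable_topology}"
  assumes \<delta>: "\<delta> > 0" and int: "\<And>t. t \<in> ball t0 \<delta> \<Longrightarrow> integrable M (k t)"
    and der: "\<And>t x. t \<in> ball t0 \<delta> \<Longrightarrow> x \<in> space M \<Longrightarrow> ((\<lambda>t. k t x) has_derivative k' t x) (at t)"
    and bound: "\<And>t x s. t \<in> ball t0 \<delta> \<Longrightarrow> x \<in> space M \<Longrightarrow> norm (k' t x s) \<le> g x * norm s"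
    and g: "integrable M g" and meas: "\<And>s. (\<lambda>x. k' t0 x s) \<in> borel_measurable M"
  shows "((\<lambda>t. \<integral>x. k t x \<partial>M) has_derivative (\<lambda>s. \<integral>x. k' t0 x s \<partial>M)) (at t0)"
proof -
  have t0: "t0 \<in> ball t0 \<delta>" using \<delta> by simp
  have intk': "integrable M (\<lambda>x. k' t0 x s)" for s
    by (rule Bochner_Integration.integrable_bound[where f="\<lambda>x. g x * norm s"])
       (use g meas bound[OF t0] order_trans[OF bound[OF t0] abs_ge_self] in auto)
  have lin: "linear (k' t0 x)" if "x \<in> space M" for x
    using der[OF t0 that] has_derivative_linear by blast
  have gnn: "g x * norm s \<ge> 0" if "x \<in> space M" for x and s :: 'p
    using bound[OF t0 that, of s] norm_ge_zero order_trans by blast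
  have bl: "bounded_linear (\<lambda>s. \<integral>x. k' t0 x s \<partial>M)"
  proof (rule bounded_linear_intro[where K="\<integral>x. g x \<partial>M"])
    fix s t :: 'p and c :: real
    show "(\<integral>x. k' t0 x (s + t) \<partial>M) = (\<integral>x. k' t0 x s \<partial>M) + (\<integral>x. k' t0 x t \<partial>M)"
      by (subst Bochner_Integration.integral_add[symmetric])
         (auto intro!: intk' Bochner_Integration.integral_cong simp: linear_add[OF lin])
    show "(\<integral>x. k' t0 x (c *\<^sub>R s) \<partial>M) = c *\<^sub>R (\<integral>x. k' t0 x s \<partial>M)"
    proof -
      have "(\<integral>x. k' t0 x (c *\<^sub>R s) \<partial>M) = (\<integral>x. c *\<^sub>R k' t0 x s \<partial>M)"
        by (intro Bochner_Integration.integral_cong refl linear_scale lin)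
      then show ?thesis by simp
    qed
    have "norm (\<integral>x. k' t0 x s \<partial>M) \<le> (\<integral>x. g x * norm s \<partial>M)"
      by (rule order_trans[OF integral_norm_bound integral_mono]) (use g intk' bound[OF t0] in auto)
    then show "norm (\<integral>x. k' t0 x s \<partial>M) \<le> norm s * (\<integral>x. g x \<partial>M)"
      by (simp add: mult.commute)
  qed
  define q where "q h x = (k (t0 + h) x - k t0 x - k' t0 x h) /\<^sub>R norm h" for h x
  have qlim: "((\<lambda>h. q h x) \<longlongrightarrow> 0) (at 0)" if "x \<in> space M" for x
  proof -
    have "((\<lambda>h. norm (k (t0 + h) x - k t0 x - k' t0 x h) / norm h) \<longlongrightarrow> 0) (at 0)"
      using der[OF t0 that] unfolding has_derivative_at by blast
    then have "((\<lambda>h. norm (q h x)) \<longlongrightarrow> 0) (at 0)" by (simp add: q_def divide_inverse mult.commute)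
    then show ?thesis by (rule tendsto_norm_zero_cancel)
  qed
  have qb: "norm (q h x) \<le> 2 * g x" if "x \<in> space M" "h \<in> ball 0 \<delta>" "h \<noteq> 0" for x h
  proof -
    have h: "t0 + h \<in> ball t0 \<delta>" using that by (simp add: dist_norm)
    have "norm (k (t0 + h) x - k t0 x) \<le> g x * norm (t0 + h - t0)"
    proof (rule differentiable_bound[where S="ball t0 \<delta>" and f'="\<lambda>t. k' t x"])
      show "onorm (k' t x) \<le> g x" if "t \<in> ball t0 \<delta>" for t
        using bound[OF that \<open>x \<in> space M\<close>] gnn[OF \<open>x \<in> space M\<close>, of h] \<open>h \<noteq> 0\<close>
        by (intro onorm_bound) (auto simp: zero_le_mult_iff)
    qed (use der that h t0 in \<open>auto intro: has_derivative_at_withinI\<close>)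
    then have "norm (k (t0 + h) x - k t0 x - k' t0 x h) \<le> 2 * (g x * norm h)"
      using norm_triangle_ineq4[of "k (t0 + h) x - k t0 x" "k' t0 x h"] bound[OF t0 that(1), of h]
      by simp
    then show ?thesis using \<open>h \<noteq> 0\<close> unfolding q_def norm_scaleR
      by (simp add: divide_inverse[symmetric] inverse_eq_divide pos_divide_le_eq mult_ac)
  qed
  have qi: "integrable M (q h)" if "h \<in> ball 0 \<delta>" for h
    unfolding q_def using that t0 by (intro integrable_scaleR_right Bochner_Integration.integrable_diff int intk')
      (auto simp: dist_norm)
  have "((\<lambda>h. \<integral>x. q h x \<partial>M) \<longlongrightarrow> 0) (at 0 within ball 0 \<delta>)"
    unfolding tendsto_at_iff_sequentially
  proof (intro allI impI)
    fix X :: "nat \<Rightarrow> 'p" assume X: "\<forall>i. X i \<in> ball 0 \<delta> - {0}" "X \<longlonglongrightarrow> 0"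
    have "(\<lambda>i. \<integral>x. q (X i) x \<partial>M) \<longlonglongrightarrow> (\<integral>x. 0 \<partial>M)"
    proof (rule integral_dominated_convergence[where w="\<lambda>x. 2 * g x"])
      show "AE x in M. (\<lambda>i. q (X i) x) \<longlonglongrightarrow> 0"
      proof (rule AE_I2)
        fix x assume "x \<in> space M"
        then have "((\<lambda>h. q h x) \<circ> X) \<longlonglongrightarrow> 0"
          using qlim[unfolded tendsto_at_iff_sequentially] X by auto
        then show "(\<lambda>i. q (X i) x) \<longlonglongrightarrow> 0" by (simp add: o_def)
      qed
      show "AE x in M. norm (q (X i) x) \<le> 2 * g x" for i
        using qb X by (intro AE_I2) auto
      show "q (X i) \<in> borel_measurable M" for i
        using X by (intro borel_measurable_integrable qi) auto
    qed (use g in auto)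
    then show "((\<lambda>h. \<integral>x. q h x \<partial>M) \<circ> X) \<longlonglongrightarrow> 0" by (simp add: o_def)
  qed
  then have "((\<lambda>h. \<integral>x. q h x \<partial>M) \<longlongrightarrow> 0) (at 0)"
    using at_within_open[of "0::'p" "ball 0 \<delta>"] \<delta> by simp
  then have "((\<lambda>h. norm (\<integral>x. q h x \<partial>M)) \<longlongrightarrow> 0) (at 0)" by (rule tendsto_norm_zero)
  moreover have "\<forall>\<^sub>F h in at 0. norm (\<integral>x. q h x \<partial>M) =
    norm ((\<integral>x. k (t0 + h) x \<partial>M) - (\<integral>x. k t0 x \<partial>M) - (\<integral>x. k' t0 x h \<partial>M)) / norm h"
  proof -
    have "\<forall>\<^sub>F h in at (0::'p). h \<in> ball 0 \<delta>" using \<delta>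
      by (intro eventually_at_in_open') auto
    then show ?thesis
    proof eventually_elim
      case (elim h)
      then have h: "t0 + h \<in> ball t0 \<delta>" by (simp add: dist_norm)
      have "(\<integral>x. q h x \<partial>M) = ((\<integral>x. k (t0 + h) x \<partial>M) - (\<integral>x. k t0 x \<partial>M) - (\<integral>x. k' t0 x h \<partial>M)) /\<^sub>R norm h"
        unfolding q_def using int[OF h] int[OF t0] intk' by simp
      then show ?case by (simp add: divide_inverse)
    qed
  qed
  ultimately have "((\<lambda>h. norm ((\<integral>x. k (t0 + h) x \<partial>M) - (\<integral>x. k t0 x \<partial>M) - (\<integral>x. k' t0 x h \<partial>M)) / norm h) \<longlongrightarrow> 0) (at 0)"
    by (rule Lim_transform_eventually)
  then show ?thesis unfolding has_derivative_at using bl by blast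
qed

subsection \<open>Weak Laplacians\<close>

text \<open>Zero extensions of elements of C(closure \<Omega>) are of this kind
  (\<open>bounded_borel_C_closure\<close>), so their integrals against test functions can be taken
  over the whole space, where translations and dilations are available.\<close>

definition bounded_borel :: "('a::euclidean_space \<Rightarrow> complex) \<Rightarrow> bool" where
  "bounded_borel u \<longleftrightarrow> u \<in> borel_measurable borel \<and> bounded (range u)"

lemma bounded_borelE:
  assumes "bounded_borel u"
  obtains M where "M \<ge> 0" "\<And>x. norm (u x) \<le> M" "u \<in> borel_measurable borel"
  using assms unfolding bounded_borel_def bounded_iff by (metis norm_ge_zero order_trans rangeI)

lemma bounded_borelI:
  "u \<in> borel_measurable borel \<Longrightarrow> (\<And>x. norm (u x) \<le> M) \<Longrightarrow> bounded_borel u"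
  unfolding bounded_borel_def bounded_iff by auto

lemma bounded_borel_add:
  assumes "bounded_borel u" "bounded_borel v"
  shows "bounded_borel (\<lambda>x. u x + v x)"
proof -
  obtain M where M: "\<And>x. norm (u x) \<le> M" "u \<in> borel_measurable borel" using assms bounded_borelE by metis
  obtain N where N: "\<And>x. norm (v x) \<le> N" "v \<in> borel_measurable borel" using assms bounded_borelE by metis
  show ?thesis
    by (rule bounded_borelI[where M="M + N"]) (use M N in \<open>auto intro: norm_triangle_le add_mono\<close>)
qed

lemma bounded_borel_mult:
  assumes "bounded_borel u" "bounded_borel v"
  shows "bounded_borel (\<lambda>x. u x * v x)"
proof -
  obtain M where M: "M \<ge> 0" "\<And>x. norm (u x) \<le> M" "u \<in> borel_measurable borel" using assms bounded_borelE by metis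
  obtain N where N: "\<And>x. norm (v x) \<le> N" "v \<in> borel_measurable borel" using assms bounded_borelE by metis
  show ?thesis
    by (rule bounded_borelI[where M="M * N"]) (use M N in \<open>auto simp: norm_mult intro!: mult_mono\<close>)
qed

lemma bounded_borel_const: "bounded_borel (\<lambda>_. c)"
  by (rule bounded_borelI[where M="norm c"]) auto

lemma integrable_bounded_borel_supported:
  fixes u :: "'a::euclidean_space \<Rightarrow> complex"
  assumes "bounded_borel u" "\<And>x. x \<notin> K \<Longrightarrow> u x = 0" "compact K"
  shows "integrable lborel u"
proof -
  obtain M where M: "M \<ge> 0" "\<And>x. norm (u x) \<le> M" "u \<in> borel_measurable borel" using assms bounded_borelE by metis
  show ?thesis
  proof (rule Bochner_Integration.integrable_bound[where f="\<lambda>x. M * indicator K x"])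
    show "integrable lborel (\<lambda>x. M * indicator K x :: real)"
      using emeasure_compact_finite[OF assms(3)] compact_imp_closed[OF assms(3)] by simp
    show "AE x in lborel. norm (u x) \<le> norm (M * indicator K x :: real)"
      using M assms(2) by (auto simp: indicator_def)
  qed (use M in auto)
qed

lemma integrable_indicator_cball:
  "integrable lborel (\<lambda>x. M * indicator (cball (a::'a::euclidean_space) r) x :: real)"
  by (intro integrable_mult_right integrable_real_indicator)
     (use emeasure_compact_finite[OF compact_cball, of a r] in auto)

lemma bounded_borel_test:
  assumes "\<phi> \<in> test_functions \<Omega>"
  shows "bounded_borel \<phi>"
proof -
  obtain K where K: "compact K" "\<And>x. x \<notin> K \<Longrightarrow> \<phi> x = 0" using assms test_functionsE by metis
  have c: "continuous_on UNIV \<phi>" using assms smooth_continuous_on test_functions_smooth by blast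
  then have "bounded (\<phi> ` K)"
    by (intro compact_imp_bounded compact_continuous_image[OF continuous_on_subset K(1)]) auto
  then obtain M where "\<And>x. x \<in> K \<Longrightarrow> norm (\<phi> x) \<le> M" unfolding bounded_iff by auto
  then have "norm (\<phi> x) \<le> max M 0" for x using K(2)[of x] by (cases "x \<in> K") (simp_all add: max.coboundedI1)
  then show ?thesis using borel_measurable_continuous_onI[OF c] by (rule bounded_borelI[rotated])
qed

lemma integrable_bounded_borel_test:
  assumes "bounded_borel u" "\<phi> \<in> test_functions \<Omega>"
  shows "integrable lborel (\<lambda>x. u x * \<phi> x)"
proof -
  obtain K where K: "compact K" "\<And>x. x \<notin> K \<Longrightarrow> \<phi> x = 0" using assms test_functionsE by metis
  show ?thesis
    by (rule integrable_bounded_borel_supported[of _ K])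
       (use K assms bounded_borel_test in \<open>auto intro: bounded_borel_mult\<close>)
qed

lemma integrable_test: "\<phi> \<in> test_functions \<Omega> \<Longrightarrow> integrable lborel \<phi>"
  using integrable_bounded_borel_test[OF bounded_borel_const, of \<phi> \<Omega> 1] by simp

lemma smooth_mult_test_integrable:
  assumes "smooth f" "\<phi> \<in> test_functions \<Omega>"
  shows "integrable lborel (\<lambda>x. f x * \<phi> x)"
  using integrable_test test_functions_mult(2)[OF assms(2,1)] by blast

lemma lborel_integral_translate:
  fixes f :: "'a::euclidean_space \<Rightarrow> complex"
  assumes "f \<in> borel_measurable borel"
  shows "(\<integral>x. f (x + a) \<partial>lborel) = (\<integral>x. f x \<partial>lborel)"
proof -
  have "(\<integral>x. f x \<partial>lborel) = (\<integral>x. f x \<partial>distr lborel borel ((+) a))" by (simp add: lborel_distr_plus)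
  also have "\<dots> = (\<integral>x. f (a + x) \<partial>lborel)" using assms by (subst integral_distr) auto
  finally show ?thesis by (simp add: add.commute)
qed

lemma lborel_integral_affine:
  fixes f :: "'a::euclidean_space \<Rightarrow> complex"
  assumes "f \<in> borel_measurable borel" "c > 0"
  shows "(\<integral>x. f x \<partial>lborel) = of_real (c ^ DIM('a)) * (\<integral>x. f (a + c *\<^sub>R x) \<partial>lborel)"
proof -
  have "(\<integral>x. f x \<partial>lborel) = (\<integral>x. f x \<partial>density (distr lborel borel (\<lambda>x. a + c *\<^sub>R x)) (\<lambda>_. ennreal (\<bar>c\<bar> ^ DIM('a))))"
    using lborel_affine[of c a] assms by simp
  also have "\<dots> = (\<integral>x. (c ^ DIM('a)) *\<^sub>R f x \<partial>distr lborel borel (\<lambda>x. a + c *\<^sub>R x))"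
    using assms by (subst integral_density) auto
  also have "\<dots> = (\<integral>x. (c ^ DIM('a)) *\<^sub>R f (a + c *\<^sub>R x) \<partial>lborel)"
    using assms by (subst integral_distr) auto
  also have "\<dots> = of_real (c ^ DIM('a)) * (\<integral>x. f (a + c *\<^sub>R x) \<partial>lborel)"
    by (simp add: scaleR_conv_of_real)
  finally show ?thesis .
qed

text \<open>By translation invariance the integral of \<open>\<phi> (x + t *\<^sub>R b)\<close> does
  not depend on t, and its derivative at t = 0 is the integral in question.\<close>

lemma integral_pderiv_dir_test:
  fixes \<phi> :: "'a::euclidean_space \<Rightarrow> complex"
  assumes \<phi>: "\<phi> \<in> test_functions \<Omega>" and b: "b \<in> Basis"
  shows "(\<integral>x. pderiv_dir b \<phi> x \<partial>lborel) = 0"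
proof -
  have sm: "smooth \<phi>" and pt: "pderiv_dir b \<phi> \<in> test_functions \<Omega>"
    using \<phi> b test_functions_smooth test_functions_pderiv_dir by auto
  obtain K where K: "compact K" "\<And>x. x \<notin> K \<Longrightarrow> \<phi> x = 0" using \<phi> test_functionsE by metis
  then obtain \<rho> where \<rho>: "\<And>x. x \<in> K \<Longrightarrow> norm x \<le> \<rho>" using compact_imp_bounded bounded_iff by metis
  have p0: "pderiv_dir b \<phi> x = 0" if "norm x > \<rho>" for x
    using \<rho> that pderiv_dir_zero_outside[OF K] by (meson not_le)
  obtain M where M: "M \<ge> 0" "\<And>x. norm (pderiv_dir b \<phi> x) \<le> M"
    using bounded_borel_test[OF pt] bounded_borelE by metis
  have bm: "\<phi> \<in> borel_measurable borel" "pderiv_dir b \<phi> \<in> borel_measurable borel"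
    using sm pt test_functions_smooth smooth_borel by auto
  have "((\<lambda>t. \<integral>x. \<phi> (x + t *\<^sub>R b) \<partial>lborel) has_derivative
      (\<lambda>s. \<integral>x. of_real s * pderiv_dir b \<phi> (x + 0 *\<^sub>R b) \<partial>lborel)) (at (0::real))"
  \<comment> \<open>The support lies in the ball of radius \<open>\<rho>\<close>, and shifts by less
    than one unit keep it in the ball of radius \<open>\<rho> + 1\<close>.\<close>
  proof (rule has_derivative_integral_dominated[where \<delta>=1 and g="\<lambda>x. M * indicator (cball 0 (\<rho> + 1)) x"])
    show "integrable lborel (\<lambda>x. \<phi> (x + t *\<^sub>R b))" for t
    proof -
      have "integrable (distr lborel borel ((+) (t *\<^sub>R b))) \<phi>"
        using integrable_test[OF \<phi>] by (simp add: lborel_distr_plus)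
      then show ?thesis using bm by (subst (asm) integrable_distr_eq) (auto simp: add.commute)
    qed
    show "((\<lambda>t. \<phi> (x + t *\<^sub>R b)) has_derivative (\<lambda>s. of_real s * pderiv_dir b \<phi> (x + t *\<^sub>R b))) (at t)" for t x
    proof -
      have "((\<lambda>t. \<phi> (x + t *\<^sub>R b)) has_derivative (\<lambda>s. pderiv_dir (s *\<^sub>R b) \<phi> (x + t *\<^sub>R b))) (at t)"
        by (rule has_derivative_compose[OF _ smooth_has_derivative[OF sm]]) (auto intro!: derivative_eq_intros)
      moreover have "pderiv_dir (s *\<^sub>R b) \<phi> y = of_real s * pderiv_dir b \<phi> y" for s y
        using linear_scale[OF has_derivative_linear[OF smooth_has_derivative[OF sm]]]
        by (simp add: scaleR_conv_of_real)
      ultimately show ?thesis by simp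
    qed
    show "norm (of_real s * pderiv_dir b \<phi> (x + t *\<^sub>R b)) \<le> M * indicator (cball 0 (\<rho> + 1)) x * norm s"
      if "t \<in> ball 0 1" for t x s
    proof (cases "norm x \<le> \<rho> + 1")
      case True
      then show ?thesis using mult_left_mono[OF M(2), of "norm s"] by (simp add: norm_mult mult.commute)
    next
      case False
      have "norm (t *\<^sub>R b) \<le> 1" using that b by simp
      then have "norm (x + t *\<^sub>R b) > \<rho>"
        using False norm_triangle_ineq4[of "x + t *\<^sub>R b" "t *\<^sub>R b"] by simp
      then show ?thesis using p0 M(1) by simp
    qed
    show "(\<lambda>x. of_real s * pderiv_dir b \<phi> (x + 0 *\<^sub>R b)) \<in> borel_measurable lborel" for s
      using bm by simp
      show "integrable lborel (\<lambda>x::'a. M * indicator (cball 0 (\<rho> + 1)) x :: real)"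
      by (rule integrable_indicator_cball)
  qed auto
  moreover have "((\<lambda>t. \<integral>x. \<phi> (x + t *\<^sub>R b) \<partial>lborel) has_derivative (\<lambda>s. 0)) (at (0::real))"
    by (simp add: lborel_integral_translate[OF bm(1)])
  ultimately have "(\<lambda>s. \<integral>x. of_real s * pderiv_dir b \<phi> (x + 0 *\<^sub>R b) \<partial>lborel) = (\<lambda>s::real. 0)"
    by (rule has_derivative_unique)
  from fun_cong[OF this, of 1] show ?thesis by simp
qed

lemma integral_by_parts_test:
  assumes "smooth f" "\<phi> \<in> test_functions \<Omega>" "b \<in> Basis"
  shows "(\<integral>x. f x * pderiv_dir b \<phi> x \<partial>lborel) = - (\<integral>x. pderiv_dir b f x * \<phi> x \<partial>lborel)"
proof -
  have "0 = (\<integral>x. pderiv_dir b (\<lambda>x. f x * \<phi> x) x \<partial>lborel)"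
    using integral_pderiv_dir_test[OF test_functions_mult(2)[OF assms(2,1)] assms(3)] by simp
  also have "\<dots> = (\<integral>x. f x * pderiv_dir b \<phi> x + pderiv_dir b f x * \<phi> x \<partial>lborel)"
    using assms by (simp add: pderiv_dir_mult test_functions_smooth)
  also have "\<dots> = (\<integral>x. f x * pderiv_dir b \<phi> x \<partial>lborel) + (\<integral>x. pderiv_dir b f x * \<phi> x \<partial>lborel)"
    by (rule Bochner_Integration.integral_add)
       (use assms in \<open>auto intro!: smooth_mult_test_integrable smooth_pderiv_dir intro: test_functions_pderiv_dir\<close>)
  finally show ?thesis by (simp add: eq_neg_iff_add_eq_0)
qed

lemma integral_laplacian_symmetric:
  assumes "smooth f" "\<phi> \<in> test_functions \<Omega>"
  shows "(\<integral>x. f x * laplacian \<phi> x \<partial>lborel) = (\<integral>x. laplacian f x * \<phi> x \<partial>lborel)"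
proof -
  have 1: "(\<integral>x. f x * pderiv_dir b (pderiv_dir b \<phi>) x \<partial>lborel) = (\<integral>x. pderiv_dir b (pderiv_dir b f) x * \<phi> x \<partial>lborel)"
    if b: "b \<in> Basis" for b
    using integral_by_parts_test[OF assms(1) test_functions_pderiv_dir[OF assms(2) b] b]
      integral_by_parts_test[OF smooth_pderiv_dir[OF assms(1) b] assms(2) b] by simp
  have "(\<integral>x. f x * laplacian \<phi> x \<partial>lborel) = (\<Sum>b\<in>Basis. \<integral>x. f x * pderiv_dir b (pderiv_dir b \<phi>) x \<partial>lborel)"
    unfolding laplacian_def sum_distrib_left
    by (rule Bochner_Integration.integral_sum)
       (use assms in \<open>auto intro!: smooth_mult_test_integrable intro: test_functions_pderiv_dir\<close>)
  also have "\<dots> = (\<Sum>b\<in>Basis. \<integral>x. pderiv_dir b (pderiv_dir b f) x * \<phi> x \<partial>lborel)"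
    using 1 by simp
  also have "\<dots> = (\<integral>x. laplacian f x * \<phi> x \<partial>lborel)"
    unfolding laplacian_def sum_distrib_right
    by (rule Bochner_Integration.integral_sum[symmetric])
       (use assms in \<open>auto intro!: smooth_mult_test_integrable smooth_pderiv_dir\<close>)
  finally show ?thesis .
qed

text \<open>The integrals run over the whole space, but test functions vanish off \<open>S\<close>,
  so only the values of \<open>u\<close> and \<open>w\<close> on \<open>S\<close> count
  (\<open>weak_laplacian_cong\<close>).\<close>

definition weak_laplacian :: "'a::euclidean_space set \<Rightarrow> ('a \<Rightarrow> complex) \<Rightarrow> ('a \<Rightarrow> complex) \<Rightarrow> bool" where
  "weak_laplacian S u w \<longleftrightarrow> (\<forall>\<phi>\<in>test_functions S.
     (\<integral>x. u x * laplacian \<phi> x \<partial>lborel) = (\<integral>x. w x * \<phi> x \<partial>lborel))"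

lemma integral_lebesgue_on_supported:
  fixes f :: "'a::euclidean_space \<Rightarrow> complex"
  assumes "f \<in> borel_measurable borel" "\<Omega> \<in> sets lebesgue" "\<And>x. x \<notin> \<Omega> \<Longrightarrow> f x = 0"
  shows "(LINT x|lebesgue_on \<Omega>. f x) = (\<integral>x. f x \<partial>lborel)"
proof -
  have "(LINT x|lebesgue_on \<Omega>. f x) = (LINT x|lebesgue. indicator \<Omega> x *\<^sub>R f x)"
    using assms by (subst integral_restrict_space) auto
  also have "(\<lambda>x. indicator \<Omega> x *\<^sub>R f x) = f"
    using assms(3) by (auto simp: fun_eq_iff indicator_def)
  also have "(LINT x|lebesgue. f x) = (\<integral>x. f x \<partial>lborel)"
    using assms(1) by (intro integral_completion) auto
  finally show ?thesis .
qed

lemma has_dist_laplacian_weak: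
  assumes "has_dist_laplacian \<Omega> u w" "open \<Omega>" "S \<subseteq> \<Omega>" "bounded_borel u" "bounded_borel w"
  shows "weak_laplacian S u w"
  unfolding weak_laplacian_def
proof
  fix \<phi> assume "\<phi> \<in> test_functions S"
  then have \<phi>: "\<phi> \<in> test_functions \<Omega>" using assms(3) test_functions_mono by blast
  note L = test_functions_laplacian[OF \<phi>]
  have bm: "u \<in> borel_measurable borel" "w \<in> borel_measurable borel" "\<phi> \<in> borel_measurable borel"
    "laplacian \<phi> \<in> borel_measurable borel"
    using assms(4,5) smooth_borel test_functions_smooth[OF \<phi>] test_functions_smooth[OF L]
    by (auto simp: bounded_borel_def)
  have \<Omega>: "\<Omega> \<in> sets lebesgue" using assms(2) by (simp add: borel_open)
  have "(LINT x|lebesgue_on \<Omega>. u x * laplacian \<phi> x) = (\<integral>x. u x * laplacian \<phi> x \<partial>lborel)"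
    by (rule integral_lebesgue_on_supported[OF _ \<Omega>]) (use bm test_functions_zero[OF L] in auto)
  moreover have "(LINT x|lebesgue_on \<Omega>. w x * \<phi> x) = (\<integral>x. w x * \<phi> x \<partial>lborel)"
    by (rule integral_lebesgue_on_supported[OF _ \<Omega>]) (use bm test_functions_zero[OF \<phi>] in auto)
  ultimately show "(\<integral>x. u x * laplacian \<phi> x \<partial>lborel) = (\<integral>x. w x * \<phi> x \<partial>lborel)"
    using assms(1) \<phi> unfolding has_dist_laplacian_def by metis
qed

lemma weak_laplacian_smooth: "smooth f \<Longrightarrow> weak_laplacian S f (laplacian f)"
  unfolding weak_laplacian_def using integral_laplacian_symmetric by blast

lemma weak_laplacian_cong:
  assumes "weak_laplacian S u w" "\<And>x. x \<in> S \<Longrightarrow> u x = u' x" "\<And>x. x \<in> S \<Longrightarrow> w x = w' x"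
  shows "weak_laplacian S u' w'"
  unfolding weak_laplacian_def
proof
  fix \<phi> assume \<phi>: "\<phi> \<in> test_functions S"
  have "(\<lambda>x. u x * laplacian \<phi> x) = (\<lambda>x. u' x * laplacian \<phi> x)" "(\<lambda>x. w x * \<phi> x) = (\<lambda>x. w' x * \<phi> x)"
    using assms(2,3) test_functions_zero[OF \<phi>] test_functions_zero[OF test_functions_laplacian[OF \<phi>]]
    by (auto simp: fun_eq_iff)
  then show "(\<integral>x. u' x * laplacian \<phi> x \<partial>lborel) = (\<integral>x. w' x * \<phi> x \<partial>lborel)"
    using assms(1) \<phi> unfolding weak_laplacian_def by metis
qed

lemma weak_laplacian_add:
  assumes "weak_laplacian S u w" "weak_laplacian S u' w'"
    "bounded_borel u" "bounded_borel w" "bounded_borel u'" "bounded_borel w'"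
  shows "weak_laplacian S (\<lambda>x. u x + u' x) (\<lambda>x. w x + w' x)"
  unfolding weak_laplacian_def
proof
  fix \<phi> assume \<phi>: "\<phi> \<in> test_functions S"
  show "(\<integral>x. (u x + u' x) * laplacian \<phi> x \<partial>lborel) = (\<integral>x. (w x + w' x) * \<phi> x \<partial>lborel)"
    using assms \<phi> integrable_bounded_borel_test[OF _ \<phi>] integrable_bounded_borel_test[OF _ test_functions_laplacian[OF \<phi>]]
    unfolding weak_laplacian_def by (simp add: distrib_right)
qed

lemma weak_laplacian_cmult:
  assumes "weak_laplacian S u w"
  shows "weak_laplacian S (\<lambda>x. c * u x) (\<lambda>x. c * w x)"
  using assms unfolding weak_laplacian_def by (simp add: mult.assoc)

subsection \<open>Mean value formula\<close>

text \<open>The common support condition for profiles \<open>f\<close> of radial test functions \<open>f (norm x\<^sup>2)\<close>.\<close>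

definition profile :: "(real \<Rightarrow> real) \<Rightarrow> bool" where
  "profile f \<longleftrightarrow> smooth_real f \<and> (\<forall>s\<ge>1. f s = 0)"

lemma profile_zero: "profile f \<Longrightarrow> 1 \<le> s \<Longrightarrow> f s = 0"
  by (simp add: profile_def)

text \<open>Beyond 1 the function is locally zero, hence so is \<open>f'\<close>; the endpoint
  \<open>s = 1\<close> follows by continuity from the right.\<close>

lemma profile_deriv:
  assumes "profile f" and f': "smooth_real f'" "\<And>t. (f has_real_derivative f' t) (at t)"
  shows "profile f'"
  unfolding profile_def
proof (intro conjI f' allI impI)
  fix s :: real assume s: "1 \<le> s"
  have z: "f' t = 0" if "t > 1" for t
  proof -
    have "eventually (\<lambda>t. f t = 0) (nhds t)"
      using eventually_nhds_in_open[of "{1<..}" t] that assms(1)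
      by (auto simp: profile_def elim!: eventually_mono)
    then have "(f has_real_derivative 0) (at t)"
      by (subst DERIV_cong_ev[OF refl _ refl]) auto
    then show ?thesis using f'(2) DERIV_unique by blast
  qed
  have "isCont f' s"
    using smooth_real_continuous[OF f'(1), of UNIV] by (simp add: continuous_on_eq_continuous_at)
  moreover have "(\<lambda>n. s + 1 / real (Suc n)) \<longlonglongrightarrow> s + 0"
    by (intro tendsto_intros LIMSEQ_Suc lim_1_over_n)
  ultimately have "(\<lambda>n. f' (s + 1 / real (Suc n))) \<longlonglongrightarrow> f' s"
    using isCont_tendsto_compose by force
  moreover have "f' (s + 1 / real (Suc n)) = 0" for n
  proof -
    have "0 < 1 / real (Suc n)" by simp
    then show ?thesis using s by (intro z) linarith
  qed
  ultimately show "f' s = 0" by (simp add: LIMSEQ_const_iff)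
qed

lemma profile_antideriv:
  assumes "profile f"
  obtains F where "profile F" "\<And>t. (F has_real_derivative f t) (at t)"
proof -
  \<comment> \<open>Integrating from 1 makes \<open>F\<close> vanish on the half-line from 1 on, as
    a profile must.\<close>
  define F where "F u = (LBINT y=1..u. f y)" for u :: real
  have c: "continuous_on S f" for S using assms smooth_real_continuous by (simp add: profile_def)
  have D: "(F has_real_derivative f t) (at t)" for t
  proof -
    have "(F has_vector_derivative f t) (at t within {min 1 t - 1..max 1 t + 1})"
      unfolding F_def one_ereal_def
      by (rule interval_integral_FTC2) (use c in auto)
    then have "(F has_vector_derivative f t) (at t)"
      by (subst (asm) at_within_Icc_at) auto
    then show ?thesis by (simp add: has_real_derivative_iff_has_vector_derivative)
  qed
  have "F s = 0" if "1 \<le> s" for s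
  proof -
    have "F s = (LBINT y=1..s. 0)" unfolding F_def
      using that assms by (intro interval_integral_cong) (auto simp: profile_def einterval_def one_ereal_def min_def split: if_splits)
    then show ?thesis by simp
  qed
  moreover have "smooth_real F" using assms D smooth_real_antideriv by (auto simp: profile_def)
  ultimately show ?thesis using that D by (auto simp: profile_def)
qed

lemma profile_deriv_ex:
  assumes "profile f"
  obtains f' where "profile f'" "\<And>t. (f has_real_derivative f' t) (at t)"
  using assms profile_deriv smooth_real_deriv_ex unfolding profile_def by metis

lemma profile_flat_exp: "profile (\<lambda>s. flat_exp (1 - s))"
  by (simp add: profile_def smooth_flat_exp_minus flat_exp_eq_0)

lemma profile_times_ident: "profile f \<Longrightarrow> profile (\<lambda>s. s * f s)"
  by (simp add: profile_def smooth_real_times_ident)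

lemma profile_bounded:
  assumes "profile f"
  obtains C where "C \<ge> 0" "\<And>s. s \<ge> 0 \<Longrightarrow> \<bar>f s\<bar> \<le> C"
proof -
  have "bounded (f ` {0..1})"
    using assms smooth_real_continuous by (intro compact_imp_bounded compact_continuous_image) (auto simp: profile_def)
  then obtain C where "\<forall>x\<in>f ` {0..1}. norm x \<le> C" unfolding bounded_iff by blast
  then have C: "\<And>s. s \<in> {0..1} \<Longrightarrow> \<bar>f s\<bar> \<le> C" by auto
  have "\<bar>f s\<bar> \<le> max C 0" if "s \<ge> 0" for s
  proof (cases "s \<le> 1")
    case True
    then show ?thesis using C[of s] that by auto
  next
    case False
    then show ?thesis using assms by (simp add: profile_def)
  qed
  then show ?thesis using that[of "max C 0"] by simp
qed

text \<open>The mean is not normalised: on constants it multiplies by \<open>radial_mass\<close>.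
  With the scaling in the argument of \<open>u\<close>, the limit at radius 0 is plain dominated
  convergence; \<open>radial_mean_eq\<close> moves the scaling into the kernel, where it can be
  differentiated although \<open>u\<close> cannot.\<close>

definition radial_mean :: "(real \<Rightarrow> real) \<Rightarrow> ('a::euclidean_space \<Rightarrow> complex) \<Rightarrow> 'a \<Rightarrow> real \<Rightarrow> complex" where
  "radial_mean f u y \<epsilon> = (\<integral>x. u (y + \<epsilon> *\<^sub>R x) * of_real (f ((norm x)\<^sup>2)) \<partial>lborel)"

definition radial_mass :: "'a::euclidean_space itself \<Rightarrow> (real \<Rightarrow> real) \<Rightarrow> complex" where
  "radial_mass _ f = (\<integral>x. of_real (f ((norm x)\<^sup>2)) \<partial>(lborel :: 'a measure))"

lemma profile_borel: "profile f \<Longrightarrow> f \<in> borel_measurable borel"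
  using smooth_real_continuous[of f UNIV] borel_measurable_continuous_onI by (auto simp: profile_def)

lemma bounded_borel_profile:
  assumes "profile f"
  shows "bounded_borel (\<lambda>x::'a::euclidean_space. of_real (f ((norm (x - y))\<^sup>2 / r\<^sup>2)))"
proof -
  obtain C where C: "C \<ge> 0" "\<And>s. s \<ge> 0 \<Longrightarrow> \<bar>f s\<bar> \<le> C" using profile_bounded[OF assms] by blast
  show ?thesis
    by (rule bounded_borelI[where M=C]) (use C profile_borel[OF assms] in auto)
qed

lemma radial_mean_eq:
  fixes u :: "'a::euclidean_space \<Rightarrow> complex"
  assumes u: "bounded_borel u" and f: "profile f" and \<epsilon>: "\<epsilon> > 0"
  shows "radial_mean f u y \<epsilon> = (\<integral>z. u z * of_real (f ((norm (z - y))\<^sup>2 / \<epsilon>\<^sup>2) / \<epsilon> ^ DIM('a)) \<partial>lborel)"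
proof -
  have b: "(\<lambda>z. u z * of_real (f ((norm (z - y))\<^sup>2 / \<epsilon>\<^sup>2))) \<in> borel_measurable borel"
    using bounded_borel_mult[OF u bounded_borel_profile[OF f]] by (simp add: bounded_borel_def)
  have "(\<integral>z. u z * of_real (f ((norm (z - y))\<^sup>2 / \<epsilon>\<^sup>2)) \<partial>lborel) = of_real (\<epsilon> ^ DIM('a)) * radial_mean f u y \<epsilon>"
    unfolding radial_mean_def using lborel_integral_affine[OF b \<epsilon>, of y] \<epsilon>
    by (simp add: power_mult_distrib)
  moreover have "(\<integral>z. u z * of_real (f ((norm (z - y))\<^sup>2 / \<epsilon>\<^sup>2) / \<epsilon> ^ DIM('a)) \<partial>lborel)
     = (\<integral>z. u z * of_real (f ((norm (z - y))\<^sup>2 / \<epsilon>\<^sup>2)) \<partial>lborel) / of_real (\<epsilon> ^ DIM('a))"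
    by simp
  ultimately show ?thesis using \<epsilon> by simp
qed

lemma radial_mean_tendsto:
  fixes u :: "'a::euclidean_space \<Rightarrow> complex"
  assumes u: "bounded_borel u" and f: "profile f" and c: "isCont u y"
  shows "((\<lambda>\<epsilon>. radial_mean f u y \<epsilon>) \<longlongrightarrow> u y * radial_mass TYPE('a) f) (at 0)"
  unfolding tendsto_at_iff_sequentially
proof (intro allI impI)
  fix X :: "nat \<Rightarrow> real" assume X: "\<forall>i. X i \<in> UNIV - {0}" "X \<longlonglongrightarrow> 0"
  obtain M where M: "M \<ge> 0" "\<And>x. norm (u x) \<le> M" "u \<in> borel_measurable borel" using u bounded_borelE by metis
  obtain C where C: "C \<ge> 0" "\<And>s. s \<ge> 0 \<Longrightarrow> \<bar>f s\<bar> \<le> C" using profile_bounded[OF f] by blast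
  have "(\<lambda>i. radial_mean f u y (X i)) \<longlonglongrightarrow> (\<integral>x. u y * of_real (f ((norm (x::'a))\<^sup>2)) \<partial>lborel)"
    unfolding radial_mean_def
  proof (rule integral_dominated_convergence[where w="\<lambda>x. M * C * indicator (cball 0 1) x"])
    show "AE x in lborel. (\<lambda>i. u (y + X i *\<^sub>R x) * of_real (f ((norm x)\<^sup>2))) \<longlonglongrightarrow> u y * of_real (f ((norm x)\<^sup>2))"
    proof (intro AE_I2 tendsto_intros)
      fix x :: 'a
      have "(\<lambda>i. y + X i *\<^sub>R x) \<longlonglongrightarrow> y + 0 *\<^sub>R x" using X by (intro tendsto_intros)
      then show "(\<lambda>i. u (y + X i *\<^sub>R x)) \<longlonglongrightarrow> u y"
        using isCont_tendsto_compose[OF c] by simp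
    qed
    show "AE x in lborel. norm (u (y + X i *\<^sub>R x) * of_real (f ((norm x)\<^sup>2))) \<le> M * C * indicator (cball 0 1) x" for i
    proof (rule AE_I2)
      fix x :: 'a
      show "norm (u (y + X i *\<^sub>R x) * of_real (f ((norm x)\<^sup>2))) \<le> M * C * indicator (cball 0 1) x"
      proof (cases "norm x \<le> 1")
        case True
        then show ?thesis using mult_mono[OF M(2) C(2)[of "(norm x)\<^sup>2"] M(1)] by (simp add: norm_mult)
      next
        case False
        then have "1 \<le> (norm x)\<^sup>2" by (simp add: one_le_power)
        then show ?thesis using False profile_zero[OF f] by simp
      qed
    qed
    show "integrable lborel (\<lambda>x::'a. M * C * indicator (cball 0 1) x)"
      by (rule integrable_indicator_cball)
  qed (use M profile_borel[OF f] in measurable)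
  then show "((\<lambda>\<epsilon>. radial_mean f u y \<epsilon>) \<circ> X) \<longlonglongrightarrow> u y * radial_mass TYPE('a) f"
    by (simp add: o_def radial_mass_def)
qed

text \<open>Put s = |z - y|^2 / \<epsilon>^2 and q(s) = 2 d f(s) + 4 s f'(s). The kernel f(s) /
  \<epsilon>^d has \<epsilon>-derivative - q(s) / (2 \<epsilon>^(d+1)), and, as F' = f, the
  Laplacian in z of F(s) is q(s) / \<epsilon>^2. The first is thus -\<epsilon>/2 times
  \<epsilon>^(-d) times the second, and F(s) is an admissible test function.\<close>

lemma radial_mean_has_derivative:
  fixes u :: "'a::euclidean_space \<Rightarrow> complex"
  assumes u: "bounded_borel u" and w: "bounded_borel w" and uw: "weak_laplacian (ball y r) u w"
    and f: "profile f" and F: "profile F" "\<And>t. (F has_real_derivative f t) (at t)"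
    and \<epsilon>: "0 < \<epsilon>" "\<epsilon> < r"
  shows "((\<lambda>\<epsilon>. radial_mean f u y \<epsilon>) has_vector_derivative - of_real (\<epsilon> / 2) * radial_mean F w y \<epsilon>) (at \<epsilon>)"
proof -
  let ?d = "DIM('a)"
  obtain f' where f': "profile f'" "\<And>t. (f has_real_derivative f' t) (at t)"
    using profile_deriv_ex[OF f] by blast
  define q where "q s = 2 * ?d * f s + 4 * (s * f' s)" for s
  obtain Cf where Cf: "Cf \<ge> 0" "\<And>s. s \<ge> 0 \<Longrightarrow> \<bar>f s\<bar> \<le> Cf" using profile_bounded[OF f] by blast
  obtain Cg where Cg: "Cg \<ge> 0" "\<And>s. s \<ge> 0 \<Longrightarrow> \<bar>s * f' s\<bar> \<le> Cg"
    using profile_bounded[OF profile_times_ident[OF f'(1)]] by blast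
  define C where "C = 2 * ?d * Cf + 4 * Cg"
  have C0: "C \<ge> 0" using Cf Cg by (simp add: C_def)
  have qC: "\<bar>q s\<bar> \<le> C" if "s \<ge> 0" for s
  proof -
    have "\<bar>q s\<bar> \<le> \<bar>2 * ?d * f s\<bar> + \<bar>4 * (s * f' s)\<bar>" unfolding q_def by (rule abs_triangle_ineq)
    also have "\<dots> \<le> C" unfolding C_def using Cf(2)[OF that] Cg(2)[OF that]
      by (simp only: abs_mult) (intro add_mono mult_mono; simp add: abs_mult)
    finally show ?thesis .
  qed
  have q0: "q s = 0" if "s \<ge> 1" for s using that f f' by (simp add: q_def profile_def)
  have qb: "q \<in> borel_measurable borel"
    unfolding q_def using profile_borel[OF f] profile_borel[OF f'(1)] by measurable
  obtain M where M: "M \<ge> 0" "\<And>x. norm (u x) \<le> M" "u \<in> borel_measurable borel" using u bounded_borelE by metis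
  define S where "S t z = (norm (z - y))\<^sup>2 / t\<^sup>2" for t and z :: 'a
  have S0: "S t z \<ge> 0" for t z by (simp add: S_def)
  define k where "k t z = u z * of_real (f (S t z) / t ^ ?d)" for t z
  define k' where "k' t z s = of_real s * (u z * of_real (- (1/2) * q (S t z) / t ^ (?d + 1)))" for t z and s :: real
  have tpos: "t > \<epsilon> / 2 \<and> t < 2 * \<epsilon>" if "t \<in> ball \<epsilon> (\<epsilon> / 2)" for t
    using that \<epsilon> by (auto simp: dist_norm abs_if split: if_splits)
  have dS: "((\<lambda>t. S t z) has_real_derivative - 2 * S t z / t) (at t)" if "t > 0" for t z
    unfolding S_def using that
    by (auto intro!: derivative_eq_intros simp: power2_eq_square power_def field_simps)
  have dk: "((\<lambda>t. f (S t z) / t ^ ?d) has_real_derivative - (1/2) * q (S t z) / t ^ (?d + 1)) (at t)" if "t > 0" for t z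
  proof -
    have "((\<lambda>t. f (S t z)) has_real_derivative f' (S t z) * (- 2 * S t z / t)) (at t)"
      by (rule DERIV_chain2[OF f'(2) dS[OF that]])
    then have "((\<lambda>t. f (S t z) / t ^ ?d) has_real_derivative
       (f' (S t z) * (- 2 * S t z / t) * t ^ ?d - f (S t z) * (real ?d * t ^ (?d - 1))) / (t ^ ?d * t ^ ?d)) (at t)"
      using that by (intro DERIV_divide DERIV_pow) auto
    moreover have "t ^ ?d = t * t ^ (?d - 1)"
      by (metis DIM_positive Suc_diff_1 power_Suc)
    ultimately show ?thesis using that
      by (elim DERIV_cong) (simp add: q_def field_simps)
  qed
  have "((\<lambda>t. \<integral>z. k t z \<partial>lborel) has_derivative (\<lambda>s. \<integral>z. k' \<epsilon> z s \<partial>lborel)) (at \<epsilon>)"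
  \<comment> \<open>Radii t within \<epsilon>/2 of \<epsilon> stay above \<epsilon>/2, which bounds
    the negative power of t, and below 2 \<epsilon>, which bounds the supports.\<close>
  proof (rule has_derivative_integral_dominated[where \<delta>="\<epsilon>/2" and g="\<lambda>z. (M * (C / (\<epsilon> / 2) ^ (?d + 1))) * indicator (cball y (2 * \<epsilon>)) z"])
    show "integrable lborel (k t)" if "t \<in> ball \<epsilon> (\<epsilon> / 2)" for t
    proof (rule integrable_bounded_borel_supported[of _ "cball y t"])
      have "t > 0" using tpos[OF that] \<epsilon> by auto
      then show "k t z = 0" if "z \<notin> cball y t" for z
        using radial_zero[of f t z y, OF profile_zero[OF f] _ that] by (simp add: k_def S_def)
      have "bounded_borel (\<lambda>z. u z * of_real (f (S t z)) * of_real (inverse (t ^ ?d)))"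
        unfolding S_def by (intro bounded_borel_mult u bounded_borel_profile f bounded_borel_const)
      then show "bounded_borel (k t)" by (simp add: k_def[abs_def] divide_inverse mult.assoc)
    qed auto
    show "((\<lambda>t. k t z) has_derivative k' t z) (at t)" if "t \<in> ball \<epsilon> (\<epsilon> / 2)" for t z
    proof -
      have "t > 0" using tpos[OF that] \<epsilon> by auto
      have "((\<lambda>t. f (S t z) / t ^ ?d) has_derivative (\<lambda>s. (- (1/2) * q (S t z) / t ^ (?d + 1)) * s)) (at t)"
        using dk[OF \<open>t > 0\<close>, of z] unfolding has_field_derivative_def .
      then have "((\<lambda>t. complex_of_real (f (S t z) / t ^ ?d)) has_derivative (\<lambda>s. complex_of_real ((- (1/2) * q (S t z) / t ^ (?d + 1)) * s))) (at t)"
        by (rule has_derivative_of_real)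
      then have "((\<lambda>t. u z * complex_of_real (f (S t z) / t ^ ?d)) has_derivative (\<lambda>s. u z * complex_of_real ((- (1/2) * q (S t z) / t ^ (?d + 1)) * s))) (at t)"
        by (rule has_derivative_mult_right)
      then show ?thesis unfolding k_def k'_def by (simp add: mult_ac)
    qed
    show "norm (k' t z s) \<le> M * (C / (\<epsilon> / 2) ^ (?d + 1)) * indicator (cball y (2 * \<epsilon>)) z * norm s"
      if t: "t \<in> ball \<epsilon> (\<epsilon> / 2)" for t z s
    proof (cases "z \<in> cball y (2 * \<epsilon>)")
      case True
      have "t > 0" using tpos[OF t] \<epsilon> by auto
      have "norm (of_real (- (1/2) * q (S t z) / t ^ (?d + 1)) :: complex) = (\<bar>q (S t z)\<bar> / 2) / t ^ (?d + 1)"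
        using \<open>t > 0\<close> by (simp add: abs_mult norm_divide norm_mult norm_power)
      also have "\<dots> \<le> C / (\<epsilon> / 2) ^ (?d + 1)"
        using qC[OF S0, of t z] C0 \<epsilon> tpos[OF t] by (intro frac_le power_mono) auto
      finally have "norm (u z) * norm (of_real (- (1/2) * q (S t z) / t ^ (?d + 1)) :: complex) \<le> M * (C / (\<epsilon> / 2) ^ (?d + 1))"
        using M by (intro mult_mono) auto
      from mult_right_mono[OF this, of "norm s"] show ?thesis
        using True by (simp only: k'_def norm_mult norm_of_real) (simp add: mult_ac)
    next
      case False
      have "t > 0" "t < 2 * \<epsilon>" using tpos[OF t] \<epsilon> by auto
      then have "z \<notin> cball y t" using False by auto
      then have "q (S t z) = 0" unfolding S_def using radial_zero[of q t z y, OF q0 \<open>t > 0\<close>] by blast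
      then show ?thesis using False by (simp add: k'_def)
    qed
    show "integrable lborel (\<lambda>z. M * (C / (\<epsilon> / 2) ^ (?d + 1)) * indicator (cball y (2 * \<epsilon>)) z :: real)"
      by (rule integrable_indicator_cball)
    show "(\<lambda>z. k' \<epsilon> z s) \<in> borel_measurable lborel" for s
      unfolding k'_def S_def using M(3) qb by measurable
  qed (use \<epsilon> in auto)
  moreover have "(\<integral>z. k' \<epsilon> z s \<partial>lborel) = s *\<^sub>R (- of_real (\<epsilon> / 2) * radial_mean F w y \<epsilon>)" for s
  proof -
    let ?\<phi> = "\<lambda>z. complex_of_real (F (S \<epsilon> z))"
    have \<phi>: "?\<phi> \<in> test_functions (ball y r)"
      unfolding S_def using F \<epsilon> by (intro radial_test) (auto simp: profile_def)
    define Sq where "Sq z = complex_of_real (S \<epsilon> z)" for z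
    have sS: "smooth Sq"
    proof -
      have "Sq = (\<lambda>z. complex_of_real (1 / \<epsilon>\<^sup>2) * complex_of_real ((norm (z - y))\<^sup>2))"
        by (auto simp: Sq_def S_def fun_eq_iff)
      then show ?thesis using smooth_mult[OF smooth_const smooth_norm_sq] by metis
    qed
    have pS: "pderiv_dir b Sq = (\<lambda>z. complex_of_real (2 * ((z - y) \<bullet> b) / \<epsilon>\<^sup>2))" for b
    proof -
      have e: "Sq = (\<lambda>z. complex_of_real (1 / \<epsilon>\<^sup>2) * complex_of_real ((norm (z - y))\<^sup>2))"
        by (auto simp: Sq_def S_def fun_eq_iff)
      show ?thesis
        unfolding e pderiv_dir_mult[OF smooth_const smooth_norm_sq] pderiv_dir_norm_sq by (simp add: fun_eq_iff)
    qed
    have sf: "smooth_real f" "smooth_real f'" using f f' by (auto simp: profile_def)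
    have sl: "smooth (\<lambda>z. complex_of_real (2 * ((z - y) \<bullet> b) / \<epsilon>\<^sup>2))" if "b \<in> Basis" for b
      using smooth_pderiv_dir[OF sS that] by (simp add: pS)
    have pl: "pderiv_dir b (\<lambda>z. complex_of_real (2 * ((z - y) \<bullet> b) / \<epsilon>\<^sup>2)) = (\<lambda>z. complex_of_real (2 / \<epsilon>\<^sup>2))" if "b \<in> Basis" for b
    proof
      fix x
      have "((\<lambda>z. (2 / \<epsilon>\<^sup>2) * ((z - y) \<bullet> b)) has_derivative (\<lambda>h. (2 / \<epsilon>\<^sup>2) * (h \<bullet> b))) (at x)"
        by (rule has_derivative_mult_right) (auto intro!: derivative_eq_intros)
      then have "((\<lambda>z. complex_of_real ((2 / \<epsilon>\<^sup>2) * ((z - y) \<bullet> b))) has_derivative (\<lambda>h. complex_of_real ((2 / \<epsilon>\<^sup>2) * (h \<bullet> b)))) (at x)"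
        by (rule has_derivative_of_real)
      from pderiv_dir_eq[OF this, of b] show "pderiv_dir b (\<lambda>z. complex_of_real (2 * ((z - y) \<bullet> b) / \<epsilon>\<^sup>2)) x = complex_of_real (2 / \<epsilon>\<^sup>2)"
        using that by simp
    qed
    note pc = pderiv_dir_compose[OF sS[unfolded Sq_def[abs_def]]] and sc = smooth_compose[OF sS[unfolded Sq_def[abs_def]]]
    have p1: "pderiv_dir b ?\<phi> = (\<lambda>z. complex_of_real (f (S \<epsilon> z)) * complex_of_real (2 * ((z - y) \<bullet> b) / \<epsilon>\<^sup>2))" for b
      using pc[OF F(2)] pS unfolding Sq_def[abs_def] by simp
    have pf: "pderiv_dir b (\<lambda>z. complex_of_real (f (S \<epsilon> z))) = (\<lambda>z. complex_of_real (f' (S \<epsilon> z)) * complex_of_real (2 * ((z - y) \<bullet> b) / \<epsilon>\<^sup>2))" for b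
      using pc[OF f'(2)] pS unfolding Sq_def[abs_def] by simp
    have p2: "pderiv_dir b (pderiv_dir b ?\<phi>) z = complex_of_real (f (S \<epsilon> z) * (2 / \<epsilon>\<^sup>2) + f' (S \<epsilon> z) * (4 / \<epsilon> ^ 4) * (((z - y) \<bullet> b))\<^sup>2)"
      if "b \<in> Basis" for b z
      unfolding p1 pderiv_dir_mult[OF sc[OF sf(1)] sl[OF that]] pf pl[OF that]
      by (simp add: power2_eq_square power4_eq_xxxx field_simps)
    have "laplacian ?\<phi> z = complex_of_real (\<Sum>b\<in>Basis. f (S \<epsilon> z) * (2 / \<epsilon>\<^sup>2) + f' (S \<epsilon> z) * (4 / \<epsilon> ^ 4) * ((z - y) \<bullet> b)\<^sup>2)" for z
      unfolding laplacian_def of_real_sum by (rule sum.cong[OF refl p2])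
    moreover have "(\<Sum>b\<in>Basis. f (S \<epsilon> z) * (2 / \<epsilon>\<^sup>2) + f' (S \<epsilon> z) * (4 / \<epsilon> ^ 4) * ((z - y) \<bullet> b)\<^sup>2) = q (S \<epsilon> z) / \<epsilon>\<^sup>2" for z
    proof -
      have "(\<Sum>b\<in>Basis. ((z - y) \<bullet> b)\<^sup>2) = (norm (z - y))\<^sup>2"
        by (rule norm_power2_sum_Basis[symmetric])
      moreover have "(norm (z - y))\<^sup>2 = \<epsilon>\<^sup>2 * S \<epsilon> z" using \<epsilon> by (simp add: S_def)
      moreover have "(\<Sum>b\<in>Basis. f (S \<epsilon> z) * (2 / \<epsilon>\<^sup>2) + f' (S \<epsilon> z) * (4 / \<epsilon> ^ 4) * ((z - y) \<bullet> b)\<^sup>2)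
        = ?d * (f (S \<epsilon> z) * (2 / \<epsilon>\<^sup>2)) + f' (S \<epsilon> z) * (4 / \<epsilon> ^ 4) * (\<Sum>b\<in>Basis. ((z - y) \<bullet> b)\<^sup>2)"
        by (simp only: sum.distrib sum_distrib_left sum_constant)
      ultimately show ?thesis using \<epsilon>
        by (simp add: q_def power4_eq_xxxx power2_eq_square field_simps)
    qed
    ultimately have L: "laplacian ?\<phi> z = complex_of_real (q (S \<epsilon> z) / \<epsilon>\<^sup>2)" for z by (simp only:)
    have "(\<integral>z. u z * complex_of_real (q (S \<epsilon> z) / \<epsilon>\<^sup>2) \<partial>lborel) = (\<integral>z. w z * ?\<phi> z \<partial>lborel)"
      using uw \<phi> unfolding weak_laplacian_def L[symmetric] by blast
    moreover have "k' \<epsilon> z s = complex_of_real (- s * (\<epsilon> / 2) / \<epsilon> ^ ?d) * (u z * complex_of_real (q (S \<epsilon> z) / \<epsilon>\<^sup>2))" for z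
      unfolding k'_def using \<epsilon> by (simp add: power2_eq_square field_simps)
    ultimately have "(\<integral>z. k' \<epsilon> z s \<partial>lborel) = complex_of_real (- s * (\<epsilon> / 2) / \<epsilon> ^ ?d) * (\<integral>z. w z * ?\<phi> z \<partial>lborel)"
      by (simp only: integral_mult_right_zero)
    also have "(\<integral>z. w z * ?\<phi> z \<partial>lborel) = of_real (\<epsilon> ^ ?d) * radial_mean F w y \<epsilon>"
      unfolding radial_mean_eq[OF w F(1) \<epsilon>(1)] S_def using \<epsilon> by simp
    finally show ?thesis using \<epsilon> by (simp add: scaleR_conv_of_real)
  qed
  ultimately have "((\<lambda>t. \<integral>z. k t z \<partial>lborel) has_vector_derivative - of_real (\<epsilon> / 2) * radial_mean F w y \<epsilon>) (at \<epsilon>)"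
    unfolding has_vector_derivative_def by simp
  then show ?thesis
  proof (rule has_vector_derivative_transform_within_open[of _ _ _ "{0<..}"])
    fix t :: real assume "t \<in> {0<..}"
    then show "(\<integral>z. k t z \<partial>lborel) = radial_mean f u y t"
      by (simp add: radial_mean_eq[OF u f] k_def S_def)
  qed (use \<epsilon> in auto)
qed

text \<open>Under \<open>A\<close> the derivative computed above is - (\<epsilon>/2) A, which
  integrates exactly; the constant of integration is the limit at radius 0. The hypothesis
  \<open>A\<close> covers harmonic u (with w = 0), constant w, and w a multiple of a harmonic
  function, whose own means are constant.\<close>

lemma mean_value_formula:
  fixes u :: "'a::euclidean_space \<Rightarrow> complex"
  assumes u: "bounded_borel u" and w: "bounded_borel w" and uw: "weak_laplacian (ball y r) u w"
    and c: "isCont u y"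
    and f: "profile f" and F: "profile F" "\<And>t. (F has_real_derivative f t) (at t)"
    and A: "\<And>\<epsilon>. 0 < \<epsilon> \<Longrightarrow> \<epsilon> < r \<Longrightarrow> radial_mean F w y \<epsilon> = A"
    and \<epsilon>: "0 < \<epsilon>" "\<epsilon> < r"
  shows "radial_mean f u y \<epsilon> = u y * radial_mass TYPE('a) f - of_real (\<epsilon>\<^sup>2 / 4) * A"
proof -
  define G where "G t = radial_mean f u y t + of_real (t\<^sup>2 / 4) * A" for t
  have dG: "(G has_vector_derivative 0) (at t)" if "0 < t" "t < r" for t
  proof -
    have "((\<lambda>t. complex_of_real (t\<^sup>2 / 4) * A) has_vector_derivative of_real (t / 2) * A) (at t)"
    proof -
      have "((\<lambda>t::real. t\<^sup>2 / 4) has_derivative (\<lambda>s. s * (t / 2))) (at t)"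
        by (auto intro!: derivative_eq_intros)
      then have "((\<lambda>t. complex_of_real (t\<^sup>2 / 4)) has_derivative (\<lambda>s. complex_of_real (s * (t / 2)))) (at t)"
        by (rule has_derivative_of_real)
      then have "((\<lambda>t. complex_of_real (t\<^sup>2 / 4) * A) has_derivative (\<lambda>s. complex_of_real (s * (t / 2)) * A)) (at t)"
        by (rule has_derivative_mult_left)
      then show ?thesis by (simp add: has_vector_derivative_def scaleR_conv_of_real mult.assoc)
    qed
    from has_vector_derivative_add[OF radial_mean_has_derivative[OF u w uw f F that] this]
    show ?thesis unfolding G_def by (simp add: A[OF that])
  qed
  have const: "G t = G \<epsilon>" if "t \<in> {0<..<r}" for t
  proof (rule has_derivative_zero_unique[of "{0<..<r}"])
    show "(G has_derivative (\<lambda>h. 0)) (at x within {0<..<r})" if "x \<in> {0<..<r}" for x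
      using dG[of x] that by (auto simp: has_vector_derivative_def intro: has_derivative_at_withinI)
  qed (use that \<epsilon> in auto)
  have "(G \<longlongrightarrow> u y * radial_mass TYPE('a) f + of_real (0\<^sup>2 / 4) * A) (at 0)"
    unfolding G_def by (intro tendsto_intros radial_mean_tendsto u f c) simp
  then have "(G \<longlongrightarrow> u y * radial_mass TYPE('a) f) (at_right 0)"
    by (simp add: filterlim_at_split)
  moreover have "(G \<longlongrightarrow> G \<epsilon>) (at_right 0)"
  proof (rule Lim_transform_eventually[OF tendsto_const])
    show "\<forall>\<^sub>F t in at_right 0. G \<epsilon> = G t"
      using const \<epsilon> unfolding eventually_at_right_field by (metis greaterThanLessThan_iff less_trans)
  qed
  ultimately have "G \<epsilon> = u y * radial_mass TYPE('a) f"
    using tendsto_unique trivial_limit_at_right_real by blast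
  then show ?thesis by (simp add: G_def algebra_simps)
qed

subsection \<open>Weyl's lemma and harmonic charts\<close>

text \<open>The points of \<open>S\<close> with \<open>g x \<noteq> 0\<close> form an open null set.
  Continuity is local because in the applications \<open>g\<close> is controlled only inside a ball
  or jumps across the boundary of a domain.\<close>

lemma nonneg_integral_zero_continuous:
  fixes g :: "'a::euclidean_space \<Rightarrow> real"
  assumes "integrable lborel g" "\<And>x. 0 \<le> g x" "(\<integral>x. g x \<partial>lborel) = 0"
    and S: "open S" "continuous_on S g" and "x \<in> S"
  shows "g x = 0"
proof (rule ccontr)
  assume "g x \<noteq> 0"
  have "AE x in lborel. g x = 0"
    using integral_nonneg_eq_0_iff_AE[OF assms(1)] assms(2,3) by auto
  then obtain N where N: "N \<in> null_sets lborel" "{x. g x \<noteq> 0} \<subseteq> N"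
    by (auto elim!: AE_E simp: null_sets_def)
  then have "negligible N"
    by (simp add: negligible_iff_null_sets null_sets_completionI)
  moreover have "open {x \<in> S. g x \<noteq> 0}"
    using continuous_open_preimage[OF S(2,1), of "- {0}"] by (simp add: vimage_def Int_def open_Compl)
  moreover have "negligible {x \<in> S. g x \<noteq> 0}"
    by (rule negligible_subset[OF \<open>negligible N\<close>]) (use N(2) in blast)
  ultimately have "{x \<in> S. g x \<noteq> 0} = {}" using open_not_negligible by blast
  then show False using \<open>g x \<noteq> 0\<close> \<open>x \<in> S\<close> by blast
qed

text \<open>For p near y the mean value formula writes \<open>u p\<close> as an integral in which p
  occurs only in a smooth kernel, so the derivative falls on the kernel. The explicit formula, not
  mere differentiability, is what later shows that the gradient of \<open>h\<close>
  vanishes.\<close>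

lemma weyl_derivative:
  fixes u :: "'a::euclidean_space \<Rightarrow> complex"
  assumes u: "bounded_borel u" and harm: "weak_laplacian (ball y r) u (\<lambda>_. 0)"
    and c: "continuous_on (ball y r) u"
    and f: "profile f" and f': "profile f'" "\<And>t. (f has_real_derivative f' t) (at t)"
    and m: "radial_mass TYPE('a) f \<noteq> 0" and \<epsilon>: "0 < \<epsilon>" "\<epsilon> < r"
  shows "(u has_derivative (\<lambda>s. (\<integral>z. u z * of_real (f' ((norm (z - y))\<^sup>2 / \<epsilon>\<^sup>2) * (2 * ((y - z) \<bullet> s) / \<epsilon>\<^sup>2) / \<epsilon> ^ DIM('a)) \<partial>lborel)
      / radial_mass TYPE('a) f)) (at y)"
proof -
  let ?d = "DIM('a)"
  obtain F where F: "profile F" "\<And>t. (F has_real_derivative f t) (at t)" using profile_antideriv[OF f] by blast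
  \<comment> \<open>Half of the room left: balls of radius \<open>r - \<delta> > \<epsilon>\<close>
    about points of \<open>ball y \<delta>\<close> stay inside \<open>ball y r\<close>, so one
    \<open>\<epsilon>\<close> serves all these points.\<close>
  define \<delta> where "\<delta> = (r - \<epsilon>) / 2"
  have \<delta>: "\<delta> > 0" "\<epsilon> + \<delta> < r" using \<epsilon> by (auto simp: \<delta>_def field_simps)
  define S where "S p z = (norm (z - p))\<^sup>2 / \<epsilon>\<^sup>2" for p z :: 'a
  have S0: "S p z \<ge> 0" for p z by (simp add: S_def)
  define k where "k p z = u z * of_real (f (S p z) / \<epsilon> ^ ?d)" for p z
  define k' where "k' p z s = u z * of_real (f' (S p z) * (2 * ((p - z) \<bullet> s) / \<epsilon>\<^sup>2) / \<epsilon> ^ ?d)" for p z s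
  obtain C where C: "C \<ge> 0" "\<And>s. s \<ge> 0 \<Longrightarrow> \<bar>f' s\<bar> \<le> C" using profile_bounded[OF f'(1)] by blast
  obtain M where M: "M \<ge> 0" "\<And>x. norm (u x) \<le> M" "u \<in> borel_measurable borel" using u bounded_borelE by metis
  have rep: "u p * radial_mass TYPE('a) f = (\<integral>z. k p z \<partial>lborel)" if "p \<in> ball y \<delta>" for p
  proof -
    have sub: "ball p (r - \<delta>) \<subseteq> ball y r"
      using that dist_triangle[of y _ p] by (smt (verit) mem_ball subsetI)
    have "weak_laplacian (ball p (r - \<delta>)) u (\<lambda>_. 0)"
      using harm test_functions_mono[OF sub] unfolding weak_laplacian_def by blast
    moreover have "isCont u p"
    proof -
      have "p \<in> ball y r" using that \<delta> \<epsilon> by simp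
      then show ?thesis using c continuous_on_eq_continuous_at[OF open_ball, of y r u] by blast
    qed
    moreover have "radial_mean F (\<lambda>_. 0) p e = 0" for e by (simp add: radial_mean_def)
    ultimately have "radial_mean f u p \<epsilon> = u p * radial_mass TYPE('a) f - of_real (\<epsilon>\<^sup>2 / 4) * 0"
      using \<delta> \<epsilon> by (intro mean_value_formula[OF u bounded_borel_const _ _ f F]) auto
    then show ?thesis using radial_mean_eq[OF u f \<epsilon>(1)] by (simp add: k_def S_def)
  qed
  have "((\<lambda>p. \<integral>z. k p z \<partial>lborel) has_derivative (\<lambda>s. \<integral>z. k' y z s \<partial>lborel)) (at y)"
  proof (rule has_derivative_integral_dominated[where \<delta>=\<delta> and g="\<lambda>z. M * (C * (2 * \<epsilon> / \<epsilon>\<^sup>2) / \<epsilon> ^ ?d) * indicator (cball y r) z"])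
    show "integrable lborel (k p)" for p
    proof (rule integrable_bounded_borel_supported[of _ "cball p \<epsilon>"])
      show "k p z = 0" if "z \<notin> cball p \<epsilon>" for z
        using radial_zero[of f \<epsilon> z p, OF profile_zero[OF f] _ that] \<epsilon> by (simp add: k_def S_def)
      have "bounded_borel (\<lambda>z. u z * of_real (f (S p z)) * of_real (inverse (\<epsilon> ^ ?d)))"
        unfolding S_def by (intro bounded_borel_mult u bounded_borel_profile f bounded_borel_const)
      then show "bounded_borel (k p)" by (simp add: k_def[abs_def] divide_inverse mult.assoc)
    qed auto
    show "((\<lambda>p. k p z) has_derivative k' p z) (at p)" for p z
    proof -
      have "((\<lambda>p. S p z) has_derivative (\<lambda>s. 2 * ((p - z) \<bullet> s) / \<epsilon>\<^sup>2)) (at p)"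
      proof -
        have "((\<lambda>p. (z - p) \<bullet> (z - p) * (1 / \<epsilon>\<^sup>2)) has_derivative (\<lambda>s. ((z - p) \<bullet> (- s) + (- s) \<bullet> (z - p)) * (1 / \<epsilon>\<^sup>2))) (at p)"
          by (rule has_derivative_mult_left) (auto intro!: derivative_eq_intros)
        moreover have "(\<lambda>s. ((z - p) \<bullet> (- s) + (- s) \<bullet> (z - p)) * (1 / \<epsilon>\<^sup>2)) = (\<lambda>s. 2 * ((p - z) \<bullet> s) / \<epsilon>\<^sup>2)"
          by (auto simp: fun_eq_iff inner_diff_left inner_diff_right inner_commute field_simps)
        ultimately show ?thesis by (simp add: S_def power2_norm_eq_inner)
      qed
      from has_derivative_compose[OF this f'(2)[unfolded has_field_derivative_def]]
      have "((\<lambda>p. f (S p z) * (1 / \<epsilon> ^ ?d)) has_derivative (\<lambda>s. f' (S p z) * (2 * ((p - z) \<bullet> s) / \<epsilon>\<^sup>2) * (1 / \<epsilon> ^ ?d))) (at p)"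
        by (rule has_derivative_mult_left)
      then have "((\<lambda>p. complex_of_real (f (S p z) * (1 / \<epsilon> ^ ?d))) has_derivative (\<lambda>s. complex_of_real (f' (S p z) * (2 * ((p - z) \<bullet> s) / \<epsilon>\<^sup>2) * (1 / \<epsilon> ^ ?d)))) (at p)"
        by (rule has_derivative_of_real)
      from has_derivative_mult_right[OF this, of "u z"]
      show ?thesis unfolding k_def k'_def by simp
    qed
    show "norm (k' p z s) \<le> M * (C * (2 * \<epsilon> / \<epsilon>\<^sup>2) / \<epsilon> ^ ?d) * indicator (cball y r) z * norm s"
      if "p \<in> ball y \<delta>" for p z s
    proof (cases "norm (z - p) \<le> \<epsilon>")
      case True
      have "dist y z < r" using that True \<delta> dist_triangle[of y z p] by (simp add: dist_norm norm_minus_commute)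
      then have z: "indicator (cball y r) z = (1::real)" by simp
      have "\<bar>(p - z) \<bullet> s\<bar> \<le> \<epsilon> * norm s"
        using Cauchy_Schwarz_ineq2[of "p - z" s] True mult_right_mono[of "norm (p - z)" \<epsilon> "norm s"]
        by (simp add: norm_minus_commute)
      then have "\<bar>2 * ((p - z) \<bullet> s) / \<epsilon>\<^sup>2\<bar> \<le> 2 * \<epsilon> / \<epsilon>\<^sup>2 * norm s"
        by (simp add: abs_mult divide_right_mono)
      then have "\<bar>f' (S p z)\<bar> * \<bar>2 * ((p - z) \<bullet> s) / \<epsilon>\<^sup>2\<bar> \<le> C * (2 * \<epsilon> / \<epsilon>\<^sup>2 * norm s)"
        using C S0 by (intro mult_mono) auto
      then have "\<bar>f' (S p z)\<bar> * \<bar>2 * ((p - z) \<bullet> s) / \<epsilon>\<^sup>2\<bar> / \<epsilon> ^ ?d \<le> C * (2 * \<epsilon> / \<epsilon>\<^sup>2 * norm s) / \<epsilon> ^ ?d"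
        using \<epsilon> by (intro divide_right_mono) auto
      then have "norm (u z) * (\<bar>f' (S p z)\<bar> * \<bar>2 * ((p - z) \<bullet> s) / \<epsilon>\<^sup>2\<bar> / \<epsilon> ^ ?d) \<le> M * (C * (2 * \<epsilon> / \<epsilon>\<^sup>2 * norm s) / \<epsilon> ^ ?d)"
        by (rule mult_mono[OF M(2) _ M(1)]) (use \<epsilon> in auto)
      then show ?thesis using \<epsilon> unfolding k'_def norm_mult norm_of_real abs_divide abs_mult z
        by (simp add: mult_ac)
    next
      case False
      then have "z \<notin> cball p \<epsilon>" by (simp add: dist_norm norm_minus_commute)
      then have "f' (S p z) = 0" unfolding S_def
        using radial_zero[of f' \<epsilon> z p, OF profile_zero[OF f'(1)] \<epsilon>(1)] by blast
      then show ?thesis using C M \<epsilon> by (simp add: k'_def)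
    qed
    show "integrable lborel (\<lambda>z. M * (C * (2 * \<epsilon> / \<epsilon>\<^sup>2) / \<epsilon> ^ ?d) * indicator (cball y r) z :: real)"
      by (rule integrable_indicator_cball)
    show "(\<lambda>z. k' y z s) \<in> borel_measurable lborel" for s
      unfolding k'_def S_def using M(3) profile_borel[OF f'(1)] by measurable
  qed (use \<delta> in auto)
  then have "((\<lambda>p. (\<integral>z. k p z \<partial>lborel) / radial_mass TYPE('a) f) has_derivative (\<lambda>s. (\<integral>z. k' y z s \<partial>lborel) / radial_mass TYPE('a) f)) (at y)"
    unfolding divide_inverse by (rule has_derivative_mult_left)
  then have "(u has_derivative (\<lambda>s. (\<integral>z. k' y z s \<partial>lborel) / radial_mass TYPE('a) f)) (at y)"
    by (rule has_derivative_transform_within_open[where s="ball y \<delta>"]) (use \<delta> m rep in \<open>auto simp: field_simps\<close>)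
  then show ?thesis by (simp add: k'_def S_def)
qed

text \<open>What the intertwining relation gives for the functions 1, \<open>x \<bullet> e\<close>
  and \<open>(x \<bullet> e)\<^sup>2\<close>. The condition \<open>Re (h z / h y) > 0\<close> has
  two uses: with z = y it says that \<open>h\<close> has no zero, and in
  \<open>chart_distance_scaled\<close> it supplies a positive weight in place of the complex
  \<open>h\<close>.\<close>

definition harmonic_chart :: "'a::euclidean_space set \<Rightarrow> ('a \<Rightarrow> complex) \<Rightarrow> ('a \<Rightarrow> 'a) \<Rightarrow> bool" where
  "harmonic_chart B h \<tau> \<longleftrightarrow> continuous_on B h \<and> continuous_on B \<tau> \<and>
    (\<forall>y\<in>B. \<forall>z\<in>B. Re (h z / h y) > 0) \<and> bounded_borel h \<and>
    (\<forall>e. bounded_borel (\<lambda>y. h y * of_real (\<tau> y \<bullet> e))) \<and>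
    (\<forall>e. bounded_borel (\<lambda>y. h y * of_real ((\<tau> y \<bullet> e)\<^sup>2))) \<and>
    weak_laplacian B h (\<lambda>_. 0) \<and>
    (\<forall>e. weak_laplacian B (\<lambda>y. h y * of_real (\<tau> y \<bullet> e)) (\<lambda>_. 0)) \<and>
    (\<forall>e. weak_laplacian B (\<lambda>y. h y * of_real ((\<tau> y \<bullet> e)\<^sup>2)) (\<lambda>y. of_real (2 * (e \<bullet> e)) * h y))"

lemma weak_laplacian_mono: "weak_laplacian T u w \<Longrightarrow> S \<subseteq> T \<Longrightarrow> weak_laplacian S u w"
  using test_functions_mono unfolding weak_laplacian_def by blast

lemma harmonic_chart_mono: "harmonic_chart T h \<tau> \<Longrightarrow> S \<subseteq> T \<Longrightarrow> harmonic_chart S h \<tau>"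
  unfolding harmonic_chart_def by (intro conjI; blast intro: continuous_on_subset weak_laplacian_mono)

lemma harmonic_chart_nonzero:
  assumes "harmonic_chart B h \<tau>" "y \<in> B"
  shows "h y \<noteq> 0"
proof
  assume "h y = 0"
  then have "Re (h y / h y) = 0" by simp
  then show False using assms unfolding harmonic_chart_def by (metis less_irrefl)
qed

lemma harmonic_chart_linear:
  assumes "harmonic_chart B h \<tau>"
  shows "bounded_borel (\<lambda>z. h z * of_real ((\<tau> z - b) \<bullet> e))"
    "weak_laplacian B (\<lambda>z. h z * of_real ((\<tau> z - b) \<bullet> e)) (\<lambda>_. 0)"
proof -
  have e: "(\<lambda>z. h z * of_real ((\<tau> z - b) \<bullet> e)) = (\<lambda>z. h z * of_real (\<tau> z \<bullet> e) + of_real (- (b \<bullet> e)) * h z)"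
    by (auto simp: fun_eq_iff inner_diff_left algebra_simps)
  have bb: "bounded_borel h" "bounded_borel (\<lambda>y. h y * of_real (\<tau> y \<bullet> e))"
    using assms unfolding harmonic_chart_def by blast+
  then show "bounded_borel (\<lambda>z. h z * of_real ((\<tau> z - b) \<bullet> e))"
    unfolding e by (intro bounded_borel_add bounded_borel_mult[OF bounded_borel_const])
  have w: "weak_laplacian B h (\<lambda>_. 0)" "weak_laplacian B (\<lambda>y. h y * of_real (\<tau> y \<bullet> e)) (\<lambda>_. 0)"
    using assms unfolding harmonic_chart_def by blast+
  from weak_laplacian_add[OF w(2) weak_laplacian_cmult[OF w(1), of "of_real (- (b \<bullet> e))"] bb(2) bounded_borel_const
      bounded_borel_mult[OF bounded_borel_const bb(1)] bounded_borel_const]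
  show "weak_laplacian B (\<lambda>z. h z * of_real ((\<tau> z - b) \<bullet> e)) (\<lambda>_. 0)"
    unfolding e by simp
qed

lemma harmonic_chart_quadratic:
  assumes "harmonic_chart B h \<tau>"
  shows "bounded_borel (\<lambda>z. h z * of_real (((\<tau> z - b) \<bullet> e)\<^sup>2))"
    "weak_laplacian B (\<lambda>z. h z * of_real (((\<tau> z - b) \<bullet> e)\<^sup>2)) (\<lambda>z. of_real (2 * (e \<bullet> e)) * h z)"
proof -
  \<comment> \<open>Recentring at b/2 in the linear term makes the constant
    \<open>(b \<bullet> e)\<^sup>2\<close> of the expanded square come out right.\<close>
  let ?q = "\<lambda>y. h y * of_real ((\<tau> y \<bullet> e)\<^sup>2)" and ?l = "\<lambda>y. of_real (- 2 * (b \<bullet> e)) * (h y * of_real ((\<tau> y - (1/2) *\<^sub>R b) \<bullet> e))"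
  have e: "(\<lambda>z. h z * of_real (((\<tau> z - b) \<bullet> e)\<^sup>2)) = (\<lambda>z. ?q z + ?l z)"
    by (auto simp: fun_eq_iff inner_diff_left power2_eq_square algebra_simps)
  have bb: "bounded_borel h" "bounded_borel ?q"
    using assms unfolding harmonic_chart_def by blast+
  have bl: "bounded_borel ?l"
    by (intro bounded_borel_mult[OF bounded_borel_const] harmonic_chart_linear(1)[OF assms])
  then show "bounded_borel (\<lambda>z. h z * of_real (((\<tau> z - b) \<bullet> e)\<^sup>2))"
    unfolding e using bb by (intro bounded_borel_add)
  have "weak_laplacian B ?q (\<lambda>y. of_real (2 * (e \<bullet> e)) * h y)"
    using assms unfolding harmonic_chart_def by blast
  moreover have "weak_laplacian B ?l (\<lambda>_. of_real (- 2 * (b \<bullet> e)) * 0)"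
    by (rule weak_laplacian_cmult[OF harmonic_chart_linear(2)[OF assms]])
  ultimately have "weak_laplacian B (\<lambda>z. ?q z + ?l z) (\<lambda>z. of_real (2 * (e \<bullet> e)) * h z + of_real (- 2 * (b \<bullet> e)) * 0)"
    by (rule weak_laplacian_add) (use bb bl in \<open>auto intro!: bounded_borel_mult bounded_borel_const\<close>)
  then show "weak_laplacian B (\<lambda>z. h z * of_real (((\<tau> z - b) \<bullet> e)\<^sup>2)) (\<lambda>z. of_real (2 * (e \<bullet> e)) * h z)"
    unfolding e by simp
qed

lemma local_cutoff:
  fixes a :: "'a::euclidean_space"
  assumes "open \<Omega>" "a \<in> \<Omega>"
  obtains s \<eta> where "s > 0" "ball a s \<subseteq> \<Omega>" "\<eta> \<in> test_functions \<Omega>" "\<And>x. x \<in> ball a s \<Longrightarrow> \<eta> x = 1"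
proof -
  obtain t where t: "t > 0" "cball a t \<subseteq> \<Omega>" using assms open_contains_cball by blast
  obtain \<kappa> :: "'a \<Rightarrow> real" where "(\<lambda>x. complex_of_real (\<kappa> x)) \<in> test_functions \<Omega>" "\<And>x. x \<in> cball a t \<Longrightarrow> \<kappa> x = 1"
    using smooth_Urysohn[OF compact_cball assms(1) t(2)] by metis
  then show ?thesis using that[of t "\<lambda>x. complex_of_real (\<kappa> x)"] t subset_trans[OF ball_subset_cball t(2)] by auto
qed

lemma smooth_square_inner: "smooth (\<lambda>x. complex_of_real ((x \<bullet> e)\<^sup>2))"
  using smooth_mult[OF smooth_inner smooth_inner, of e e] by (simp add: power2_eq_square)

lemma laplacian_const: "laplacian (\<lambda>_. c) = (\<lambda>_. 0)"
  by (simp add: laplacian_def fun_eq_iff)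

lemma laplacian_inner: "laplacian (\<lambda>x. complex_of_real (x \<bullet> e)) = (\<lambda>_. 0)"
  by (simp add: laplacian_def fun_eq_iff pderiv_dir_inner)

lemma laplacian_square_inner: "laplacian (\<lambda>x. complex_of_real ((x \<bullet> e)\<^sup>2)) = (\<lambda>_. of_real (2 * (e \<bullet> e)))"
proof
  fix x
  have 1: "pderiv_dir b (\<lambda>x. complex_of_real ((x \<bullet> e)\<^sup>2)) = (\<lambda>x. complex_of_real (2 * (b \<bullet> e)) * complex_of_real (x \<bullet> e))" for b
    unfolding power2_eq_square of_real_mult pderiv_dir_mult[OF smooth_inner smooth_inner] pderiv_dir_inner
    by (simp add: fun_eq_iff)
  have 2: "pderiv_dir b (\<lambda>x. complex_of_real (2 * (b \<bullet> e)) * complex_of_real (x \<bullet> e)) x = complex_of_real (2 * ((b \<bullet> e) * (b \<bullet> e)))" for b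
    unfolding pderiv_dir_mult[OF smooth_const smooth_inner] pderiv_dir_inner by simp
  show "laplacian (\<lambda>x. complex_of_real ((x \<bullet> e)\<^sup>2)) x = complex_of_real (2 * (e \<bullet> e))"
    unfolding laplacian_def 1 2 by (subst euclidean_inner) (simp add: sum_distrib_left inner_commute)
qed

text \<open>For a profile \<open>F\<close> with derivative \<open>f\<close> this is the integral of
  \<open>(x \<bullet> e)\<^sup>2 * f ((norm x)\<^sup>2)\<close> for every unit vector e. The factor
  - 1/2 is the - 1/4 of the mean value formula times the Laplacian 2 of the square.\<close>

definition radial_second_moment :: "'a::euclidean_space itself \<Rightarrow> (real \<Rightarrow> real) \<Rightarrow> real" where
  "radial_second_moment T F = - (1/2) * Re (radial_mass T F)"

lemma integrable_radial_bounded: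
  fixes g :: "'a::euclidean_space \<Rightarrow> complex"
  assumes f: "profile f" and g: "g \<in> borel_measurable borel" and C: "\<And>x. norm x < 1 \<Longrightarrow> norm (g x) \<le> C"
  shows "integrable lborel (\<lambda>x. g x * of_real (f ((norm x)\<^sup>2)))"
proof (rule integrable_bounded_borel_supported[of _ "cball 0 1"])
  obtain D where D: "D \<ge> 0" "\<And>s. s \<ge> 0 \<Longrightarrow> \<bar>f s\<bar> \<le> D" using profile_bounded[OF f] by blast
  have z: "f ((norm x)\<^sup>2) = 0" if "norm x \<ge> 1" for x :: 'a
    using that by (intro profile_zero[OF f]) (simp add: one_le_power)
  then show "g x * of_real (f ((norm x)\<^sup>2)) = 0" if "x \<notin> cball 0 1" for x using that by simp
  have C0: "0 \<le> C" using C[of 0] norm_ge_zero order_trans by (metis norm_zero zero_less_one)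
  show "bounded_borel (\<lambda>x. g x * of_real (f ((norm x)\<^sup>2)))"
  proof (rule bounded_borelI[where M="C * D"])
    fix x
    show "norm (g x * of_real (f ((norm x)\<^sup>2))) \<le> C * D"
    proof (cases "norm x < 1")
      case True
      then show ?thesis using C[OF True] C0 D by (auto simp: norm_mult intro!: mult_mono)
    next
      case False
      then show ?thesis using z C0 D by simp
    qed
  qed (use g profile_borel[OF f] in measurable)
qed auto

text \<open>The mean value formula at 0 with radius 1, applied to
  \<open>(x \<bullet> e)\<^sup>2\<close>, which vanishes at 0 and has constant Laplacian. The cutoff
  beyond radius 2 only makes the function bounded, as that formula asks.\<close>

lemma second_moment:
  fixes e :: "'a::euclidean_space"
  assumes f: "profile f" and F: "profile F" "\<And>t. (F has_real_derivative f t) (at t)"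
  shows "(\<integral>x. complex_of_real ((x \<bullet> e)\<^sup>2) * of_real (f ((norm x)\<^sup>2)) \<partial>lborel)
    = of_real (radial_second_moment TYPE('a) F * (e \<bullet> e))"
proof -
  obtain \<kappa> :: "'a \<Rightarrow> real" where k: "(\<lambda>x. complex_of_real (\<kappa> x)) \<in> test_functions UNIV"
      "\<And>x. 0 \<le> \<kappa> x" "\<And>x. \<kappa> x \<le> 1" "\<And>x. x \<in> cball 0 2 \<Longrightarrow> \<kappa> x = 1"
    by (rule smooth_Urysohn[OF compact_cball open_UNIV subset_UNIV, of 0 2]) (rule that)
  define u where "u x = complex_of_real (\<kappa> x) * complex_of_real ((x \<bullet> e)\<^sup>2)" for x
  have tu: "u \<in> test_functions UNIV" unfolding u_def by (rule test_functions_mult(1)[OF k(1) smooth_square_inner])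
  have eq: "u x = complex_of_real ((x \<bullet> e)\<^sup>2)" if "x \<in> ball 0 2" for x using k(4)[of x] that by (simp add: u_def)
  have "laplacian u x = of_real (2 * (e \<bullet> e))" if "x \<in> ball 0 2" for x
    by (rule trans[OF laplacian_cong_open[OF open_ball that eq] fun_cong[OF laplacian_square_inner]])
  then have "weak_laplacian (ball 0 2) u (\<lambda>_. of_real (2 * (e \<bullet> e)))"
    by (intro weak_laplacian_cong[OF weak_laplacian_smooth[OF test_functions_smooth[OF tu]]]) auto
  moreover have "isCont u 0"
    using smooth_continuous_on[OF test_functions_smooth[OF tu], of UNIV]
    by (simp add: continuous_on_eq_continuous_at)
  moreover have A: "radial_mean F (\<lambda>_. of_real (2 * (e \<bullet> e))) (0::'a) t = of_real (2 * (e \<bullet> e)) * radial_mass TYPE('a) F" for t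
    by (simp add: radial_mean_def radial_mass_def)
  ultimately have "radial_mean f u 0 1 = u 0 * radial_mass TYPE('a) f - of_real (1\<^sup>2 / 4) * (of_real (2 * (e \<bullet> e)) * radial_mass TYPE('a) F)"
    by (intro mean_value_formula[where r=2, OF bounded_borel_test[OF tu] bounded_borel_const _ _ f F]) auto
  moreover have "u 0 = 0" by (simp add: u_def)
  moreover obtain R where "radial_mass TYPE('a) F = of_real R"
    by (rule that, unfold radial_mass_def, rule integral_complex_of_real)
  moreover have "radial_mean f u 0 1 = (\<integral>x. of_real ((x \<bullet> e)\<^sup>2) * of_real (f ((norm x)\<^sup>2)) \<partial>lborel)"
    unfolding radial_mean_def
  proof (rule Bochner_Integration.integral_cong[OF refl])
    fix x :: 'a
    show "u (0 + 1 *\<^sub>R x) * of_real (f ((norm x)\<^sup>2)) = of_real ((x \<bullet> e)\<^sup>2) * of_real (f ((norm x)\<^sup>2))"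
    proof (cases "norm x < 1")
      case True
      then show ?thesis using eq[of x] by simp
    next
      case False
      then have "f ((norm x)\<^sup>2) = 0" by (intro profile_zero[OF f]) (simp add: one_le_power)
      then show ?thesis by simp
    qed
  qed
  ultimately show ?thesis by (simp add: radial_second_moment_def)
qed

subsection \<open>Charts are affine isometries\<close>

definition bump :: "real \<Rightarrow> real" where "bump s = flat_exp (1 - s)"

lemma profile_bump: "profile bump"
  using profile_flat_exp by (simp add: bump_def[abs_def])

lemma bump_nonneg: "bump s \<ge> 0" and bump_pos: "s < 1 \<Longrightarrow> bump s > 0"
  by (simp_all add: bump_def flat_exp_nonneg flat_exp_pos)

lemma bump_norm_eq_0: "norm x \<ge> 1 \<Longrightarrow> bump ((norm x)\<^sup>2) = 0"
  by (rule profile_zero[OF profile_bump]) (simp add: one_le_power)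

lemma bump_norm_pos: "norm x < 1 \<Longrightarrow> bump ((norm x)\<^sup>2) > 0"
  by (rule bump_pos) (simp add: power_less_one_iff)

lemma continuous_on_bump: "continuous_on S g \<Longrightarrow> continuous_on S (\<lambda>x. bump (g x))"
  using continuous_on_compose2[OF smooth_real_continuous[of bump UNIV]] profile_bump by (auto simp: profile_def)

lemma integral_times_bump_zero:
  fixes g :: "'a::euclidean_space \<Rightarrow> real"
  assumes int: "integrable lborel (\<lambda>x. g x * bump ((norm x)\<^sup>2))"
    and nn: "\<And>x. norm x < 1 \<Longrightarrow> g x \<ge> 0"
    and zero: "(\<integral>x. g x * bump ((norm x)\<^sup>2) \<partial>lborel) = 0"
    and c: "continuous_on (ball 0 1) g" and x: "norm x < 1"
  shows "g x = 0"
proof -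
  have "g x * bump ((norm x)\<^sup>2) = 0"
  proof (rule nonneg_integral_zero_continuous[OF int _ zero])
    show "0 \<le> g x * bump ((norm x)\<^sup>2)" for x
      using nn[of x] bump_nonneg bump_norm_eq_0[of x] by (cases "norm x < 1") auto
    show "continuous_on (ball 0 1) (\<lambda>x. g x * bump ((norm x)\<^sup>2))"
      by (intro continuous_intros c continuous_on_bump)
  qed (use x in auto)
  then show ?thesis using bump_norm_pos[OF x] by simp
qed

lemma integrable_real_times_bump:
  fixes g :: "'a::euclidean_space \<Rightarrow> real"
  assumes "continuous_on UNIV g"
  shows "integrable lborel (\<lambda>x. g x * bump ((norm x)\<^sup>2))"
proof -
  have "bounded (g ` cball 0 1)"
    by (intro compact_imp_bounded compact_continuous_image[OF continuous_on_subset[OF assms]]) auto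
  then obtain C where C: "\<forall>y\<in>g ` cball 0 1. norm y \<le> C" unfolding bounded_iff by blast
  have "integrable lborel (\<lambda>x. complex_of_real (g x) * of_real (bump ((norm x)\<^sup>2)))"
  proof (rule integrable_radial_bounded[OF profile_bump])
    show "(\<lambda>x. complex_of_real (g x)) \<in> borel_measurable borel"
      using borel_measurable_continuous_onI[OF assms] by measurable
    show "norm (complex_of_real (g x)) \<le> C" if "norm x < 1" for x using C that by auto
  qed
  then have "integrable lborel (\<lambda>x. Re (complex_of_real (g x) * of_real (bump ((norm x)\<^sup>2))))"
    by (rule integrable_Re)
  then show ?thesis by simp
qed

lemma radial_mass_bump: "radial_mass TYPE('a::euclidean_space) bump \<noteq> 0"
proof
  assume "radial_mass TYPE('a) bump = 0"
  then have "(\<integral>x. 1 * bump ((norm (x::'a))\<^sup>2) \<partial>lborel) = 0"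
    by (simp add: radial_mass_def)
  then have "(1::real) = 0"
    by (intro integral_times_bump_zero[where g="\<lambda>_::'a. 1" and x=0] integrable_real_times_bump) auto
  then show False by simp
qed

lemma second_moment_bump:
  assumes F: "profile F" "\<And>t. (F has_real_derivative bump t) (at t)"
  shows "radial_second_moment TYPE('a::euclidean_space) F \<noteq> 0"
proof
  assume 0: "radial_second_moment TYPE('a) F = 0"
  obtain e :: 'a where e: "e \<in> Basis" using nonempty_Basis by blast
  have "(\<integral>x. complex_of_real ((x \<bullet> e)\<^sup>2) * of_real (bump ((norm x)\<^sup>2)) \<partial>lborel) = 0"
    using second_moment[OF profile_bump F, of e] 0 by simp
  then have "complex_of_real (\<integral>x. (x \<bullet> e)\<^sup>2 * bump ((norm x)\<^sup>2) \<partial>lborel) = 0"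
    by (simp only: of_real_mult[symmetric] integral_complex_of_real)
  then have z: "(\<integral>x. (x \<bullet> e)\<^sup>2 * bump ((norm x)\<^sup>2) \<partial>lborel) = 0" by simp
  have "(((1/2) *\<^sub>R e) \<bullet> e)\<^sup>2 = 0"
    by (rule integral_times_bump_zero[OF integrable_real_times_bump _ z])
       (use e in \<open>auto intro!: continuous_intros\<close>)
  then show False using e by simp
qed

context
  fixes h :: "'a::euclidean_space \<Rightarrow> complex" and \<tau> :: "'a \<Rightarrow> 'a" and y0 :: 'a and r :: real
  assumes chart: "harmonic_chart (ball y0 r) h \<tau>"
begin

lemma chart_h:
  "bounded_borel h" "continuous_on (ball y0 r) h" "continuous_on (ball y0 r) \<tau>" "weak_laplacian (ball y0 r) h (\<lambda>_. 0)"
  "\<And>y z. y \<in> ball y0 r \<Longrightarrow> z \<in> ball y0 r \<Longrightarrow> Re (h z / h y) > 0"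
  using chart unfolding harmonic_chart_def by blast+

lemma chart_sub_ball: "ball y (r - dist y0 y) \<subseteq> ball y0 r"
  using dist_triangle[of y0 _ y] by (smt (verit) mem_ball subsetI)

lemma chart_isCont: "y \<in> ball y0 r \<Longrightarrow> isCont h y" "y \<in> ball y0 r \<Longrightarrow> isCont \<tau> y"
  using chart_h(2,3) continuous_on_eq_continuous_at[OF open_ball] by blast+

lemma chart_weyl:
  assumes y: "y \<in> ball y0 r" and u: "bounded_borel u" "continuous_on (ball y0 r) u" "weak_laplacian (ball y0 r) u (\<lambda>_. 0)"
  shows "u differentiable (at y)"
proof -
  obtain f' where f': "profile f'" "\<And>t. (bump has_real_derivative f' t) (at t)"
    using profile_deriv_ex[OF profile_bump] by blast
  define \<rho> where "\<rho> = r - dist y0 y"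
  have \<rho>: "\<rho> > 0" using y by (simp add: \<rho>_def)
  have sub: "ball y \<rho> \<subseteq> ball y0 r" unfolding \<rho>_def by (rule chart_sub_ball)
  show ?thesis
    using weyl_derivative[OF u(1) weak_laplacian_mono[OF u(3) sub] continuous_on_subset[OF u(2) sub]
        profile_bump f' radial_mass_bump, of "\<rho> / 2"] \<rho>
    unfolding differentiable_def by auto
qed

text \<open>Weyl's lemma does not apply to the components of \<open>\<tau>\<close>, but it applies
  to \<open>h\<close> and to \<open>h\<close> times a component; the quotient recovers the
  component.\<close>

lemma chart_differentiable:
  assumes y: "y \<in> ball y0 r"
  shows "\<tau> differentiable (at y)"
proof -
  have dh: "h differentiable (at y)"
    using chart_weyl[OF y chart_h(1,2,4)] .
  have "(\<lambda>z. \<tau> z \<bullet> e) differentiable (at y)" for e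
  proof -
    let ?u = "\<lambda>z. h z * of_real (\<tau> z \<bullet> e)"
    have "?u differentiable (at y)"
    proof (rule chart_weyl[OF y])
      show "continuous_on (ball y0 r) ?u" using chart_h(2,3) by (intro continuous_intros)
    qed (use chart in \<open>auto simp: harmonic_chart_def\<close>)
    then have "(\<lambda>z. ?u z / h z) differentiable (at y)"
      using dh harmonic_chart_nonzero[OF chart y] by (intro differentiable_divide)
    then obtain D where "((\<lambda>z. ?u z / h z) has_derivative D) (at y)" unfolding differentiable_def by blast
    from has_derivative_Re[OF this]
    have "((\<lambda>z. Re (?u z / h z)) has_derivative (\<lambda>s. Re (D s))) (at y)" .
    moreover have "Re (?u z / h z) = \<tau> z \<bullet> e" if "z \<in> ball y0 r" for z
      using harmonic_chart_nonzero[OF chart that] by simp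
    ultimately have "((\<lambda>z. \<tau> z \<bullet> e) has_derivative (\<lambda>s. Re (D s))) (at y)"
      by (rule has_derivative_transform_within_open[OF _ open_ball y])
    then show ?thesis unfolding differentiable_def by blast
  qed
  then show ?thesis using differentiable_componentwise_within[of \<tau> y UNIV] by blast
qed

text \<open>The function vanishes at y and its Laplacian is a multiple of \<open>h\<close>. Since
  \<open>h\<close> is harmonic, its \<open>F\<close>-mean does not depend on the radius, by the mean
  value formula with a second antiderivative \<open>G\<close>; this is what the formula for the
  quadratic function requires.\<close>

lemma chart_quadratic_mean:
  assumes y: "y \<in> ball y0 r" and \<epsilon>: "0 < \<epsilon>" "\<epsilon> < r - dist y0 y"
    and F: "profile F" "\<And>t. (F has_real_derivative bump t) (at t)"
  shows "radial_mean bump (\<lambda>z. h z * of_real (((\<tau> z - \<tau> y) \<bullet> e)\<^sup>2)) y \<epsilon>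
    = of_real (\<epsilon>\<^sup>2 * (e \<bullet> e) * radial_second_moment TYPE('a) F) * h y"
proof -
  define \<rho> where "\<rho> = r - dist y0 y"
  have sub: "ball y \<rho> \<subseteq> ball y0 r" unfolding \<rho>_def by (rule chart_sub_ball)
  have ch: "harmonic_chart (ball y \<rho>) h \<tau>" by (rule harmonic_chart_mono[OF chart sub])
  have wh: "weak_laplacian (ball y \<rho>) h (\<lambda>_. 0)" by (rule weak_laplacian_mono[OF chart_h(4) sub])
  obtain G where G: "profile G" "\<And>t. (G has_real_derivative F t) (at t)" using profile_antideriv[OF F(1)] by blast
  have FH: "radial_mean F h y t = h y * radial_mass TYPE('a) F" if "0 < t" "t < \<rho>" for t
    using mean_value_formula[OF chart_h(1) bounded_borel_const wh chart_isCont(1)[OF y] F(1) G, of 0 t] that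
    by (simp add: radial_mean_def[of G])
  have A: "radial_mean F (\<lambda>z. of_real (2 * (e \<bullet> e)) * h z) y t = of_real (2 * (e \<bullet> e)) * (h y * radial_mass TYPE('a) F)"
    if "0 < t" "t < \<rho>" for t
    using FH[OF that] unfolding radial_mean_def mult.assoc by simp
  have "isCont (\<lambda>z. h z * of_real (((\<tau> z - \<tau> y) \<bullet> e)\<^sup>2)) y"
    by (intro continuous_intros chart_isCont y)
  from mean_value_formula[OF harmonic_chart_quadratic(1)[OF ch] bounded_borel_mult[OF bounded_borel_const chart_h(1)]
      harmonic_chart_quadratic(2)[OF ch] this profile_bump F A]
  have "radial_mean bump (\<lambda>z. h z * of_real (((\<tau> z - \<tau> y) \<bullet> e)\<^sup>2)) y \<epsilon>
    = - of_real (\<epsilon>\<^sup>2 / 4) * (of_real (2 * (e \<bullet> e)) * (h y * radial_mass TYPE('a) F))"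
    using \<epsilon> by (simp add: \<rho>_def)
  moreover have "radial_mass TYPE('a) F = of_real (- 2 * radial_second_moment TYPE('a) F)"
    unfolding radial_second_moment_def radial_mass_def by (simp only: integral_complex_of_real Re_complex_of_real) simp
  ultimately show ?thesis by simp
qed

text \<open>Divide the identity of \<open>chart_quadratic_mean\<close> by \<epsilon>^2 and let
  \<epsilon> tend to 0: the left side becomes a second moment of
  \<open>T x \<bullet> e = x \<bullet> adjoint T e\<close>, so \<open>adjoint T\<close> preserves
  norms. Then \<open>adjoint T\<close> is orthogonal with inverse \<open>T\<close>.\<close>

lemma chart_derivative_orthogonal:
  assumes y: "y \<in> ball y0 r" and T: "(\<tau> has_derivative T) (at y)"
  shows "orthogonal_transformation T"
proof -
  obtain F where F: "profile F" "\<And>t. (F has_real_derivative bump t) (at t)"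
    using profile_antideriv[OF profile_bump] by blast
  define m where "m = radial_second_moment TYPE('a) F"
  have m: "m \<noteq> 0" using second_moment_bump[OF F] by (simp add: m_def)
  have linT: "linear T" using T has_derivative_linear by blast
  have key: "norm (adjoint T e) = norm e" for e
  proof -
    define \<rho> where "\<rho> = r - dist y0 y"
    have \<rho>: "\<rho> > 0" using y by (simp add: \<rho>_def)
    obtain M where M: "M \<ge> 0" "\<And>x. norm (h x) \<le> M" "h \<in> borel_measurable borel" using chart_h(1) bounded_borelE by metis
    obtain C where C: "C \<ge> 0" "\<And>s. s \<ge> 0 \<Longrightarrow> \<bar>bump s\<bar> \<le> C" using profile_bounded[OF profile_bump] by blast
    define Q where "Q t x = h (y + t *\<^sub>R x) * of_real (((\<tau> (y + t *\<^sub>R x) - \<tau> y) \<bullet> e)\<^sup>2) * of_real (bump ((norm x)\<^sup>2)) / of_real (t\<^sup>2)" for t x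
    have bq: "(\<lambda>z. h z * of_real (((\<tau> z - \<tau> y) \<bullet> e)\<^sup>2)) \<in> borel_measurable borel"
      using harmonic_chart_quadratic(1)[OF chart] by (auto simp: bounded_borel_def)
    have intQ: "(\<integral>x. Q t x \<partial>lborel) = of_real (m * (e \<bullet> e)) * h y" if "0 < t" "t < \<rho>" for t
      using chart_quadratic_mean[OF y that[unfolded \<rho>_def] F, of e] that
      by (simp add: Q_def radial_mean_def m_def field_simps)
    obtain B where B: "\<And>x. norm (T x) \<le> B * norm x" "B > 0"
      using bounded_linear.pos_bounded[OF has_derivative_bounded_linear[OF T]] by (auto simp: mult.commute)
    have "\<forall>\<^sub>F x in at 0. norm (\<tau> (y + x) - \<tau> y - T x) / norm x < 1"
      using T unfolding has_derivative_at by (intro order_tendstoD(2)[of _ 0]) auto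
    then obtain \<delta> where \<delta>: "\<delta> > 0" "\<And>x. x \<noteq> 0 \<Longrightarrow> norm x < \<delta> \<Longrightarrow> norm (\<tau> (y + x) - \<tau> y - T x) / norm x < 1"
      unfolding eventually_at by (auto simp: dist_norm)
    \<comment> \<open>Differentiability at the single point y already gives linear growth, which
      dominates the rescaled squares \<open>Q\<close>.\<close>
    have lip: "norm (\<tau> (y + x) - \<tau> y) \<le> (B + 1) * norm x" if "norm x < \<delta>" for x
    proof (cases "x = 0")
      case False
      then have "norm (\<tau> (y + x) - \<tau> y - T x) \<le> norm x" using \<delta>(2)[OF False that] by (simp add: divide_less_eq)
      then show ?thesis using B(1)[of x] norm_triangle_ineq[of "\<tau> (y + x) - \<tau> y - T x" "T x"]
        by (simp add: algebra_simps)
    qed simp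
    \<comment> \<open>Dividing by n + 2 keeps even the first radius strictly below both
      bounds.\<close>
    define X where "X n = min \<delta> \<rho> / real (n + 2)" for n :: nat
    have X: "X n > 0" "X n < \<delta>" "X n < \<rho>" for n
    proof -
      define m where "m = min \<delta> \<rho>"
      have m: "m > 0" "m \<le> \<delta>" "m \<le> \<rho>" using \<delta>(1) \<rho> by (auto simp: m_def)
      then have "m * 1 < m * real (n + 2)" by (intro mult_strict_left_mono) auto
      then have "X n < m" by (simp add: X_def m_def[symmetric] divide_less_eq)
      then show "X n < \<delta>" "X n < \<rho>" using m by auto
      show "X n > 0" using m by (simp add: X_def m_def[symmetric])
    qed
    have X0: "X \<longlonglongrightarrow> 0"
      unfolding X_def using LIMSEQ_ignore_initial_segment[OF lim_const_over_n[of "min \<delta> \<rho>"], of 2] by simp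
    have "(\<lambda>n. \<integral>x. Q (X n) x \<partial>lborel) \<longlonglongrightarrow> (\<integral>x. h y * (of_real ((T x \<bullet> e)\<^sup>2) * of_real (bump ((norm x)\<^sup>2))) \<partial>lborel)"
    proof (rule integral_dominated_convergence[where w="\<lambda>x. (M * ((B + 1) * norm e)\<^sup>2 * C) * indicator (cball 0 1) x"])
      show "(\<lambda>x. h y * (of_real ((T x \<bullet> e)\<^sup>2) * of_real (bump ((norm x)\<^sup>2)))) \<in> borel_measurable lborel"
        using borel_measurable_continuous_onI[OF linear_continuous_on[OF has_derivative_bounded_linear[OF T]]] profile_borel[OF profile_bump]
        by measurable
      show "Q (X n) \<in> borel_measurable lborel" for n
      proof -
        have "(\<lambda>x. h (y + X n *\<^sub>R x) * of_real (((\<tau> (y + X n *\<^sub>R x) - \<tau> y) \<bullet> e)\<^sup>2)) \<in> borel_measurable borel"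
          using measurable_compose[OF _ bq, of "\<lambda>x. y + X n *\<^sub>R x" borel] by simp
        then show ?thesis unfolding Q_def using profile_borel[OF profile_bump] by measurable
      qed
      show "AE x in lborel. (\<lambda>n. Q (X n) x) \<longlonglongrightarrow> h y * (of_real ((T x \<bullet> e)\<^sup>2) * of_real (bump ((norm x)\<^sup>2)))"
      proof (rule AE_I2)
        fix x
        have arg: "(\<lambda>n. y + X n *\<^sub>R x) \<longlonglongrightarrow> y"
          using tendsto_add[OF tendsto_const tendsto_scaleR[OF X0 tendsto_const], of y x] by simp
        have hl: "(\<lambda>n. h (y + X n *\<^sub>R x)) \<longlonglongrightarrow> h y"
          by (rule isCont_tendsto_compose[OF chart_isCont(1)[OF y] arg])
        have "((\<lambda>t. \<tau> (y + t *\<^sub>R x)) has_derivative (\<lambda>t. T (t *\<^sub>R x))) (at 0)"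
          by (rule has_derivative_compose[of "\<lambda>t. y + t *\<^sub>R x" "\<lambda>t. t *\<^sub>R x"])
             (use T in \<open>auto intro!: derivative_eq_intros\<close>)
        then have "((\<lambda>t. \<tau> (y + t *\<^sub>R x) \<bullet> e) has_derivative (\<lambda>t. T (t *\<^sub>R x) \<bullet> e)) (at 0)"
          by (rule has_derivative_inner_left)
        moreover have "(\<lambda>t. T (t *\<^sub>R x) \<bullet> e) = (*) (T x \<bullet> e)"
          by (auto simp: linear_scale[OF linT] mult.commute)
        ultimately have "((\<lambda>t. \<tau> (y + t *\<^sub>R x) \<bullet> e) has_real_derivative T x \<bullet> e) (at 0)"
          by (simp add: has_field_derivative_def)
        then have D: "((\<lambda>t. ((\<tau> (y + t *\<^sub>R x) - \<tau> y) \<bullet> e) / t) \<longlongrightarrow> T x \<bullet> e) (at 0)"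
          by (simp add: DERIV_def inner_diff_left)
        have "filterlim X (at 0) sequentially"
          using X0 X(1) by (auto simp: filterlim_at less_imp_neq[symmetric])
        then have "(\<lambda>n. ((\<tau> (y + X n *\<^sub>R x) - \<tau> y) \<bullet> e) / X n) \<longlonglongrightarrow> T x \<bullet> e"
          by (rule filterlim_compose[OF D])
        then have "(\<lambda>n. h (y + X n *\<^sub>R x) * (of_real ((((\<tau> (y + X n *\<^sub>R x) - \<tau> y) \<bullet> e) / X n)\<^sup>2) * of_real (bump ((norm x)\<^sup>2))))
           \<longlonglongrightarrow> h y * (of_real ((T x \<bullet> e)\<^sup>2) * of_real (bump ((norm x)\<^sup>2)))"
          by (intro tendsto_intros hl)
        moreover have "h (y + X n *\<^sub>R x) * (of_real ((((\<tau> (y + X n *\<^sub>R x) - \<tau> y) \<bullet> e) / X n)\<^sup>2) * of_real (bump ((norm x)\<^sup>2))) = Q (X n) x" for n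
          by (simp add: Q_def power_divide)
        ultimately show "(\<lambda>n. Q (X n) x) \<longlonglongrightarrow> h y * (of_real ((T x \<bullet> e)\<^sup>2) * of_real (bump ((norm x)\<^sup>2)))"
          by simp
      qed
      show "AE x in lborel. norm (Q (X n) x) \<le> M * ((B + 1) * norm e)\<^sup>2 * C * indicator (cball 0 1) x" for n
      proof (rule AE_I2)
        fix x
        show "norm (Q (X n) x) \<le> M * ((B + 1) * norm e)\<^sup>2 * C * indicator (cball 0 1) x"
        proof (cases "norm x < 1")
          case True
          have "norm (X n *\<^sub>R x) \<le> X n" using True X(1)[of n] by (simp add: mult_left_le)
          then have "norm (\<tau> (y + X n *\<^sub>R x) - \<tau> y) \<le> (B + 1) * X n"
            using lip[of "X n *\<^sub>R x"] X(2)[of n] B(2) mult_left_mono[of "norm (X n *\<^sub>R x)" "X n" "B + 1"] by linarith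
          then have "\<bar>(\<tau> (y + X n *\<^sub>R x) - \<tau> y) \<bullet> e\<bar> \<le> (B + 1) * X n * norm e"
            using Cauchy_Schwarz_ineq2[of "\<tau> (y + X n *\<^sub>R x) - \<tau> y" e] mult_right_mono[of _ "(B + 1) * X n" "norm e"]
            by (meson norm_ge_zero order_trans)
          then have "\<bar>(\<tau> (y + X n *\<^sub>R x) - \<tau> y) \<bullet> e\<bar>\<^sup>2 \<le> ((B + 1) * X n * norm e)\<^sup>2" by (intro power_mono) auto
          then have sq: "((\<tau> (y + X n *\<^sub>R x) - \<tau> y) \<bullet> e)\<^sup>2 / (X n)\<^sup>2 \<le> ((B + 1) * norm e)\<^sup>2"
          proof -
            have "((B + 1) * X n * norm e)\<^sup>2 = ((B + 1) * norm e)\<^sup>2 * (X n)\<^sup>2" by (simp add: power_mult_distrib)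
            then show ?thesis using \<open>_ \<le> ((B + 1) * X n * norm e)\<^sup>2\<close> X(1)[of n] by (simp add: pos_divide_le_eq)
          qed
          have "norm (Q (X n) x) = norm (h (y + X n *\<^sub>R x)) * (((\<tau> (y + X n *\<^sub>R x) - \<tau> y) \<bullet> e)\<^sup>2 / (X n)\<^sup>2) * \<bar>bump ((norm x)\<^sup>2)\<bar>"
            unfolding Q_def by (simp add: norm_mult norm_divide norm_power)
          also have "\<dots> \<le> M * ((B + 1) * norm e)\<^sup>2 * C"
            using M C sq by (intro mult_mono) auto
          finally show ?thesis using True by simp
        next
          case False
          then show ?thesis using bump_norm_eq_0[of x] M C by (simp add: Q_def)
        qed
      qed
      show "integrable lborel (\<lambda>x. M * ((B + 1) * norm e)\<^sup>2 * C * indicator (cball 0 1) (x::'a) :: real)"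
        by (rule integrable_indicator_cball)
    qed
    then have "(\<lambda>n. of_real (m * (e \<bullet> e)) * h y) \<longlonglongrightarrow> (\<integral>x. h y * (of_real ((T x \<bullet> e)\<^sup>2) * of_real (bump ((norm x)\<^sup>2))) \<partial>lborel)"
      using intQ X by simp
    then have "of_real (m * (e \<bullet> e)) * h y = (\<integral>x. h y * (of_real ((T x \<bullet> e)\<^sup>2) * of_real (bump ((norm x)\<^sup>2))) \<partial>lborel)"
      using LIMSEQ_unique tendsto_const by blast
    also have "\<dots> = h y * (\<integral>x. of_real ((x \<bullet> adjoint T e)\<^sup>2) * of_real (bump ((norm x)\<^sup>2)) \<partial>lborel)"
      using adjoint_works[OF linT] by simp
    also have "\<dots> = of_real (m * (adjoint T e \<bullet> adjoint T e)) * h y"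
      unfolding second_moment[OF profile_bump F] m_def by simp
    finally have "complex_of_real (m * (e \<bullet> e)) = of_real (m * (adjoint T e \<bullet> adjoint T e))"
      using harmonic_chart_nonzero[OF chart y] by simp
    then show ?thesis using m by (simp only: of_real_eq_iff) (simp add: norm_eq_sqrt_inner)
  qed
  have "linear (adjoint T)" using adjoint_linear[OF linT] .
  then have orth: "orthogonal_transformation (adjoint T)" using key orthogonal_transformation by blast
  have TT: "T (adjoint T e) = e" for e
  proof -
    have "T (adjoint T e) \<bullet> v = e \<bullet> v" for v
      using orth adjoint_works[OF linT] unfolding orthogonal_transformation_def by metis
    then show ?thesis using vector_eq_rdot by blast
  qed
  have "norm (T x) = norm x" for x
  proof -
    obtain e where "x = adjoint T e" using orthogonal_transformation_surj[OF orth] by (metis surjD)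
    then show ?thesis using TT key by metis
  qed
  then show ?thesis using linT orthogonal_transformation by blast
qed

lemma chart_nonexpansive:
  assumes "y \<in> ball y0 r" "z \<in> ball y0 r"
  shows "norm (\<tau> z - \<tau> y) \<le> norm (z - y)"
proof -
  obtain D where D: "\<And>x. x \<in> ball y0 r \<Longrightarrow> (\<tau> has_derivative D x) (at x)"
    using chart_differentiable unfolding differentiable_def by metis
  have "norm (\<tau> z - \<tau> y) \<le> 1 * norm (z - y)"
  proof (rule differentiable_bound[OF convex_ball])
    show "onorm (D x) \<le> 1" if "x \<in> ball y0 r" for x
      using orthogonal_transformation_norm[OF chart_derivative_orthogonal[OF that D[OF that]]]
      by (intro onorm_bound) auto
  qed (use D assms in \<open>auto intro: has_derivative_at_withinI\<close>)
  then show ?thesis by simp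
qed

text \<open>Summed over an orthonormal basis, \<open>chart_quadratic_mean\<close> shows that
  \<open>h\<close> times the squared distance of the images has the same weighted integral as
  \<open>h\<close> times the squared distance of the points. After division by \<open>h y\<close>
  the difference has a nonnegative real part, by \<open>chart_nonexpansive\<close> and
  \<open>Re (h z / h y) > 0\<close>, and zero integral.\<close>

lemma chart_distance_scaled:
  assumes y: "y \<in> ball y0 r" and \<epsilon>: "0 < \<epsilon>" "\<epsilon> < r - dist y0 y" and x: "norm x < 1"
  shows "norm (\<tau> (y + \<epsilon> *\<^sub>R x) - \<tau> y) = \<epsilon> * norm x"
proof -
  define \<rho> where "\<rho> = r - dist y0 y"
  have sub: "ball y \<rho> \<subseteq> ball y0 r" unfolding \<rho>_def by (rule chart_sub_ball)
  have arg: "y + \<epsilon> *\<^sub>R x \<in> ball y0 r" if "norm x < 1" for x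
  proof -
    have "\<epsilon> * norm x < \<rho>" using that \<epsilon> mult_strict_left_mono[of "norm x" 1 \<epsilon>] unfolding \<rho>_def by linarith
    then have "y + \<epsilon> *\<^sub>R x \<in> ball y \<rho>" using \<epsilon> by (simp add: dist_norm)
    then show ?thesis using sub by blast
  qed
  obtain F where F: "profile F" "\<And>t. (F has_real_derivative bump t) (at t)"
    using profile_antideriv[OF profile_bump] by blast
  define m where "m = radial_second_moment TYPE('a) F"
  have h0: "h y \<noteq> 0" using harmonic_chart_nonzero[OF chart y] .
  obtain M where M: "M \<ge> 0" "\<And>x. norm (h x) \<le> M" "h \<in> borel_measurable borel" using chart_h(1) bounded_borelE by metis
  define P where "P x = h (y + \<epsilon> *\<^sub>R x) * of_real ((norm x)\<^sup>2) * of_real (bump ((norm x)\<^sup>2))" for x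
  define K where "K e x = h (y + \<epsilon> *\<^sub>R x) * of_real (((\<tau> (y + \<epsilon> *\<^sub>R x) - \<tau> y) \<bullet> e)\<^sup>2) * of_real (bump ((norm x)\<^sup>2))" for e x
  have intK: "integrable lborel (K e)" for e
  proof -
    obtain C where C: "C \<ge> 0" "\<And>z. norm (h z * of_real (((\<tau> z - \<tau> y) \<bullet> e)\<^sup>2)) \<le> C"
      "(\<lambda>z. h z * of_real (((\<tau> z - \<tau> y) \<bullet> e)\<^sup>2)) \<in> borel_measurable borel"
      by (rule bounded_borelE[OF harmonic_chart_quadratic(1)[OF chart, of "\<tau> y" e]]) (rule that)
    have m: "(\<lambda>x. h (y + \<epsilon> *\<^sub>R x) * of_real (((\<tau> (y + \<epsilon> *\<^sub>R x) - \<tau> y) \<bullet> e)\<^sup>2)) \<in> borel_measurable borel"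
      using measurable_compose[OF _ C(3), of "\<lambda>x. y + \<epsilon> *\<^sub>R x" borel] by simp
    show ?thesis unfolding K_def[abs_def] by (rule integrable_radial_bounded[OF profile_bump m]) (rule C(2))
  qed
  have valK: "(\<integral>x. K e x \<partial>lborel) = of_real (\<epsilon>\<^sup>2 * (e \<bullet> e) * m) * h y" for e
    using chart_quadratic_mean[OF y \<epsilon> F, of e] by (simp add: K_def radial_mean_def m_def)
  have intP: "integrable lborel P"
    unfolding P_def[abs_def]
  proof (rule integrable_radial_bounded[OF profile_bump])
    show "norm (h (y + \<epsilon> *\<^sub>R x) * of_real ((norm x)\<^sup>2)) \<le> M * 1" if "norm x < 1" for x
      unfolding norm_mult using M(1,2) that by (intro mult_mono) (auto simp: power_le_one norm_power)
  qed (use M(3) in measurable)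
  have valP: "(\<integral>x. P x \<partial>lborel) = of_real (DIM('a) * m) * h y"
  proof -
    \<comment> \<open>The factor \<open>(norm x)\<^sup>2\<close> is radial, so it can be absorbed
      into the profile; what remains is a mean of the harmonic function \<open>h\<close>.\<close>
    let ?f = "\<lambda>s. s * bump s"
    have f: "profile ?f" by (rule profile_times_ident[OF profile_bump])
    obtain G where G: "profile G" "\<And>t. (G has_real_derivative ?f t) (at t)" using profile_antideriv[OF f] by blast
    have wh: "weak_laplacian (ball y \<rho>) h (\<lambda>_. 0)" by (rule weak_laplacian_mono[OF chart_h(4) sub])
    have "radial_mean ?f h y \<epsilon> = h y * radial_mass TYPE('a) ?f"
      using mean_value_formula[OF chart_h(1) bounded_borel_const wh chart_isCont(1)[OF y] f G, of 0 \<epsilon>] \<epsilon>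
      by (simp add: radial_mean_def[of G] \<rho>_def)
    moreover have "radial_mean ?f h y \<epsilon> = (\<integral>x. P x \<partial>lborel)"
      by (simp add: radial_mean_def P_def mult.assoc)
    moreover have "radial_mass TYPE('a) ?f = of_real (DIM('a) * m)"
    proof -
      have "radial_mass TYPE('a) ?f = (\<integral>x. (\<Sum>e\<in>Basis. complex_of_real ((x \<bullet> e)\<^sup>2) * of_real (bump ((norm x)\<^sup>2))) \<partial>(lborel :: 'a measure))"
        unfolding radial_mass_def
      proof (rule Bochner_Integration.integral_cong[OF refl])
        fix x :: 'a
        have "(norm x)\<^sup>2 = (\<Sum>e\<in>Basis. (x \<bullet> e)\<^sup>2)"
          by (rule norm_power2_sum_Basis)
        then show "complex_of_real ((norm x)\<^sup>2 * bump ((norm x)\<^sup>2)) = (\<Sum>e\<in>Basis. complex_of_real ((x \<bullet> e)\<^sup>2) * of_real (bump ((norm x)\<^sup>2)))"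
          by (simp only: of_real_mult of_real_sum sum_distrib_right)
      qed
      also have "\<dots> = (\<Sum>e\<in>Basis. \<integral>x. complex_of_real ((x \<bullet> e)\<^sup>2) * of_real (bump ((norm x)\<^sup>2)) \<partial>(lborel :: 'a measure))"
      proof (rule Bochner_Integration.integral_sum)
        fix e :: 'a
        have "continuous_on UNIV (\<lambda>x::'a. (x \<bullet> e)\<^sup>2)" by (intro continuous_intros)
        from integrable_of_real[OF integrable_real_times_bump[OF this], where 'a=complex]
        show "integrable lborel (\<lambda>x::'a. complex_of_real ((x \<bullet> e)\<^sup>2) * of_real (bump ((norm x)\<^sup>2)))"
          by (simp only: of_real_mult)
      qed
      also have "\<dots> = (\<Sum>e\<in>(Basis::'a set). complex_of_real (m * (e \<bullet> e)))"
        unfolding second_moment[OF profile_bump F] m_def ..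
      also have "\<dots> = of_real (DIM('a) * m)" by simp
      finally show ?thesis .
    qed
    ultimately show ?thesis by (simp add: mult.commute)
  qed
  define g where "g x = Re (h (y + \<epsilon> *\<^sub>R x) / h y) * (\<epsilon>\<^sup>2 * (norm x)\<^sup>2 - (norm (\<tau> (y + \<epsilon> *\<^sub>R x) - \<tau> y))\<^sup>2)" for x
  define H where "H x = (of_real (\<epsilon>\<^sup>2) * P x - (\<Sum>e\<in>Basis. K e x)) / h y" for x
  have intH: "integrable lborel H"
    unfolding H_def[abs_def] by (intro integrable_divide Bochner_Integration.integrable_diff integrable_mult_right intP Bochner_Integration.integrable_sum intK)
  have valH: "(\<integral>x. H x \<partial>lborel) = 0"
    unfolding H_def using intP intK
    by (simp add: Bochner_Integration.integral_diff Bochner_Integration.integrable_sum Bochner_Integration.integral_sum valP valK)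
  have ReH: "Re (H x) = g x * bump ((norm x)\<^sup>2)" for x
  proof -
    have "(norm (\<tau> (y + \<epsilon> *\<^sub>R x) - \<tau> y))\<^sup>2 = (\<Sum>e\<in>Basis. ((\<tau> (y + \<epsilon> *\<^sub>R x) - \<tau> y) \<bullet> e)\<^sup>2)"
      by (rule norm_power2_sum_Basis)
    then have "(\<Sum>e\<in>Basis. K e x) = h (y + \<epsilon> *\<^sub>R x) * of_real ((norm (\<tau> (y + \<epsilon> *\<^sub>R x) - \<tau> y))\<^sup>2) * of_real (bump ((norm x)\<^sup>2))"
      by (simp only: K_def of_real_sum sum_distrib_left sum_distrib_right)
    then have "H x = (h (y + \<epsilon> *\<^sub>R x) / h y) * of_real ((\<epsilon>\<^sup>2 * (norm x)\<^sup>2 - (norm (\<tau> (y + \<epsilon> *\<^sub>R x) - \<tau> y))\<^sup>2) * bump ((norm x)\<^sup>2))"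
      by (simp add: H_def P_def field_simps)
    moreover have "Re (a * complex_of_real t) = Re a * t" for a t by simp
    ultimately show ?thesis by (simp only: g_def mult.assoc)
  qed
  have "g x = 0"
  proof (rule integral_times_bump_zero[OF _ _ _ _ x])
    show "integrable lborel (\<lambda>x. g x * bump ((norm x)\<^sup>2))"
      using integrable_Re[OF intH] by (simp add: ReH)
    show "(\<integral>x. g x * bump ((norm x)\<^sup>2) \<partial>lborel) = 0"
      using integral_Re[OF intH] valH by (simp add: ReH)
    show "0 \<le> g x" if "norm x < 1" for x
    proof -
      have "norm (\<tau> (y + \<epsilon> *\<^sub>R x) - \<tau> y) \<le> \<epsilon> * norm x"
        using chart_nonexpansive[OF y arg[OF that]] \<epsilon> by simp
      then have "(norm (\<tau> (y + \<epsilon> *\<^sub>R x) - \<tau> y))\<^sup>2 \<le> (\<epsilon> * norm x)\<^sup>2" by (intro power_mono) auto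
      then show ?thesis unfolding g_def using chart_h(5)[OF y arg[OF that]]
        by (intro mult_nonneg_nonneg) (auto simp: power_mult_distrib)
    qed
    show "continuous_on (ball 0 1) g"
      unfolding g_def[abs_def]
      by (intro continuous_intros continuous_on_compose2[OF chart_h(2)] continuous_on_compose2[OF chart_h(3)])
         (use arg h0 in auto)
  qed
  moreover have "Re (h (y + \<epsilon> *\<^sub>R x) / h y) > 0" using chart_h(5)[OF y arg[OF x]] .
  ultimately have "(norm (\<tau> (y + \<epsilon> *\<^sub>R x) - \<tau> y))\<^sup>2 = (\<epsilon> * norm x)\<^sup>2"
    by (simp add: g_def power_mult_distrib)
  then show ?thesis using \<epsilon> by (simp add: power2_eq_iff_nonneg)
qed

lemma chart_distance:
  assumes y: "y \<in> ball y0 r" and z: "dist y z < r - dist y0 y"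
  shows "dist (\<tau> y) (\<tau> z) = dist y z"
proof -
  obtain \<epsilon> where \<epsilon>: "dist y z < \<epsilon>" "\<epsilon> < r - dist y0 y" using z dense by blast
  then have pos: "\<epsilon> > 0" using zero_le_dist[of y z] by linarith
  define x where "x = (z - y) /\<^sub>R \<epsilon>"
  have "norm x < 1" using \<epsilon> pos unfolding x_def norm_scaleR
    by (simp add: dist_norm norm_minus_commute inverse_eq_divide pos_divide_less_eq)
  from chart_distance_scaled[OF y pos \<epsilon>(2) this] show ?thesis
    using pos by (simp add: x_def dist_norm norm_minus_commute)
qed

text \<open>Distances are preserved near \<open>y0\<close>, and polarisation identifies
  \<open>\<tau>\<close> with its linear part. For \<open>h\<close>: with \<open>\<tau>\<close>
  affine, the kernel in Weyl's formula for its derivative turns the integral into a mean of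
  \<open>h\<close> times a component of \<open>\<tau> - \<tau> y0\<close>, a harmonic function that
  vanishes at \<open>y0\<close>.\<close>

lemma chart_affine:
  assumes "r > 0"
  obtains T where "orthogonal_transformation T" "\<And>z. z \<in> ball y0 (r/3) \<Longrightarrow> \<tau> z = \<tau> y0 + T (z - y0)"
    "(h has_derivative (\<lambda>_. 0)) (at y0)"
proof -
  have y0: "y0 \<in> ball y0 r" using assms by simp
  obtain T where T: "(\<tau> has_derivative T) (at y0)" using chart_differentiable[OF y0] unfolding differentiable_def by blast
  have orth: "orthogonal_transformation T" by (rule chart_derivative_orthogonal[OF y0 T])
  \<comment> \<open>Two points of this ball are less than 2r/3 apart, and
    \<open>r - dist y0 u\<close> exceeds 2r/3, so \<open>chart_distance\<close> applies to every
    pair.\<close>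
  have iso: "dist (\<tau> u) (\<tau> v) = dist u v" if "u \<in> ball y0 (r/3)" "v \<in> ball y0 (r/3)" for u v
  proof (rule chart_distance)
    show "u \<in> ball y0 r" using that assms by simp
    show "dist u v < r - dist y0 u" using that dist_triangle[of u v y0] by (simp add: dist_commute)
  qed
  have polar: "(\<tau> u - \<tau> y0) \<bullet> (\<tau> v - \<tau> y0) = (u - y0) \<bullet> (v - y0)" if "u \<in> ball y0 (r/3)" "v \<in> ball y0 (r/3)" for u v
  proof -
    have "norm (\<tau> u - \<tau> y0) = norm (u - y0)" "norm (\<tau> v - \<tau> y0) = norm (v - y0)"
      using iso[of u y0] iso[of v y0] that assms by (auto simp: dist_norm)
    moreover have "norm ((\<tau> u - \<tau> y0) - (\<tau> v - \<tau> y0)) = norm ((u - y0) - (v - y0))"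
      using iso[OF that] by (simp add: dist_norm)
    ultimately show ?thesis
      using dot_norm_neg[of "\<tau> u - \<tau> y0" "\<tau> v - \<tau> y0"] dot_norm_neg[of "u - y0" "v - y0"] by simp
  qed
  have aff: "\<tau> u = \<tau> y0 + T (u - y0)" if u: "u \<in> ball y0 (r/3)" for u
  proof -
    have "(\<tau> u - \<tau> y0) \<bullet> T k = (u - y0) \<bullet> k" for k
    proof -
      \<comment> \<open>The polarised identity is differentiated in v at \<open>y0\<close>, with u
        fixed.\<close>
      have "((\<lambda>v. (\<tau> u - \<tau> y0) \<bullet> (\<tau> v - \<tau> y0)) has_derivative (\<lambda>k. (\<tau> u - \<tau> y0) \<bullet> T k)) (at y0)"
        by (auto intro!: derivative_eq_intros T)
      then have "((\<lambda>v. (u - y0) \<bullet> (v - y0)) has_derivative (\<lambda>k. (\<tau> u - \<tau> y0) \<bullet> T k)) (at y0)"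
        by (rule has_derivative_transform_within_open[of _ _ _ _ "ball y0 (r/3)"]) (use polar[OF u] assms in auto)
      moreover have "((\<lambda>v. (u - y0) \<bullet> (v - y0)) has_derivative (\<lambda>k. (u - y0) \<bullet> k)) (at y0)"
        by (auto intro!: derivative_eq_intros)
      ultimately show ?thesis using has_derivative_unique by metis
    qed
    moreover have "T (u - y0) \<bullet> T k = (u - y0) \<bullet> k" for k
      using orth unfolding orthogonal_transformation_def by blast
    ultimately have "(\<tau> u - \<tau> y0) \<bullet> T k = T (u - y0) \<bullet> T k" for k by simp
    then have "(\<tau> u - \<tau> y0) \<bullet> w = T (u - y0) \<bullet> w" for w
      using orthogonal_transformation_surj[OF orth] by (metis surjD)
    then have "\<tau> u - \<tau> y0 = T (u - y0)" using vector_eq_rdot by blast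
    then show ?thesis by (simp add: algebra_simps)
  qed
  \<comment> \<open>Below r/3, so that the affine formula holds on the whole support of the
    kernel.\<close>
  define \<epsilon> where "\<epsilon> = r / 4"
  have \<epsilon>: "0 < \<epsilon>" "\<epsilon> < r" "\<epsilon> < r / 3" using assms by (auto simp: \<epsilon>_def)
  obtain f' where f': "profile f'" "\<And>t. (bump has_real_derivative f' t) (at t)"
    using profile_deriv_ex[OF profile_bump] by blast
  let ?d = "\<lambda>s. (\<integral>z. h z * of_real (f' ((norm (z - y0))\<^sup>2 / \<epsilon>\<^sup>2) * (2 * ((y0 - z) \<bullet> s) / \<epsilon>\<^sup>2) / \<epsilon> ^ DIM('a)) \<partial>lborel)"
  have "(h has_derivative (\<lambda>s. ?d s / radial_mass TYPE('a) bump)) (at y0)"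
    by (rule weyl_derivative[OF chart_h(1,4,2) profile_bump f' radial_mass_bump \<epsilon>(1,2)])
  moreover have "?d s = 0" for s
  proof -
    obtain G where G: "profile G" "\<And>t. (G has_real_derivative f' t) (at t)" using profile_bump f' by blast
    let ?u = "\<lambda>z. h z * of_real ((\<tau> z - \<tau> y0) \<bullet> T s)"
    have bu: "bounded_borel ?u" by (rule harmonic_chart_linear(1)[OF chart])
    have "isCont ?u y0" by (intro continuous_intros chart_isCont y0)
    then have "radial_mean f' ?u y0 \<epsilon> = 0"
      using mean_value_formula[OF bu bounded_borel_const harmonic_chart_linear(2)[OF chart] _ f'(1) G, of 0 \<epsilon>] \<epsilon>
      by (simp add: radial_mean_def[of G])
    then have z: "(\<integral>z. ?u z * of_real (f' ((norm (z - y0))\<^sup>2 / \<epsilon>\<^sup>2) / \<epsilon> ^ DIM('a)) \<partial>lborel) = 0"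
      using radial_mean_eq[OF bu f'(1) \<epsilon>(1), of y0] by simp
    have "h z * of_real (f' ((norm (z - y0))\<^sup>2 / \<epsilon>\<^sup>2) * (2 * ((y0 - z) \<bullet> s) / \<epsilon>\<^sup>2) / \<epsilon> ^ DIM('a))
      = of_real (- 2 / \<epsilon>\<^sup>2) * (?u z * of_real (f' ((norm (z - y0))\<^sup>2 / \<epsilon>\<^sup>2) / \<epsilon> ^ DIM('a)))" for z
    proof (cases "z \<in> cball y0 \<epsilon>")
      case True
      then have "\<tau> z = \<tau> y0 + T (z - y0)" using \<epsilon> by (intro aff) auto
      then have "(\<tau> z - \<tau> y0) \<bullet> T s = - ((y0 - z) \<bullet> s)"
        using orth unfolding orthogonal_transformation_def by (simp add: inner_diff_left)
      then show ?thesis by (simp add: field_simps)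
    next
      case False
      have "f' ((norm (z - y0))\<^sup>2 / \<epsilon>\<^sup>2) = 0"
        by (rule radial_zero[OF profile_zero[OF f'(1)] \<epsilon>(1) False])
      then show ?thesis by simp
    qed
    then show ?thesis using z by (simp only: integral_mult_right_zero) simp
  qed
  ultimately have "(h has_derivative (\<lambda>s. 0 / radial_mass TYPE('a) bump)) (at y0)" by (simp only:)
  then have "(h has_derivative (\<lambda>_. 0)) (at y0)" by simp
  then show ?thesis using that[OF orth aff] by blast
qed

end

subsection \<open>Disjointness preserving functionals and Hausdorff measure of graphs\<close>

definition zero_ext :: "'a::euclidean_space set \<Rightarrow> ('a \<Rightarrow> complex) \<Rightarrow> 'a \<Rightarrow> complex" where
  "zero_ext \<Omega> g x = (if x \<in> closure \<Omega> then g x else 0)"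

lemma zero_ext_C_closure: "continuous_on (closure \<Omega>) g \<Longrightarrow> zero_ext \<Omega> g \<in> C_closure \<Omega>"
  unfolding C_closure_def by (auto simp: zero_ext_def cong: continuous_on_cong)

lemma C_closure_continuous: "f \<in> C_closure \<Omega> \<Longrightarrow> continuous_on (closure \<Omega>) f"
  by (simp add: C_closure_def)

lemma C_closure_zero: "f \<in> C_closure \<Omega> \<Longrightarrow> x \<notin> closure \<Omega> \<Longrightarrow> f x = 0"
  by (simp add: C_closure_def)

lemma C_closure_add: "f \<in> C_closure \<Omega> \<Longrightarrow> g \<in> C_closure \<Omega> \<Longrightarrow> (\<lambda>x. f x + g x) \<in> C_closure \<Omega>"
  and C_closure_cmult: "f \<in> C_closure \<Omega> \<Longrightarrow> (\<lambda>x. a * f x) \<in> C_closure \<Omega>"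
  by (auto simp: C_closure_def intro!: continuous_intros)

lemma test_functions_C_closure: "f \<in> test_functions \<Omega> \<Longrightarrow> f \<in> C_closure \<Omega>"
  unfolding C_closure_def using subsetD[OF closure_subset] test_functions_zero
  by (blast intro: smooth_continuous_on test_functions_smooth)

lemma C_closure_bdd_above:
  assumes "bounded \<Omega>" "f \<in> C_closure \<Omega>"
  shows "bdd_above ((\<lambda>x. norm (f x)) ` closure \<Omega>)"
proof -
  have "compact (f ` closure \<Omega>)"
    using assms C_closure_continuous by (intro compact_continuous_image) (auto simp: compact_closure)
  then obtain M where "\<forall>y\<in>f ` closure \<Omega>. norm y \<le> M" using compact_imp_bounded bounded_iff by blast
  then show ?thesis by (intro bdd_aboveI[of _ M]) auto
qed

lemma norm_le_sup_norm:
  assumes "bounded \<Omega>" "f \<in> C_closure \<Omega>" "x \<in> closure \<Omega>"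
  shows "norm (f x) \<le> sup_norm \<Omega> f"
  unfolding sup_norm_def by (rule cSUP_upper[OF assms(3) C_closure_bdd_above[OF assms(1,2)]])

lemma sup_norm_le:
  assumes "\<Omega> \<noteq> {}" "\<And>x. x \<in> closure \<Omega> \<Longrightarrow> norm (f x) \<le> M"
  shows "sup_norm \<Omega> f \<le> M"
  unfolding sup_norm_def using assms by (intro cSUP_least) auto

lemma bounded_borel_C_closure:
  assumes "bounded \<Omega>" "f \<in> C_closure \<Omega>"
  shows "bounded_borel f"
proof (rule bounded_borelI[where M="max 0 (sup_norm \<Omega> f)"])
  show "norm (f x) \<le> max 0 (sup_norm \<Omega> f)" for x
    using norm_le_sup_norm[OF assms, of x] C_closure_zero[OF assms(2), of x] by (cases "x \<in> closure \<Omega>") auto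
  have "(\<lambda>x. if x \<in> closure \<Omega> then f x else 0) \<in> borel_measurable borel"
    using C_closure_continuous[OF assms(2)]
    by (intro borel_measurable_continuous_on_if borel_closed) auto
  moreover have "(\<lambda>x. if x \<in> closure \<Omega> then f x else 0) = f"
    using C_closure_zero[OF assms(2)] by auto
  ultimately show "f \<in> borel_measurable borel" by simp
qed

text \<open>
  The support of a disjointness preserving functional is at most one point: otherwise every point
  would have a neighbourhood on which the functional vanishes, and a partition of unity would kill it.
\<close>

lemma disjointness_preserving_functional:
  fixes \<phi> :: "('a::euclidean_space \<Rightarrow> complex) \<Rightarrow> complex"
  assumes \<Omega>: "bounded \<Omega>" "\<Omega> \<noteq> {}"
    and add: "\<And>f g. f \<in> C_closure \<Omega> \<Longrightarrow> g \<in> C_closure \<Omega> \<Longrightarrow> \<phi> (\<lambda>x. f x + g x) = \<phi> f + \<phi> g"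
    and mult: "\<And>f a. f \<in> C_closure \<Omega> \<Longrightarrow> \<phi> (\<lambda>x. a * f x) = a * \<phi> f"
    and bound: "\<And>f. f \<in> C_closure \<Omega> \<Longrightarrow> norm (\<phi> f) \<le> B * sup_norm \<Omega> f"
    and disj: "\<And>f g. f \<in> C_closure \<Omega> \<Longrightarrow> g \<in> C_closure \<Omega> \<Longrightarrow> (\<And>x. x \<in> closure \<Omega> \<Longrightarrow> f x * g x = 0) \<Longrightarrow> \<phi> f * \<phi> g = 0"
  obtains x where "x \<in> closure \<Omega>" "\<And>f. f \<in> C_closure \<Omega> \<Longrightarrow> \<phi> f = \<phi> (zero_ext \<Omega> (\<lambda>_. 1)) * f x"
proof -
  let ?K = "closure \<Omega>" and ?one = "zero_ext \<Omega> (\<lambda>_. 1)"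
  have K: "compact ?K" using \<Omega>(1) by (simp add: compact_closure)
  have one: "?one \<in> C_closure \<Omega>" by (intro zero_ext_C_closure continuous_intros)
  have "\<exists>x\<in>?K. \<forall>f\<in>C_closure \<Omega>. \<forall>r>0. (\<forall>z\<in>ball x r \<inter> ?K. f z = 0) \<longrightarrow> \<phi> f = 0"
  proof (rule ccontr)
    assume "\<not> ?thesis"
    then have "\<forall>x\<in>?K. \<exists>f r. f \<in> C_closure \<Omega> \<and> r > 0 \<and> (\<forall>z\<in>ball x r \<inter> ?K. f z = 0) \<and> \<phi> f \<noteq> 0" by blast
    then obtain F r where F: "\<And>x. x \<in> ?K \<Longrightarrow> F x \<in> C_closure \<Omega>" "\<And>x. x \<in> ?K \<Longrightarrow> r x > 0"
      "\<And>x z. x \<in> ?K \<Longrightarrow> z \<in> ball x (r x) \<inter> ?K \<Longrightarrow> F x z = 0" "\<And>x. x \<in> ?K \<Longrightarrow> \<phi> (F x) \<noteq> 0"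
      by metis
    have "?K \<subseteq> (\<Union>x\<in>?K. ball x (r x))" using F(2) by force
    then obtain I where I: "I \<subseteq> ?K" "finite I" "?K \<subseteq> (\<Union>x\<in>I. ball x (r x))"
      using compactE_image[OF K, of ?K "\<lambda>x. ball x (r x)"] by blast
    \<comment> \<open>Tent functions supported in the chosen balls; divided by their sum
      \<open>S\<close> they form the partition of unity.\<close>
    define g where "g x z = max 0 (r x - dist x z)" for x z
    define S where "S z = (\<Sum>x\<in>I. g x z)" for z
    have Spos: "S z > 0" if "z \<in> ?K" for z
    proof -
      obtain x where "x \<in> I" "z \<in> ball x (r x)" using I(3) \<open>z \<in> ?K\<close> by blast
      then have "g x z > 0" by (simp add: g_def)
      then show ?thesis unfolding S_def using I(2) \<open>x \<in> I\<close> by (intro sum_pos2) (auto simp: g_def)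
    qed
    have "\<phi> f = 0" if f: "f \<in> C_closure \<Omega>" for f
    proof -
      define p where "p x = zero_ext \<Omega> (\<lambda>z. f z * of_real (g x z / S z))" for x
      have pC: "p x \<in> C_closure \<Omega>" for x
        unfolding p_def g_def S_def
        by (intro zero_ext_C_closure continuous_intros C_closure_continuous f)
           (use Spos in \<open>force simp: S_def g_def\<close>)
      \<comment> \<open>\<open>p x\<close> lives in the ball on which \<open>F x\<close> vanishes,
        so \<open>\<phi>\<close> is zero on one of the two functions, and it is nonzero on
        \<open>F x\<close>.\<close>
      have p0: "\<phi> (p x) = 0" if "x \<in> I" for x
      proof -
        have "\<phi> (p x) * \<phi> (F x) = 0"
        proof (rule disj[OF pC F(1)])
          fix z assume "z \<in> ?K"
          show "p x z * F x z = 0"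
            using F(3)[of x z] \<open>z \<in> ?K\<close> that I(1) by (cases "dist x z < r x") (auto simp: p_def zero_ext_def g_def)
        qed (use that I in auto)
        then show ?thesis using F(4) that I(1) by auto
      qed
      have sum0: "\<phi> (\<lambda>z. \<Sum>x\<in>J. p x z) = 0 \<and> (\<lambda>z. \<Sum>x\<in>J. p x z) \<in> C_closure \<Omega>" if "J \<subseteq> I" for J
        using finite_subset[OF that I(2)] that
      proof (induction J rule: finite_induct)
        case empty
        then show ?case using mult[OF one, of 0] C_closure_cmult[OF one, of 0] by simp
      next
        case (insert x J)
        then show ?case using add[OF pC, of "\<lambda>z. \<Sum>x\<in>J. p x z" x] p0 C_closure_add[OF pC] by simp
      qed
      have "(\<lambda>z. \<Sum>x\<in>I. p x z) = f"
      proof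
        fix z
        show "(\<Sum>x\<in>I. p x z) = f z"
        proof (cases "z \<in> ?K")
          case True
          then have "(\<Sum>x\<in>I. p x z) = f z * of_real (\<Sum>x\<in>I. g x z / S z)"
            by (simp add: p_def zero_ext_def sum_distrib_left)
          also have "(\<Sum>x\<in>I. g x z / S z) = 1"
            using Spos[OF True] by (simp add: sum_divide_distrib[symmetric] S_def[symmetric])
          finally show ?thesis by simp
        next
          case False
          then show ?thesis using C_closure_zero[OF f] by (simp add: p_def zero_ext_def)
        qed
      qed
      then show ?thesis using sum0[of I] by simp
    qed
    then show False using F(1,4) \<Omega>(2) by (metis closure_eq_empty ex_in_conv)
  qed
  then obtain x where x: "x \<in> ?K"
    "\<And>f r. f \<in> C_closure \<Omega> \<Longrightarrow> r > 0 \<Longrightarrow> (\<And>z. z \<in> ball x r \<inter> ?K \<Longrightarrow> f z = 0) \<Longrightarrow> \<phi> f = 0"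
    by blast
  have van: "\<phi> f = 0" if f: "f \<in> C_closure \<Omega>" "f x = 0" for f
  proof (rule ccontr)
    assume "\<phi> f \<noteq> 0"
    \<comment> \<open>With this value a function of norm at most \<open>\<epsilon>\<close> has
      \<open>\<phi>\<close>-value at most half of \<open>norm (\<phi> f)\<close>. The
      \<open>+ 1\<close> keeps the denominator positive.\<close>
    define \<epsilon> where "\<epsilon> = norm (\<phi> f) / (2 * (\<bar>B\<bar> + 1))"
    have \<epsilon>: "\<epsilon> > 0" using \<open>\<phi> f \<noteq> 0\<close> by (simp add: \<epsilon>_def)
    obtain \<delta> where \<delta>: "\<delta> > 0" "\<And>z. z \<in> ?K \<Longrightarrow> dist z x < \<delta> \<Longrightarrow> dist (f z) (f x) < \<epsilon>"
      using C_closure_continuous[OF f(1)] x(1) \<epsilon> unfolding continuous_on_iff by blast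
    \<comment> \<open>\<open>\<psi>\<close> is 0 within \<open>\<delta>/2\<close> of x and 1 beyond
      \<open>\<delta>\<close>. Hence \<open>f1\<close> vanishes near x and is annihilated, while
      \<open>f2\<close> lives where f is small.\<close>
    define \<psi> where "\<psi> z = min 1 (max 0 (2 * dist x z / \<delta> - 1))" for z
    define f1 where "f1 = zero_ext \<Omega> (\<lambda>z. f z * of_real (\<psi> z))"
    define f2 where "f2 = zero_ext \<Omega> (\<lambda>z. f z * of_real (1 - \<psi> z))"
    have C: "f1 \<in> C_closure \<Omega>" "f2 \<in> C_closure \<Omega>"
      unfolding f1_def f2_def \<psi>_def using \<delta>(1)
      by (auto intro!: zero_ext_C_closure continuous_intros C_closure_continuous[OF f(1)])
    have "\<phi> f1 = 0"
    proof (rule x(2)[OF C(1), of "\<delta> / 2"])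
      fix z assume "z \<in> ball x (\<delta> / 2) \<inter> ?K"
      then have "\<psi> z = 0" using \<delta>(1) by (simp add: \<psi>_def field_simps)
      then show "f1 z = 0" by (simp add: f1_def zero_ext_def)
    qed (use \<delta> in auto)
    moreover have "f = (\<lambda>z. f1 z + f2 z)"
      using C_closure_zero[OF f(1)] by (auto simp: fun_eq_iff f1_def f2_def zero_ext_def algebra_simps)
    ultimately have "\<phi> f = \<phi> f2" using add[OF C] by simp
    have "norm (f2 z) \<le> \<epsilon>" if "z \<in> ?K" for z
    proof (cases "dist x z < \<delta>")
      case True
      then have "norm (f z) \<le> \<epsilon>" using \<delta>(2)[OF that] f(2) by (simp add: dist_commute)
      moreover have "0 \<le> \<psi> z" "\<psi> z \<le> 1" by (auto simp: \<psi>_def)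
      then have "\<bar>1 - \<psi> z\<bar> \<le> 1" by auto
      ultimately have "norm (f z) * \<bar>1 - \<psi> z\<bar> \<le> \<epsilon> * 1" using \<epsilon> by (intro mult_mono) auto
      then show ?thesis using that by (simp only: f2_def zero_ext_def if_True norm_mult norm_of_real)
    next
      case False
      then have "\<psi> z = 1" using \<delta>(1) by (simp add: \<psi>_def field_simps)
      then show ?thesis using \<epsilon> by (simp add: f2_def zero_ext_def)
    qed
    then have s: "sup_norm \<Omega> f2 \<le> \<epsilon>" by (rule sup_norm_le[OF \<Omega>(2)])
    have s0: "0 \<le> sup_norm \<Omega> f2" using norm_le_sup_norm[OF \<Omega>(1) C(2) x(1)] norm_ge_zero order_trans by blast
    have "norm (\<phi> f2) \<le> B * sup_norm \<Omega> f2" by (rule bound[OF C(2)])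
    also have "\<dots> \<le> (\<bar>B\<bar> + 1) * \<epsilon>" using s s0 by (intro mult_mono) auto
    also have "\<dots> = norm (\<phi> f) / 2" by (simp add: \<epsilon>_def field_simps)
    finally show False using \<open>\<phi> f = \<phi> f2\<close> \<open>\<phi> f \<noteq> 0\<close> by simp
  qed
  have "\<phi> f = \<phi> ?one * f x" if f: "f \<in> C_closure \<Omega>" for f
  proof -
    define f0 where "f0 = (\<lambda>z. f z + (- f x) * ?one z)"
    have C0: "f0 \<in> C_closure \<Omega>" unfolding f0_def by (intro C_closure_add f C_closure_cmult one)
    have "\<phi> f0 = 0" by (rule van[OF C0]) (use x(1) in \<open>simp add: f0_def zero_ext_def\<close>)
    moreover have "\<phi> f0 = \<phi> f + (- f x) * \<phi> ?one"
      unfolding f0_def using add[OF f C_closure_cmult[OF one]] mult[OF one] by (simp only:)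
    ultimately show ?thesis by (simp add: algebra_simps)
  qed
  with that x(1) show ?thesis by blast
qed

section \<open>Finiteness of the Hausdorff measure of Lipschitz graphs\<close>

lemma emeasure_hausdorff_le: "emeasure (hausdorff_measure s) A \<le> hausdorff_outer s A"
  \<comment> \<open>\<open>measure_of\<close> returns either the given set function or its default
    0, so the upper bound holds in both cases.\<close>
  unfolding hausdorff_measure_def emeasure_measure_of_conv by auto

lemma sets_hausdorff_measure [simp]: "sets (hausdorff_measure s) = sets borel"
  unfolding hausdorff_measure_def using sets.sigma_sets_eq[of borel] by (simp add: sets_measure_of_conv)

text \<open>Over a grid of mesh 1/n in the hyperplane the graph splits into at most (2 n R)^s cells
  of diameter at most c/n, where s = d - 1. The sum (2 n R)^s (c / (2 n))^s = (R c)^s does not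
  depend on n, hence bounds the content at every scale.\<close>

lemma hausdorff_outer_graph_finite:
  fixes \<phi> :: "'a::euclidean_space \<Rightarrow> real"
  assumes e: "norm e = 1" and L: "L-lipschitz_on {y. y \<bullet> e = 0} \<phi>"
    and A: "A \<subseteq> (\<lambda>x. x + \<phi> x *\<^sub>R e) ` {x. x \<bullet> e = 0 \<and> norm x \<le> \<rho>}"
  shows "hausdorff_outer (DIM('a) - 1) A < \<infinity>"
proof -
  let ?s = "DIM('a) - 1" and ?H = "{y. y \<bullet> e = 0}"
  have sub: "subspace ?H" by (rule subspace_hyperplane2)
  have L0: "L \<ge> 0" using L lipschitz_on_nonneg by blast
  have "e \<noteq> 0" using e by auto
  then have dimH: "dim ?H = ?s" using dim_hyperplane[of e] by (simp add: inner_commute)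
  obtain B where B: "B \<subseteq> ?H" "pairwise orthogonal B" "\<And>x. x \<in> B \<Longrightarrow> norm x = 1" "independent B" "card B = dim ?H" "span B = ?H"
    using orthonormal_basis_subspace[OF sub] by metis
  have finB: "finite B" using B(4) independent_imp_finite by blast
  \<comment> \<open>The \<open>+ 1\<close> makes the bound on coordinates strict, as the half-open
    index intervals in \<open>I\<close> require.\<close>
  define R :: nat where "R = nat \<lceil>\<rho>\<rceil> + 1"
  have R: "\<bar>t\<bar> < R" if "\<bar>t\<bar> \<le> \<rho>" for t
    using that unfolding R_def by linarith
  \<comment> \<open>Two points of a grid cell differ by at most 1/n in each of the \<open>?s\<close>
    coordinates; passing to the graph costs a factor 1 + L.\<close>
  define c where "c = (1 + L) * ?s"
  have c0: "c \<ge> 0" using L0 by (simp add: c_def)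
  define M where "M = unit_ball_vol (real ?s) * (R * c) ^ ?s"
  have "hausdorff_content ?s \<delta> A \<le> ennreal M" if \<delta>: "\<delta> > 0" for \<delta>
  proof -
    obtain n :: nat where n: "n > 0" "c / n \<le> \<delta>"
    proof -
      obtain n :: nat where "c / \<delta> < n" using reals_Archimedean2 by blast
      then have "c / real (Suc n) \<le> \<delta>" using \<delta> by (simp add: field_simps)
      then show ?thesis using that[of "Suc n"] by simp
    qed
    define Cell where "Cell k = (\<lambda>x. x + \<phi> x *\<^sub>R e) ` {x. x \<bullet> e = 0 \<and> (\<forall>b\<in>B. \<lfloor>n * (x \<bullet> b)\<rfloor> = k b)}" for k :: "'a \<Rightarrow> int"
    define I where "I = (PiE B (\<lambda>_. {- int (n * R)..<int (n * R)}))"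
    have finI: "finite I" unfolding I_def using finB by (intro finite_PiE) auto
    have cardI: "card I = (2 * n * R) ^ ?s"
    proof -
      have "card {- int (n * R)..<int (n * R)} = n * R + n * R"
        by (simp only: card_atLeastLessThan_int diff_minus_eq_add of_nat_add[symmetric] nat_int)
      then show ?thesis
        unfolding I_def card_PiE[OF finB] by (simp only: prod_constant B(5) dimH mult.assoc mult_2 distrib_right)
    qed
    have cover: "A \<subseteq> (\<Union>k\<in>I. Cell k)"
    proof
      fix a assume "a \<in> A"
      then obtain x where x: "a = x + \<phi> x *\<^sub>R e" "x \<bullet> e = 0" "norm x \<le> \<rho>" using A by blast
      define k where "k = restrict (\<lambda>b. \<lfloor>n * (x \<bullet> b)\<rfloor>) B"
      have "k \<in> I" unfolding I_def
      proof (rule PiE_I)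
        fix b assume b: "b \<in> B"
        have "\<bar>x \<bullet> b\<bar> \<le> \<rho>" using Cauchy_Schwarz_ineq2[of x b] B(3)[OF b] x(3) by simp
        then have "\<bar>x \<bullet> b\<bar> < R" by (rule R)
        then have "n * \<bar>x \<bullet> b\<bar> < n * real R" using n by simp
        then have "\<bar>n * (x \<bullet> b)\<bar> < real (n * R)" by (simp add: abs_mult)
        then have "\<lfloor>n * (x \<bullet> b)\<rfloor> < int (n * R)" "- int (n * R) \<le> \<lfloor>n * (x \<bullet> b)\<rfloor>"
          by linarith+
        then show "k b \<in> {- int (n * R)..<int (n * R)}" using b by (simp add: k_def)
      qed (simp add: k_def)
      moreover have "a \<in> Cell k" unfolding Cell_def using x by (auto simp: k_def)
      ultimately show "a \<in> (\<Union>k\<in>I. Cell k)" by blast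
    qed
    have small: "dist p q \<le> c / n" if pq: "p \<in> Cell k" "q \<in> Cell k" for p q k
    proof -
      obtain x y where x: "p = x + \<phi> x *\<^sub>R e" "x \<bullet> e = 0" "\<forall>b\<in>B. \<lfloor>n * (x \<bullet> b)\<rfloor> = k b"
        and y: "q = y + \<phi> y *\<^sub>R e" "y \<bullet> e = 0" "\<forall>b\<in>B. \<lfloor>n * (y \<bullet> b)\<rfloor> = k b"
        using pq unfolding Cell_def by blast
      have "x - y \<in> span B" using x y B(6) by (simp add: inner_diff_left)
      then have "x - y = (\<Sum>b\<in>B. ((x - y) \<bullet> b) *\<^sub>R b)"
        using orthonormal_basis_expand[OF B(2,3) _ finB] by metis
      then have "norm (x - y) \<le> (\<Sum>b\<in>B. norm (((x - y) \<bullet> b) *\<^sub>R b))" by (metis norm_sum)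
      also have "\<dots> \<le> (\<Sum>b\<in>B. 1 / n)"
      proof (rule sum_mono)
        fix b assume b: "b \<in> B"
        then have "\<lfloor>n * (x \<bullet> b)\<rfloor> = \<lfloor>n * (y \<bullet> b)\<rfloor>" using x y by simp
        then have "\<bar>n * (x \<bullet> b) - n * (y \<bullet> b)\<bar> < 1" by linarith
        moreover have "\<bar>n * (x \<bullet> b) - n * (y \<bullet> b)\<bar> = n * \<bar>(x - y) \<bullet> b\<bar>"
          by (simp add: inner_diff_left right_diff_distrib[symmetric] abs_mult)
        ultimately have "\<bar>(x - y) \<bullet> b\<bar> \<le> 1 / n" using n by (simp add: field_simps)
        then show "norm (((x - y) \<bullet> b) *\<^sub>R b) \<le> 1 / n" using B(3)[OF b] by simp
      qed
      also have "\<dots> = ?s / n" using B(5) dimH by simp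
      finally have 1: "norm (x - y) \<le> ?s / n" .
      have "\<bar>\<phi> x - \<phi> y\<bar> \<le> L * norm (x - y)"
        using lipschitz_onD[OF L, of x y] x y by (simp add: dist_norm)
      moreover have "p - q = (x - y) + (\<phi> x - \<phi> y) *\<^sub>R e" using x y by (simp add: algebra_simps)
      then have "norm (p - q) \<le> norm (x - y) + \<bar>\<phi> x - \<phi> y\<bar>"
        using norm_triangle_ineq[of "x - y" "(\<phi> x - \<phi> y) *\<^sub>R e"] e by simp
      ultimately have "norm (p - q) \<le> (1 + L) * norm (x - y)" by (simp add: algebra_simps)
      also have "\<dots> \<le> (1 + L) * (?s / n)" using 1 L0 by (intro mult_left_mono) auto
      finally show ?thesis by (simp add: dist_norm c_def)
    qed
    have cn: "0 \<le> c / n" using c0 by simp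
    have bdd: "bounded (Cell k)" for k using small bounded_two_points by blast
    have diam: "diameter (Cell k) \<le> c / n" for k
      using small cn by (intro diameter_le) (auto simp: dist_norm)
    obtain g where g: "bij_betw g {..<card I} I"
      using ex_bij_betw_nat_finite[OF finI] by (auto simp: atLeast0LessThan)
    \<comment> \<open>Padding by empty sets adds nothing, also for d = 1, where the exponent is 0
      and every non-empty set counts 1.\<close>
    define C where "C i = (if i < card I then Cell (g i) else {})" for i
    let ?t = "\<lambda>i. if C i = {} then 0 else ennreal (unit_ball_vol (real ?s) * (diameter (C i) / 2) ^ ?s)"
    have Cprop: "A \<subseteq> (\<Union>i. C i)" "bounded (C i)" "diameter (C i) \<le> \<delta>" for i
    proof -
      have CI: "Cell k \<subseteq> (\<Union>i. C i)" if "k \<in> I" for k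
      proof -
        have "k \<in> g ` {..<card I}" using g that by (simp add: bij_betw_def)
        then obtain i where "i < card I" "g i = k" by blast
        then have "C i = Cell k" by (simp add: C_def)
        then show ?thesis by blast
      qed
      show "A \<subseteq> (\<Union>i. C i)" by (rule subset_trans[OF cover UN_least[OF CI]])
      show "bounded (C i)" using bdd by (simp add: C_def)
      show "diameter (C i) \<le> \<delta>" using order_trans[OF diam n(2)] \<delta> by (simp add: C_def)
    qed
    have "hausdorff_content ?s \<delta> A \<le> (\<Sum>i. ?t i)"
      unfolding hausdorff_content_def by (rule INF_lower) (use Cprop in auto)
    also have "\<dots> = (\<Sum>i<card I. ?t i)"
      by (rule suminf_finite) (auto simp: C_def)
    also have "\<dots> \<le> (\<Sum>i<card I. ennreal (unit_ball_vol (real ?s) * (c / n / 2) ^ ?s))"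
    proof (rule sum_mono)
      fix i assume "i \<in> {..<card I}"
      have "(diameter (C i) / 2) ^ ?s \<le> (c / n / 2) ^ ?s"
        using diam[of "g i"] diameter_ge_0[OF bdd[of "g i"]] \<open>i \<in> _\<close> by (intro power_mono divide_right_mono) (auto simp: C_def)
      then show "?t i \<le> ennreal (unit_ball_vol (real ?s) * (c / n / 2) ^ ?s)"
        by (auto intro!: ennreal_leI mult_left_mono)
    qed
    also have "\<dots> = of_nat (card I) * ennreal (unit_ball_vol (real ?s) * (c / n / 2) ^ ?s)" by simp
    also have "\<dots> = ennreal (real (card I) * (unit_ball_vol (real ?s) * (c / n / 2) ^ ?s))"
      by (simp add: ennreal_mult' ennreal_of_nat_eq_real_of_nat)
    also have "real (card I) * (unit_ball_vol (real ?s) * (c / n / 2) ^ ?s) = M"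
    proof -
      have "real (card I) * (c / n / 2) ^ ?s = (real (2 * n * R) * (c / n / 2)) ^ ?s"
        unfolding cardI of_nat_power by (rule power_mult_distrib[symmetric])
      also have "real (2 * n * R) * (c / n / 2) = R * c" using n by simp
      finally have "real (card I) * (c / n / 2) ^ ?s = (R * c) ^ ?s" .
      then show ?thesis unfolding M_def by (subst mult.left_commute) simp
    qed
    finally show ?thesis .
  qed
  then have "hausdorff_outer ?s A \<le> ennreal M"
    unfolding hausdorff_outer_def by (intro SUP_least) auto
  from le_less_trans[OF this ennreal_less_top] show ?thesis by simp
qed

subsection \<open>Normal derivatives at Lipschitz boundaries\<close>

lemma integrable_const_lebesgue_on:
  assumes "bounded \<Omega>" "open \<Omega>"
  shows "integrable (lebesgue_on \<Omega>) (\<lambda>_. c)"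
  by (rule finite_measure.integrable_const[OF finite_measure_lebesgue_on[OF lmeasurable_open[OF assms]]])

lemma L2_imp_integrable:
  fixes f :: "'a::euclidean_space \<Rightarrow> complex"
  assumes "bounded \<Omega>" "open \<Omega>" "L2 (lebesgue_on \<Omega>) f"
  shows "integrable (lebesgue_on \<Omega>) f"
proof (rule Bochner_Integration.integrable_bound[where f="\<lambda>x. 1 + (norm (f x))\<^sup>2"])
  show "integrable (lebesgue_on \<Omega>) (\<lambda>x. 1 + (norm (f x))\<^sup>2)"
    using assms(3) unfolding L2_def
    by (intro Bochner_Integration.integrable_add integrable_const_lebesgue_on assms) auto
  have "t \<le> 1 + t\<^sup>2" for t :: real
  proof -
    have "0 \<le> t\<^sup>2 - 2 * t + 1" using zero_le_power2[of "t - 1"] by (simp add: power2_diff)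
    then show ?thesis using zero_le_power2[of t] by linarith
  qed
  then show "AE x in lebesgue_on \<Omega>. norm (f x) \<le> norm (1 + (norm (f x))\<^sup>2)" by simp
qed (use assms(3) in \<open>simp add: L2_def\<close>)

text \<open>Distributional identities on \<open>\<Omega>\<close> see only test functions supported
  inside it, whereas the boundary argument tests with functions that cross the boundary. Cutoffs
  equal to 1 on an exhaustion of \<open>\<Omega>\<close> by compact sets bridge the gap, by
  dominated convergence.\<close>

lemma annihilator_extend:
  fixes g :: "'a::euclidean_space \<Rightarrow> complex"
  assumes \<Omega>: "open \<Omega>" and g: "integrable (lebesgue_on \<Omega>) g" and v: "v \<in> test_functions B"
    and ann: "\<And>\<psi>. \<psi> \<in> test_functions (\<Omega> \<inter> B) \<Longrightarrow> (LINT x|lebesgue_on \<Omega>. g x * \<psi> x) = 0"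
  shows "(LINT x|lebesgue_on \<Omega>. g x * v x) = 0"
proof -
  obtain C :: "nat \<Rightarrow> 'a set" where C: "\<And>n. compact (C n)" "\<And>n. C n \<subseteq> \<Omega>"
      "\<And>K. compact K \<Longrightarrow> K \<subseteq> \<Omega> \<Longrightarrow> \<exists>N. \<forall>n\<ge>N. K \<subseteq> C n"
    using open_Union_compact_subsets[OF \<Omega>] by metis
  have "\<exists>\<kappa> :: 'a \<Rightarrow> real. (\<lambda>x. complex_of_real (\<kappa> x)) \<in> test_functions \<Omega> \<and> (\<forall>x. 0 \<le> \<kappa> x \<and> \<kappa> x \<le> 1) \<and> (\<forall>x\<in>C n. \<kappa> x = 1)" for n
  proof -
    obtain \<kappa> :: "'a \<Rightarrow> real" where "(\<lambda>x. complex_of_real (\<kappa> x)) \<in> test_functions \<Omega>"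
      "\<And>x. 0 \<le> \<kappa> x" "\<And>x. \<kappa> x \<le> 1" "\<And>x. x \<in> C n \<Longrightarrow> \<kappa> x = 1"
      by (rule smooth_Urysohn[OF C(1) \<Omega> C(2), of n]) (rule that)
    then show ?thesis by blast
  qed
  then obtain \<kappa> :: "nat \<Rightarrow> 'a \<Rightarrow> real" where k: "\<And>n. (\<lambda>x. complex_of_real (\<kappa> n x)) \<in> test_functions \<Omega>"
    "\<And>n x. 0 \<le> \<kappa> n x" "\<And>n x. \<kappa> n x \<le> 1" "\<And>n x. x \<in> C n \<Longrightarrow> \<kappa> n x = 1" by metis
  have test: "(\<lambda>x. v x * of_real (\<kappa> n x)) \<in> test_functions (\<Omega> \<inter> B)" for n
  proof -
    obtain K where K: "compact K" "K \<subseteq> \<Omega>" "\<And>x. x \<notin> K \<Longrightarrow> complex_of_real (\<kappa> n x) = 0"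
      using k(1) test_functionsE by metis
    obtain L where L: "compact L" "L \<subseteq> B" "\<And>x. x \<notin> L \<Longrightarrow> v x = 0" using v test_functionsE by metis
    show ?thesis
      by (rule test_functionsI[of _ "K \<inter> L"])
         (use K L smooth_mult[OF test_functions_smooth[OF v] test_functions_smooth[OF k(1)]] in \<open>auto intro: compact_Int\<close>)
  qed
  obtain M where M: "M \<ge> 0" "\<And>x. norm (v x) \<le> M" "v \<in> borel_measurable borel"
    by (rule bounded_borelE[OF bounded_borel_test[OF v]]) (rule that)
  have mb: "f \<in> borel_measurable (lebesgue_on \<Omega>)" if "f \<in> borel_measurable borel" for f :: "'a \<Rightarrow> complex"
    using that by (intro measurable_restrict_space1 measurable_completion) simp
  have mg: "g \<in> borel_measurable (lebesgue_on \<Omega>)" using g by simp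
  have "(\<lambda>n. LINT x|lebesgue_on \<Omega>. g x * (v x * of_real (\<kappa> n x))) \<longlonglongrightarrow> (LINT x|lebesgue_on \<Omega>. g x * v x)"
  proof (rule integral_dominated_convergence[where w="\<lambda>x. norm (g x) * M"])
    show "(\<lambda>x. g x * v x) \<in> borel_measurable (lebesgue_on \<Omega>)"
      using mg mb[OF M(3)] by (rule borel_measurable_times)
    show "(\<lambda>x. g x * (v x * of_real (\<kappa> n x))) \<in> borel_measurable (lebesgue_on \<Omega>)" for n
      using mg mb[OF smooth_borel[OF test_functions_smooth[OF test[of n]]]] by (rule borel_measurable_times)
    show "integrable (lebesgue_on \<Omega>) (\<lambda>x. norm (g x) * M)"
      using g by (intro integrable_mult_left integrable_norm)
    show "AE x in lebesgue_on \<Omega>. norm (g x * (v x * of_real (\<kappa> n x))) \<le> norm (g x) * M" for n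
    proof (rule AE_I2)
      fix x
      have "norm (v x) * \<kappa> n x \<le> M * 1" using M k(2,3) by (intro mult_mono) auto
      then show "norm (g x * (v x * of_real (\<kappa> n x))) \<le> norm (g x) * M"
        using k(2)[of n x] by (simp add: norm_mult mult_left_mono)
    qed
    show "AE x in lebesgue_on \<Omega>. (\<lambda>n. g x * (v x * of_real (\<kappa> n x))) \<longlonglongrightarrow> g x * v x"
    proof (rule AE_I2)
      fix x assume "x \<in> space (lebesgue_on \<Omega>)"
      then have "x \<in> \<Omega>" by simp
      then obtain N where N: "\<forall>n\<ge>N. {x} \<subseteq> C n" using C(3)[of "{x}"] by auto
      have "eventually (\<lambda>n. g x * v x = g x * (v x * of_real (\<kappa> n x))) sequentially"
        using N k(4) by (intro eventually_sequentiallyI[of N]) auto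
      then show "(\<lambda>n. g x * (v x * of_real (\<kappa> n x))) \<longlonglongrightarrow> g x * v x"
        by (rule Lim_transform_eventually[OF tendsto_const])
    qed
  qed
  then have "(\<lambda>n. 0) \<longlonglongrightarrow> (LINT x|lebesgue_on \<Omega>. g x * v x)" using ann[OF test] by simp
  then show ?thesis by (simp add: LIMSEQ_const_iff)
qed

lemma L2_bounded_lebesgue_on:
  assumes "bounded \<Omega>" "open \<Omega>" "bounded_borel (f :: 'a::euclidean_space \<Rightarrow> complex)"
  shows "L2 (lebesgue_on \<Omega>) f"
proof -
  obtain M where M: "M \<ge> 0" "\<And>x. norm (f x) \<le> M" "f \<in> borel_measurable borel"
    by (rule bounded_borelE[OF assms(3)]) (rule that)
  have mb: "f \<in> borel_measurable (lebesgue_on \<Omega>)"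
    using M(3) by (intro measurable_restrict_space1 measurable_completion) simp
  have "integrable (lebesgue_on \<Omega>) (\<lambda>x. (norm (f x))\<^sup>2)"
  proof (rule Bochner_Integration.integrable_bound[where f="\<lambda>x. M\<^sup>2"])
    show "integrable (lebesgue_on \<Omega>) (\<lambda>x. M\<^sup>2)" by (rule integrable_const_lebesgue_on[OF assms(1,2)])
    show "AE x in lebesgue_on \<Omega>. norm ((norm (f x))\<^sup>2) \<le> norm (M\<^sup>2)"
      using M by (intro AE_I2) (simp add: power_mono)
  qed (use mb in measurable)
  then show ?thesis using mb by (simp add: L2_def)
qed

lemma has_H1_gradient_test:
  assumes "bounded \<Omega>" "open \<Omega>" "v \<in> test_functions B"
  shows "has_H1_gradient \<Omega> v (\<lambda>b. pderiv_dir b v)"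
  unfolding has_H1_gradient_def
proof (intro conjI ballI)
  show "L2 (lebesgue_on \<Omega>) v" using L2_bounded_lebesgue_on assms bounded_borel_test by blast
  fix b :: 'a assume b: "b \<in> Basis"
  have pt: "pderiv_dir b v \<in> test_functions B" using assms(3) b test_functions_pderiv_dir by blast
  then show "L2 (lebesgue_on \<Omega>) (pderiv_dir b v)" using L2_bounded_lebesgue_on assms bounded_borel_test by blast
  fix \<phi> assume \<phi>: "\<phi> \<in> test_functions \<Omega>"
  have p\<phi>: "pderiv_dir b \<phi> \<in> test_functions \<Omega>" using \<phi> b test_functions_pderiv_dir by blast
  note bm = smooth_borel[OF test_functions_smooth]
  have \<Omega>: "\<Omega> \<in> sets lebesgue" using assms(2) by (simp add: borel_open)
  have "(LINT x|lebesgue_on \<Omega>. v x * pderiv_dir b \<phi> x) = (\<integral>x. v x * pderiv_dir b \<phi> x \<partial>lborel)"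
    by (rule integral_lebesgue_on_supported[OF _ \<Omega>])
       (use bm[OF assms(3)] bm[OF p\<phi>] test_functions_zero[OF p\<phi>] in auto)
  also have "\<dots> = - (\<integral>x. pderiv_dir b v x * \<phi> x \<partial>lborel)"
    by (rule integral_by_parts_test[OF test_functions_smooth[OF assms(3)] \<phi> b])
  also have "(\<integral>x. pderiv_dir b v x * \<phi> x \<partial>lborel) = (LINT x|lebesgue_on \<Omega>. pderiv_dir b v x * \<phi> x)"
    by (rule integral_lebesgue_on_supported[OF _ \<Omega>, symmetric])
       (use bm[OF pt] bm[OF \<phi>] test_functions_zero[OF \<phi>] in auto)
  finally show "(LINT x|lebesgue_on \<Omega>. v x * pderiv_dir b \<phi> x) = - (LINT x|lebesgue_on \<Omega>. pderiv_dir b v x * \<phi> x)" .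
qed

lemma has_trace_test:
  assumes "bounded \<Omega>" "open \<Omega>" "v \<in> test_functions B" "L2 (surface_measure \<Omega>) v"
  shows "has_trace \<Omega> v v"
  unfolding has_trace_def
proof (intro conjI exI)
  show "has_H1_gradient \<Omega> v (\<lambda>b. pderiv_dir b v)" by (rule has_H1_gradient_test[OF assms(1-3)])
  show "\<forall>n::nat. continuous_on (closure \<Omega>) ((\<lambda>_. v) n) \<and> has_H1_gradient \<Omega> ((\<lambda>_. v) n) ((\<lambda>_ b. pderiv_dir b v) n) \<and> L2 (surface_measure \<Omega>) ((\<lambda>_. v) n)"
    using has_H1_gradient_test[OF assms(1-3)] assms(4) smooth_continuous_on[OF test_functions_smooth[OF assms(3)]] by simp
qed (use assms(4) in auto)

lemma affine_lower_order:
  fixes a :: "'a::euclidean_space" and k :: real and c :: complex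
  defines "u \<equiv> \<lambda>x. c * complex_of_real (x \<bullet> a + k)"
  shows "smooth u" "pderiv_dir b u x = c * of_real (b \<bullet> a)" "laplacian u x = 0"
proof -
  have e: "u = (\<lambda>x. c * (complex_of_real (x \<bullet> a) + complex_of_real k))" by (simp add: u_def)
  have s1: "smooth (\<lambda>x. complex_of_real (x \<bullet> a) + complex_of_real k)"
    by (intro smooth_add smooth_inner smooth_const)
  show "smooth u" unfolding e by (intro smooth_mult smooth_const s1)
  have p: "pderiv_dir b u = (\<lambda>x. c * of_real (b \<bullet> a))" for b
    unfolding e pderiv_dir_mult[OF smooth_const s1] pderiv_dir_add[OF smooth_inner smooth_const] pderiv_dir_inner
    by simp
  then show "pderiv_dir b u x = c * of_real (b \<bullet> a)" by simp
  show "laplacian u x = 0" unfolding laplacian_def p by simp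
qed

text \<open>The functions \<open>G\<close> and \<open>w\<close> come from an existential statement,
  so their pointwise values are unknown. Tested inside \<open>\<Omega> \<inter> B\<close> they agree
  with the gradient and Laplacian of the affine function, and \<open>annihilator_extend\<close>
  carries this over to test functions on \<open>B\<close>. The defining identity of the normal
  derivative then retains only the derivative of \<open>q\<close> along \<open>a\<close>.\<close>

lemma normal_derivative_affine:
  fixes u :: "'a::euclidean_space \<Rightarrow> complex" and q :: "'a \<Rightarrow> real"
  assumes \<Omega>: "bounded \<Omega>" "open \<Omega>" and h: "has_normal_derivative \<Omega> u h"
    and aff: "\<And>x. x \<in> \<Omega> \<inter> B \<Longrightarrow> u x = c * complex_of_real (x \<bullet> a + k)"
    and v: "(\<lambda>x. complex_of_real (q x)) \<in> test_functions B" and tr: "L2 (surface_measure \<Omega>) (\<lambda>x. complex_of_real (q x))"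
  shows "(LINT x|lebesgue_on \<Omega>. c * pderiv_dir a (\<lambda>x. complex_of_real (q x)) x) = (LINT z|surface_measure \<Omega>. h z * of_real (q z))"
proof -
  let ?v = "\<lambda>x. complex_of_real (q x)" and ?l = "\<lambda>x. c * complex_of_real (x \<bullet> a + k)"
  obtain G w where G: "has_H1_gradient \<Omega> u G" and w: "L2 (lebesgue_on \<Omega>) w" "has_dist_laplacian \<Omega> u w"
    and id: "\<And>v G' g. has_H1_gradient \<Omega> v G' \<Longrightarrow> has_trace \<Omega> v g \<Longrightarrow>
        (LINT x|lebesgue_on \<Omega>. (\<Sum>b\<in>Basis. G b x * cnj (G' b x)) + w x * cnj (v x)) =
        (LINT z|surface_measure \<Omega>. h z * cnj (g z))"
    using h unfolding has_normal_derivative_def by blast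
  note sv = test_functions_smooth[OF v]
  have \<Omega>s: "\<Omega> \<in> sets lebesgue" using \<Omega>(2) by (simp add: borel_open)
  \<comment> \<open>Testing with real \<open>q\<close> removes the conjugations from the weak
    identity.\<close>
  have cnjp: "cnj (pderiv_dir b ?v x) = pderiv_dir b ?v x" for b x
    using smooth_of_real_has_derivative(2)[OF sv, of b x] by (metis complex_cnj_complex_of_real)
  have intw: "integrable (lebesgue_on \<Omega>) w" by (rule L2_imp_integrable[OF \<Omega> w(1)])
  have intG: "integrable (lebesgue_on \<Omega>) (G b)" if "b \<in> Basis" for b
    using G that unfolding has_H1_gradient_def by (intro L2_imp_integrable[OF \<Omega>]) auto
  have to_lborel: "(LINT x|lebesgue_on \<Omega>. u x * \<psi> x) = (\<integral>x. ?l x * \<psi> x \<partial>lborel)"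
    if \<psi>: "\<psi> \<in> test_functions (\<Omega> \<inter> B)" for \<psi>
  proof -
    have "(LINT x|lebesgue_on \<Omega>. u x * \<psi> x) = (LINT x|lebesgue_on \<Omega>. ?l x * \<psi> x)"
      using aff test_functions_zero[OF \<psi>] by (intro Bochner_Integration.integral_cong refl) (metis IntI mult_zero_right)
    also have "\<dots> = (\<integral>x. ?l x * \<psi> x \<partial>lborel)"
      by (rule integral_lebesgue_on_supported[OF _ \<Omega>s])
         (use smooth_borel[OF affine_lower_order(1)[of c a k]] smooth_borel[OF test_functions_smooth[OF \<psi>]] test_functions_zero[OF \<psi>] in auto)
    finally show ?thesis .
  qed
  have w0: "(LINT x|lebesgue_on \<Omega>. w x * ?v x) = 0"
  proof (rule annihilator_extend[OF \<Omega>(2) intw v])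
    fix \<psi> assume \<psi>: "\<psi> \<in> test_functions (\<Omega> \<inter> B)"
    then have "\<psi> \<in> test_functions \<Omega>" using test_functions_mono[of "\<Omega> \<inter> B" \<Omega>] by blast
    then have "(LINT x|lebesgue_on \<Omega>. w x * \<psi> x) = (LINT x|lebesgue_on \<Omega>. u x * laplacian \<psi> x)"
      using w(2) unfolding has_dist_laplacian_def by simp
    also have "\<dots> = (\<integral>x. ?l x * laplacian \<psi> x \<partial>lborel)" by (rule to_lborel[OF test_functions_laplacian[OF \<psi>]])
    also have "\<dots> = 0" using integral_laplacian_symmetric[OF affine_lower_order(1)[of c a k] \<psi>] affine_lower_order(3)[of c a k] by simp
    finally show "(LINT x|lebesgue_on \<Omega>. w x * \<psi> x) = 0" .
  qed
  have intv: "integrable (lebesgue_on \<Omega>) (\<lambda>x. g x * \<psi> x)" if g: "integrable (lebesgue_on \<Omega>) g" and \<psi>: "\<psi> \<in> test_functions B" for g \<psi>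
  proof -
    obtain M where M: "M \<ge> 0" "\<And>x. norm (\<psi> x) \<le> M" "\<psi> \<in> borel_measurable borel"
      by (rule bounded_borelE[OF bounded_borel_test[OF \<psi>]]) (rule that)
    have mb: "\<psi> \<in> borel_measurable (lebesgue_on \<Omega>)"
      using M(3) by (intro measurable_restrict_space1 measurable_completion) simp
    show ?thesis
      by (rule Bochner_Integration.integrable_bound[where f="\<lambda>x. norm (g x) * M"])
         (use g mb M in \<open>auto simp: norm_mult intro!: AE_I2 mult_left_mono borel_measurable_times\<close>)
  qed
  have G0: "(LINT x|lebesgue_on \<Omega>. G b x * pderiv_dir b ?v x) = (LINT x|lebesgue_on \<Omega>. c * of_real (b \<bullet> a) * pderiv_dir b ?v x)"
    if b: "b \<in> Basis" for b
  proof -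
    have pv: "pderiv_dir b ?v \<in> test_functions B" using v b test_functions_pderiv_dir by blast
    have ic: "integrable (lebesgue_on \<Omega>) (\<lambda>x. c * of_real (b \<bullet> a))" by (rule integrable_const_lebesgue_on[OF \<Omega>])
    have "(LINT x|lebesgue_on \<Omega>. (G b x - c * of_real (b \<bullet> a)) * pderiv_dir b ?v x) = 0"
    proof (rule annihilator_extend[OF \<Omega>(2) _ pv])
      show "integrable (lebesgue_on \<Omega>) (\<lambda>x. G b x - c * of_real (b \<bullet> a))" using intG[OF b] ic by simp
      fix \<psi> assume \<psi>: "\<psi> \<in> test_functions (\<Omega> \<inter> B)"
      then have \<psi>\<Omega>: "\<psi> \<in> test_functions \<Omega>" and \<psi>B: "\<psi> \<in> test_functions B"
        using test_functions_mono[of "\<Omega> \<inter> B" \<Omega>] test_functions_mono[of "\<Omega> \<inter> B" B] by blast+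
      have "- (LINT x|lebesgue_on \<Omega>. G b x * \<psi> x) = (LINT x|lebesgue_on \<Omega>. u x * pderiv_dir b \<psi> x)"
        using G b \<psi>\<Omega> unfolding has_H1_gradient_def by simp
      also have "\<dots> = (\<integral>x. ?l x * pderiv_dir b \<psi> x \<partial>lborel)" by (rule to_lborel[OF test_functions_pderiv_dir[OF \<psi> b]])
      also have "\<dots> = - (\<integral>x. c * of_real (b \<bullet> a) * \<psi> x \<partial>lborel)"
        using integral_by_parts_test[OF affine_lower_order(1)[of c a k] \<psi> b] affine_lower_order(2)[of b c a k] by simp
      also have "(\<integral>x. c * of_real (b \<bullet> a) * \<psi> x \<partial>lborel) = (LINT x|lebesgue_on \<Omega>. c * of_real (b \<bullet> a) * \<psi> x)"
        by (rule integral_lebesgue_on_supported[OF _ \<Omega>s, symmetric])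
           (use smooth_borel[OF test_functions_smooth[OF \<psi>]] test_functions_zero[OF \<psi>\<Omega>] in auto)
      finally show "(LINT x|lebesgue_on \<Omega>. (G b x - c * of_real (b \<bullet> a)) * \<psi> x) = 0"
        unfolding left_diff_distrib using Bochner_Integration.integral_diff[OF intv[OF intG[OF b] \<psi>B] intv[OF ic \<psi>B]] by (simp only: neg_equal_iff_equal diff_self)
    qed
    moreover have "(LINT x|lebesgue_on \<Omega>. (G b x - c * of_real (b \<bullet> a)) * pderiv_dir b ?v x) =
      (LINT x|lebesgue_on \<Omega>. G b x * pderiv_dir b ?v x) - (LINT x|lebesgue_on \<Omega>. c * of_real (b \<bullet> a) * pderiv_dir b ?v x)"
      unfolding left_diff_distrib by (rule Bochner_Integration.integral_diff[OF intv[OF intG[OF b] pv] intv[OF ic pv]])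
    ultimately show ?thesis by (simp only: right_minus_eq)
  qed
  have pv: "pderiv_dir b ?v \<in> test_functions B" if "b \<in> Basis" for b using v that test_functions_pderiv_dir by blast
  have "(LINT z|surface_measure \<Omega>. h z * of_real (q z)) = (LINT x|lebesgue_on \<Omega>. (\<Sum>b\<in>Basis. G b x * pderiv_dir b ?v x) + w x * ?v x)"
    using id[OF has_H1_gradient_test[OF \<Omega> v] has_trace_test[OF \<Omega> v tr]] by (simp add: cnjp)
  also have "\<dots> = (LINT x|lebesgue_on \<Omega>. (\<Sum>b\<in>Basis. G b x * pderiv_dir b ?v x)) + (LINT x|lebesgue_on \<Omega>. w x * ?v x)"
    using intv intG intw v pv by (intro Bochner_Integration.integral_add Bochner_Integration.integrable_sum) auto
  also have "\<dots> = (\<Sum>b\<in>Basis. LINT x|lebesgue_on \<Omega>. G b x * pderiv_dir b ?v x)"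
    unfolding w0 using intv intG pv by (subst Bochner_Integration.integral_sum) auto
  also have "\<dots> = (\<Sum>b\<in>Basis. LINT x|lebesgue_on \<Omega>. c * of_real (b \<bullet> a) * pderiv_dir b ?v x)"
    using G0 by simp
  also have "\<dots> = (LINT x|lebesgue_on \<Omega>. (\<Sum>b\<in>Basis. c * of_real (b \<bullet> a) * pderiv_dir b ?v x))"
    using intv[OF integrable_const_lebesgue_on[OF \<Omega>]] pv by (intro Bochner_Integration.integral_sum[symmetric]) auto
  also have "\<dots> = (LINT x|lebesgue_on \<Omega>. c * pderiv_dir a ?v x)"
  proof (rule Bochner_Integration.integral_cong[OF refl])
    fix x
    show "(\<Sum>b\<in>Basis. c * of_real (b \<bullet> a) * pderiv_dir b ?v x) = c * pderiv_dir a ?v x"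
      unfolding pderiv_dir_sum_Basis[OF sv, of a x]
      by (simp add: sum_distrib_left mult.assoc inner_commute)
  qed
  finally show ?thesis by simp
qed

text \<open>A bounded function living on a piece of the boundary of finite measure;
  \<open>fin\<close> will be supplied by the graph estimate in
  \<open>frontier_hausdorff_finite\<close>.\<close>

lemma L2_surface_test:
  assumes fin: "hausdorff_outer (DIM('a) - 1) (frontier \<Omega> \<inter> B) < \<infinity>" and B: "open B"
    and v: "v \<in> test_functions (B :: 'a::euclidean_space set)"
  shows "L2 (surface_measure \<Omega>) v"
proof -
  let ?H = "hausdorff_measure (DIM('a) - 1) :: 'a measure"
  obtain M where M: "M \<ge> 0" "\<And>x. norm (v x) \<le> M" "v \<in> borel_measurable borel"
    by (rule bounded_borelE[OF bounded_borel_test[OF v]]) (rule that)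
  have m: "v \<in> borel_measurable (surface_measure \<Omega>)"
    unfolding surface_measure_def
    by (rule measurable_restrict_space1) (use M(3) in \<open>simp cong: measurable_cong_sets\<close>)
  have b: "frontier \<Omega> \<in> sets ?H" "frontier \<Omega> \<inter> B \<in> sets ?H" using B by (auto intro: borel_closed)
  have sp: "space ?H = UNIV" using sets_eq_imp_space_eq[OF sets_hausdorff_measure] by simp
  have "emeasure (surface_measure \<Omega>) (frontier \<Omega> \<inter> B) = emeasure ?H (frontier \<Omega> \<inter> B)"
    unfolding surface_measure_def using b sp by (intro emeasure_restrict_space) auto
  then have e: "emeasure (surface_measure \<Omega>) (frontier \<Omega> \<inter> B) < \<infinity>"
    using le_less_trans[OF emeasure_hausdorff_le fin] by simp
  have "integrable (surface_measure \<Omega>) (\<lambda>x. (norm (v x))\<^sup>2)"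
  proof (rule Bochner_Integration.integrable_bound[where f="\<lambda>x. M\<^sup>2 * indicator (frontier \<Omega> \<inter> B) x"])
    show "integrable (surface_measure \<Omega>) (\<lambda>x. M\<^sup>2 * indicator (frontier \<Omega> \<inter> B) x :: real)"
      using e b sp by (intro integrable_mult_right integrable_real_indicator)
        (auto simp: surface_measure_def sets_restrict_space)
    show "AE x in surface_measure \<Omega>. norm ((norm (v x))\<^sup>2) \<le> norm (M\<^sup>2 * indicator (frontier \<Omega> \<inter> B) x :: real)"
    proof (rule AE_I2)
      fix x assume "x \<in> space (surface_measure \<Omega>)"
      then have "x \<in> frontier \<Omega>" by (simp add: surface_measure_def space_restrict_space)
      then show "norm ((norm (v x))\<^sup>2) \<le> norm (M\<^sup>2 * indicator (frontier \<Omega> \<inter> B) x :: real)"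
        using M(1,2) test_functions_zero[OF v] by (cases "x \<in> B") (auto simp: power_mono)
    qed
  qed (use m in measurable)
  then show ?thesis using m by (simp add: L2_def)
qed

section \<open>Local epigraph coordinates at a boundary point\<close>

context
  fixes \<Omega> V :: "'a::euclidean_space set" and e :: 'a and L :: real and \<phi> :: "'a \<Rightarrow> real"
  assumes op: "open \<Omega>" "open V" and e1: "norm e = 1" and lip: "L-lipschitz_on {y. y \<bullet> e = 0} \<phi>"
    and epi: "\<And>y. y \<in> V \<Longrightarrow> y \<in> \<Omega> \<longleftrightarrow> \<phi> (y - (y \<bullet> e) *\<^sub>R e) < y \<bullet> e"
begin

lemma proj_hyperplane: "(y - (y \<bullet> e) *\<^sub>R e) \<bullet> e = 0"
  using e1 by (simp add: inner_diff_left power2_norm_eq_inner[symmetric])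

lemma proj_add: "(y + t *\<^sub>R e) - ((y + t *\<^sub>R e) \<bullet> e) *\<^sub>R e = y - (y \<bullet> e) *\<^sub>R e"
  using e1 by (simp add: inner_add_left power2_norm_eq_inner[symmetric] algebra_simps)

lemma inner_add_e: "(y + t *\<^sub>R e) \<bullet> e = y \<bullet> e + t"
  using e1 by (simp add: inner_add_left power2_norm_eq_inner[symmetric])

lemma proj_diff_le: "norm ((y - (y \<bullet> e) *\<^sub>R e) - (z - (z \<bullet> e) *\<^sub>R e)) \<le> norm (y - z)"
proof -
  let ?w = "y - z"
  have "(y - (y \<bullet> e) *\<^sub>R e) - (z - (z \<bullet> e) *\<^sub>R e) = ?w - (?w \<bullet> e) *\<^sub>R e"
    by (simp add: inner_diff_left algebra_simps)
  moreover have "(norm (?w - (?w \<bullet> e) *\<^sub>R e))\<^sup>2 = (norm ?w)\<^sup>2 - (?w \<bullet> e)\<^sup>2"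
    using e1 unfolding power2_norm_eq_inner
    by (simp add: inner_diff_left inner_diff_right inner_commute power2_eq_square norm_eq_1 algebra_simps)
  then have "(norm (?w - (?w \<bullet> e) *\<^sub>R e))\<^sup>2 \<le> (norm ?w)\<^sup>2" by simp
  then have "norm (?w - (?w \<bullet> e) *\<^sub>R e) \<le> norm ?w" by (rule power2_le_imp_le) simp
  ultimately show ?thesis by (simp only:)
qed

lemma lip_nonneg: "L \<ge> 0" using lip lipschitz_on_nonneg by blast

lemma graph_lip: "\<bar>\<phi> (y - (y \<bullet> e) *\<^sub>R e) - \<phi> (z - (z \<bullet> e) *\<^sub>R e)\<bar> \<le> L * norm (y - z)"
proof -
  have "\<bar>\<phi> (y - (y \<bullet> e) *\<^sub>R e) - \<phi> (z - (z \<bullet> e) *\<^sub>R e)\<bar> \<le> L * norm ((y - (y \<bullet> e) *\<^sub>R e) - (z - (z \<bullet> e) *\<^sub>R e))"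
    using lipschitz_onD[OF lip, of "y - (y \<bullet> e) *\<^sub>R e" "z - (z \<bullet> e) *\<^sub>R e"] proj_hyperplane by (simp add: dist_norm)
  also have "\<dots> \<le> L * norm (y - z)" by (rule mult_left_mono[OF proj_diff_le lip_nonneg])
  finally show ?thesis .
qed

lemma graph_continuous: "continuous_on S (\<lambda>y. \<phi> (y - (y \<bullet> e) *\<^sub>R e))"
  by (rule continuous_on_compose2[OF lipschitz_on_continuous_on[OF lip]])
     (use proj_hyperplane in \<open>auto intro!: continuous_intros\<close>)

lemma below_graph: "open {y \<in> V. \<phi> (y - (y \<bullet> e) *\<^sub>R e) > y \<bullet> e}" "y \<in> V \<Longrightarrow> \<phi> (y - (y \<bullet> e) *\<^sub>R e) > y \<bullet> e \<Longrightarrow> y \<notin> closure \<Omega>"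
proof -
  let ?W = "{y \<in> V. \<phi> (y - (y \<bullet> e) *\<^sub>R e) > y \<bullet> e}"
  have "open (V \<inter> (\<lambda>y. \<phi> (y - (y \<bullet> e) *\<^sub>R e) - y \<bullet> e) -` {0<..})"
    by (rule continuous_open_preimage[OF _ op(2)]) (auto intro!: continuous_intros graph_continuous)
  moreover have "V \<inter> (\<lambda>y. \<phi> (y - (y \<bullet> e) *\<^sub>R e) - y \<bullet> e) -` {0<..} = ?W" by auto
  ultimately show o: "open ?W" by simp
  have "?W \<inter> \<Omega> = {}" using epi by fastforce
  then have "?W \<inter> closure \<Omega> = {}" using open_Int_closure_eq_empty[OF o] by blast
  then show "y \<notin> closure \<Omega>" if "y \<in> V" "\<phi> (y - (y \<bullet> e) *\<^sub>R e) > y \<bullet> e" using that by blast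
qed

lemma frontier_height:
  assumes "y \<in> frontier \<Omega>" "y \<in> V"
  shows "\<phi> (y - (y \<bullet> e) *\<^sub>R e) = y \<bullet> e"
proof -
  have "y \<notin> \<Omega>" "y \<in> closure \<Omega>" using assms(1) op(1) by (auto simp: frontier_def interior_open)
  then show ?thesis using epi[OF assms(2)] below_graph(2)[OF assms(2)] by fastforce
qed

lemma frontier_hausdorff_finite:
  assumes "ball y0 \<rho> \<subseteq> V"
  shows "hausdorff_outer (DIM('a) - 1) (frontier \<Omega> \<inter> ball y0 \<rho>) < \<infinity>"
proof (rule hausdorff_outer_graph_finite[OF e1 lip])
  show "frontier \<Omega> \<inter> ball y0 \<rho> \<subseteq> (\<lambda>x. x + \<phi> x *\<^sub>R e) ` {x. x \<bullet> e = 0 \<and> norm x \<le> norm y0 + \<rho>}"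
  proof
    fix y assume y: "y \<in> frontier \<Omega> \<inter> ball y0 \<rho>"
    define x where "x = y - (y \<bullet> e) *\<^sub>R e"
    have "\<phi> x = y \<bullet> e" unfolding x_def using y assms by (intro frontier_height) auto
    then have "y = x + \<phi> x *\<^sub>R e" by (simp add: x_def)
    moreover have "x \<bullet> e = 0" unfolding x_def by (rule proj_hyperplane)
    moreover have "norm x \<le> norm y" using proj_diff_le[of y 0] by (simp add: x_def)
    then have "norm x \<le> norm y0 + \<rho>" using y norm_triangle_ineq2[of y y0] by (simp add: dist_norm norm_minus_commute)
    ultimately show "y \<in> (\<lambda>x. x + \<phi> x *\<^sub>R e) ` {x. x \<bullet> e = 0 \<and> norm x \<le> norm y0 + \<rho>}" by blast
  qed
qed

text \<open>A point of \<open>V\<close> outside \<open>\<Omega>\<close> lies on or below the graph,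
  and an arbitrarily small step along - e leads strictly below it, out of the closure.\<close>

lemma interior_closure_subset:
  assumes "z \<in> V" "z \<in> interior (closure \<Omega>)"
  shows "z \<in> \<Omega>"
proof (rule ccontr)
  assume "z \<notin> \<Omega>"
  then have le: "z \<bullet> e \<le> \<phi> (z - (z \<bullet> e) *\<^sub>R e)" using epi[OF assms(1)] by simp
  obtain t where t: "t > 0" "ball z t \<subseteq> V \<inter> interior (closure \<Omega>)"
    using open_contains_ball[of "V \<inter> interior (closure \<Omega>)"] op assms by blast
  let ?y = "z + (- (t/2)) *\<^sub>R e"
  have "?y \<in> ball z t" using t e1 by (simp add: dist_norm)
  then have "?y \<in> V" "?y \<in> closure \<Omega>" using t interior_subset by blast+
  moreover have "\<phi> (?y - (?y \<bullet> e) *\<^sub>R e) > ?y \<bullet> e"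
    by (subst proj_add, subst inner_add_e) (use le t(1) in simp)
  ultimately show False using below_graph(2) by blast
qed

text \<open>The intersection of \<open>\<Omega>\<close> with a ball may be disconnected, so a
  cylinder over the graph is taken instead: it is the image of a convex set under the shear
  \<open>m\<close>. Connectedness near the boundary point is what will force one affine formula for
  \<open>\<tau>\<close> there.\<close>

lemma connected_piece:
  assumes y0: "y0 \<in> frontier \<Omega>" and \<rho>: "\<rho> > 0" "ball y0 \<rho> \<subseteq> V"
  obtains Q \<delta> where "connected Q" "Q \<subseteq> \<Omega> \<inter> ball y0 \<rho>" "\<delta> > 0" "\<Omega> \<inter> ball y0 \<delta> \<subseteq> Q"
proof -
  let ?p = "\<lambda>y. y - (y \<bullet> e) *\<^sub>R e"
  \<comment> \<open>With (1 + L) \<delta> = \<rho>/2 both inclusions work: the cylinder stays within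
    \<delta> + \<rho>/2 + L \<delta> = \<rho> of \<open>y0\<close>, and points of the \<delta>-ball
    are less than (1 + L) \<delta> = \<rho>/2 above the graph.\<close>
  define \<delta> where "\<delta> = \<rho> / (2 * (1 + L))"
  have L0: "1 + L > 0" using lip_nonneg by simp
  have \<delta>: "\<delta> > 0" "(1 + L) * \<delta> = \<rho> / 2" using \<rho>(1) L0 by (auto simp: \<delta>_def field_simps)
  have y0V: "y0 \<in> V" using \<rho> by auto
  have h0: "\<phi> (?p y0) = y0 \<bullet> e" by (rule frontier_height[OF y0 y0V])
  define D where "D = ?p -` ball (?p y0) \<delta> \<inter> {z. e \<bullet> z > 0} \<inter> {z. e \<bullet> z < \<rho> / 2}"
  have "linear ?p"
    by (intro linearI) (auto simp: inner_add_left algebra_simps)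
  then have "convex D" unfolding D_def
    by (intro convex_Int convex_linear_vimage convex_ball convex_halfspace_gt convex_halfspace_lt)
  define m where "m z = z + \<phi> (?p z) *\<^sub>R e" for z
  have "connected (m ` D)"
    unfolding m_def
    by (intro connected_continuous_image convex_connected \<open>convex D\<close>) (auto intro!: continuous_intros graph_continuous)
  moreover have "m ` D \<subseteq> \<Omega> \<inter> ball y0 \<rho>"
  proof
    fix y assume "y \<in> m ` D"
    then obtain z where z: "y = m z" "norm (?p z - ?p y0) < \<delta>" "0 < z \<bullet> e" "z \<bullet> e < \<rho> / 2"
      by (auto simp: D_def dist_norm norm_minus_commute inner_commute)
    have py: "?p y = ?p z" and ye: "y \<bullet> e = z \<bullet> e + \<phi> (?p z)"
      unfolding z(1) m_def by (rule proj_add, rule inner_add_e)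
    have "\<bar>\<phi> (?p z) - \<phi> (?p y0)\<bar> \<le> L * norm (?p z - ?p y0)"
      using lipschitz_onD[OF lip, of "?p z" "?p y0"] proj_hyperplane by (simp add: dist_norm)
    also have "\<dots> \<le> L * \<delta>" using z(2) lip_nonneg by (intro mult_left_mono) auto
    finally have "\<bar>(y - y0) \<bullet> e\<bar> < \<rho> / 2 + L * \<delta>" using ye z h0 by (simp add: inner_diff_left)
    moreover have "norm (y - y0) \<le> norm (?p y - ?p y0) + \<bar>(y - y0) \<bullet> e\<bar>"
    proof -
      define r where "r = (y - y0) \<bullet> e"
      have eq: "y - y0 = (?p y - ?p y0) + r *\<^sub>R e" by (simp add: r_def inner_diff_left algebra_simps)
      have "norm ((?p y - ?p y0) + r *\<^sub>R e) \<le> norm (?p y - ?p y0) + \<bar>r\<bar>"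
        using norm_triangle_ineq[of "?p y - ?p y0" "r *\<^sub>R e"] e1 by simp
      then show ?thesis unfolding r_def[symmetric] eq[symmetric] .
    qed
    ultimately have "norm (y - y0) < \<delta> + (\<rho> / 2 + L * \<delta>)" using z(2) py by simp
    also have "\<dots> = \<rho>" using \<delta>(2) by (simp add: algebra_simps)
    finally have yb: "y \<in> ball y0 \<rho>" by (simp add: dist_norm norm_minus_commute)
    moreover have "y \<in> \<Omega>" using epi[of y] yb \<rho>(2) py ye z(3) by auto
    ultimately show "y \<in> \<Omega> \<inter> ball y0 \<rho>" by blast
  qed
  moreover have "\<Omega> \<inter> ball y0 \<delta> \<subseteq> m ` D"
  proof
    fix y assume y: "y \<in> \<Omega> \<inter> ball y0 \<delta>"
    have "1 * \<delta> \<le> (1 + L) * \<delta>" using lip_nonneg \<delta>(1) by (intro mult_right_mono) auto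
    then have "\<delta> \<le> \<rho>" using \<delta> \<rho> by simp
    then have yV: "y \<in> V" using y \<rho>(2) by auto
    define z where "z = y + (- \<phi> (?p y)) *\<^sub>R e"
    have pz: "?p z = ?p y" and ze: "z \<bullet> e = y \<bullet> e - \<phi> (?p y)"
      unfolding z_def by (rule proj_add, subst inner_add_e) simp
    have ny: "norm (y - y0) < \<delta>" using y by (simp add: dist_norm norm_minus_commute)
    have "y = m z" unfolding m_def pz by (simp add: z_def)
    moreover have "norm (?p z - ?p y0) < \<delta>" unfolding pz using proj_diff_le[of y y0] ny by simp
    moreover have "z \<bullet> e > 0" using epi[OF yV] y ze by auto
    moreover have "z \<bullet> e < \<rho> / 2"
    proof -
      have "z \<bullet> e = (y - y0) \<bullet> e + (\<phi> (?p y0) - \<phi> (?p y))" using ze h0 by (simp add: inner_diff_left)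
      also have "\<dots> \<le> norm (y - y0) + L * norm (y - y0)"
        using Cauchy_Schwarz_ineq2[of "y - y0" e] e1 graph_lip[of y y0] by simp
      also have "\<dots> = (1 + L) * norm (y - y0)" by (simp add: algebra_simps)
      also have "\<dots> < (1 + L) * \<delta>" using ny L0 by (rule mult_strict_left_mono)
      finally show ?thesis using \<delta>(2) by simp
    qed
    ultimately show "y \<in> m ` D" by (auto simp: D_def dist_norm norm_minus_commute inner_commute)
  qed
  ultimately show ?thesis using that \<delta>(1) by blast
qed

text \<open>
  Vanishing flux would make the mass that \<open>\<Omega>\<close> gives to a bump constant under small translations
  along \<open>e\<close>, but moving down strictly increases it.
\<close>

lemma flux_nonzero:
  assumes bd: "bounded \<Omega>" and y0: "y0 \<in> frontier \<Omega>" and \<rho>: "\<rho> > 0" "ball y0 \<rho> \<subseteq> V"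
    and flux: "\<And>q. (\<lambda>x. complex_of_real (q x)) \<in> test_functions (ball y0 \<rho>) \<Longrightarrow>
       (LINT x|lebesgue_on \<Omega>. pderiv_dir e (\<lambda>x. complex_of_real (q x)) x) = 0"
  shows False
proof -
  \<comment> \<open>A bump of radius s whose centre moves by less than 2 s keeps its support within
    3 s of \<open>y0\<close>, inside the ball of radius 4 s.\<close>
  define s where "s = \<rho> / 4"
  have s: "s > 0" "2 * s < \<rho>" using \<rho> by (auto simp: s_def)
  define Q where "Q y x = complex_of_real (bump ((norm (x - y))\<^sup>2 / s\<^sup>2))" for y x :: 'a
  have sQ: "smooth (Q y)" for y
    unfolding Q_def[abs_def] using profile_bump by (intro smooth_radial) (simp add: profile_def)
  have Q0: "Q y x = 0" if "norm (x - y) \<ge> s" for x y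
  proof -
    have "s\<^sup>2 \<le> (norm (x - y))\<^sup>2" using that s by (intro power_mono) auto
    then show ?thesis using s profile_zero[OF profile_bump] by (simp add: Q_def)
  qed
  have tQ: "Q y \<in> test_functions (ball y0 \<rho>)" if "dist y0 y < \<rho> - s" for y
    unfolding Q_def[abs_def]
  proof (rule radial_test)
    show "cball y s \<subseteq> ball y0 \<rho>"
    proof
      fix x assume "x \<in> cball y s"
      then show "x \<in> ball y0 \<rho>" using that dist_triangle[of y0 x y] by simp
    qed
  qed (use profile_bump s in \<open>auto simp: profile_def\<close>)
  have tU: "Q y \<in> test_functions UNIV" for y
    unfolding Q_def[abs_def] using profile_bump s by (intro radial_test) (auto simp: profile_def)
  have shift: "Q y (x + t *\<^sub>R e) = Q (y - t *\<^sub>R e) x" for y x t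
    by (simp add: Q_def algebra_simps)
  have dQ: "((\<lambda>t. Q (y0 - t *\<^sub>R e) x) has_derivative (\<lambda>h. of_real h * pderiv_dir e (Q (y0 - t *\<^sub>R e)) x)) (at t)" for x t
  proof -
    have "((\<lambda>r. Q (y0 - t *\<^sub>R e) (x + (r - t) *\<^sub>R e)) has_derivative (\<lambda>h. pderiv_dir (h *\<^sub>R e) (Q (y0 - t *\<^sub>R e)) (x + (t - t) *\<^sub>R e))) (at t)"
      by (rule has_derivative_compose[OF _ smooth_has_derivative[OF sQ]]) (auto intro!: derivative_eq_intros)
    moreover have "Q (y0 - t *\<^sub>R e) (x + (r - t) *\<^sub>R e) = Q (y0 - r *\<^sub>R e) x" for r
      unfolding shift by (simp add: algebra_simps)
    moreover have "pderiv_dir (h *\<^sub>R e) (Q (y0 - t *\<^sub>R e)) x = of_real h * pderiv_dir e (Q (y0 - t *\<^sub>R e)) x" for h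
      using linear_scale[OF has_derivative_linear[OF smooth_has_derivative[OF sQ]]] by (simp add: scaleR_conv_of_real)
    ultimately show ?thesis by simp
  qed
  have pe: "pderiv_dir e (Q y) = (\<lambda>x. \<Sum>b\<in>Basis. of_real (e \<bullet> b) * pderiv_dir b (Q y) x)" for y
    by (rule ext, rule pderiv_dir_sum_Basis[OF sQ])
  have "smooth (pderiv_dir e (Q y0))"
    unfolding pe by (intro smooth_sum smooth_mult smooth_const smooth_pderiv_dir sQ) auto
  moreover have pz: "pderiv_dir e (Q y) x = 0" if "norm (x - y) > s" for x y
  proof (rule pderiv_dir_zero_outside[of "cball y s"])
    show "Q y x = 0" if "x \<notin> cball y s" for x using that Q0[of x y] by (simp add: dist_norm norm_minus_commute)
  qed (use that in \<open>auto simp: dist_norm norm_minus_commute\<close>)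
  ultimately have "pderiv_dir e (Q y0) \<in> test_functions UNIV"
    by (intro test_functionsI[of _ "cball y0 s"]) (auto simp: dist_norm norm_minus_commute)
  then obtain M where M: "M \<ge> 0" "\<And>x. norm (pderiv_dir e (Q y0) x) \<le> M"
    using bounded_borel_test bounded_borelE by metis
  have ps: "pderiv_dir e (Q (y0 - t *\<^sub>R e)) x = pderiv_dir e (Q y0) (x + t *\<^sub>R e)" for t x
  proof -
    have "((\<lambda>x. Q y0 (x + t *\<^sub>R e)) has_derivative (\<lambda>k. pderiv_dir k (Q y0) (x + t *\<^sub>R e))) (at x)"
      by (rule has_derivative_compose[OF _ smooth_has_derivative[OF sQ]]) (auto intro!: derivative_eq_intros)
    then show ?thesis unfolding shift by (rule pderiv_dir_eq)
  qed
  have mb: "f \<in> borel_measurable (lebesgue_on \<Omega>)" if "smooth f" for f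
    using smooth_borel[OF that] by (intro measurable_restrict_space1 measurable_completion) simp
  have intQ: "integrable (lebesgue_on \<Omega>) (Q y)" for y
    by (rule L2_imp_integrable[OF bd op(1) L2_bounded_lebesgue_on[OF bd op(1) bounded_borel_test[OF tU]]])
  \<comment> \<open>The mass that \<open>\<Omega>\<close> gives to the bump centred at
    \<open>y0 - t *\<^sub>R e\<close>; its derivative in t is the integral that \<open>flux\<close>
    makes zero.\<close>
  define J where "J t = (LINT x|lebesgue_on \<Omega>. Q (y0 - t *\<^sub>R e) x)" for t
  have dJ: "(J has_derivative (\<lambda>_. 0)) (at t)" if t: "\<bar>t\<bar> < 2 * s" for t
  proof -
    have "(J has_derivative (\<lambda>h. LINT x|lebesgue_on \<Omega>. of_real h * pderiv_dir e (Q (y0 - t *\<^sub>R e)) x)) (at t)"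
      unfolding J_def
    proof (rule has_derivative_integral_dominated[where \<delta>=1 and g="\<lambda>_. M"])
      show "norm (of_real h * pderiv_dir e (Q (y0 - r *\<^sub>R e)) x) \<le> M * norm h" for r x and h :: real
        unfolding ps using mult_left_mono[OF M(2), of "\<bar>h\<bar>"] by (simp add: norm_mult mult.commute)
      show "(\<lambda>x. of_real h * pderiv_dir e (Q (y0 - t *\<^sub>R e)) x) \<in> borel_measurable (lebesgue_on \<Omega>)" for h
        unfolding pe by (intro mb smooth_sum smooth_mult smooth_const smooth_pderiv_dir sQ) auto
    qed (use intQ dQ integrable_const_lebesgue_on[OF bd op(1)] in auto)
    moreover have "dist y0 (y0 - t *\<^sub>R e) < \<rho> - s" using t e1 s by (simp add: dist_norm s_def)
    then have "(LINT x|lebesgue_on \<Omega>. pderiv_dir e (Q (y0 - t *\<^sub>R e)) x) = 0"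
      using flux[OF tQ[unfolded Q_def[abs_def]]] unfolding Q_def[abs_def] by blast
    ultimately show ?thesis by simp
  qed
  have J: "J s = J 0"
  proof (rule has_derivative_zero_unique[of "{- (2 * s)<..<2 * s}"])
    show "(J has_derivative (\<lambda>_. 0)) (at t within {- (2 * s)<..<2 * s})" if "t \<in> {- (2 * s)<..<2 * s}" for t
      using dJ[of t] that by (auto intro: has_derivative_at_withinI)
  qed (use s in auto)
  define f where "f x = bump ((norm (x - y0))\<^sup>2 / s\<^sup>2)" for x
  have fc: "continuous_on S f" for S unfolding f_def using s by (intro continuous_on_bump continuous_intros) auto
  have Qf: "Q y0 x = of_real (f x)" for x by (simp add: Q_def f_def)
  have fint: "integrable lborel f"
    using integrable_Re[OF integrable_test[OF tU[of y0]]] by (simp add: Qf)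
  have \<Omega>b: "\<Omega> \<in> sets borel" using op(1) by simp
  have ind: "(LINT x|lebesgue_on \<Omega>. Q y x) = (\<integral>x. indicator \<Omega> x *\<^sub>R Q y x \<partial>lborel)" for y
  proof -
    have "(LINT x|lebesgue_on \<Omega>. Q y x) = (LINT x|lebesgue_on \<Omega>. indicator \<Omega> x *\<^sub>R Q y x)"
      by (intro Bochner_Integration.integral_cong) auto
    also have "\<dots> = (\<integral>x. indicator \<Omega> x *\<^sub>R Q y x \<partial>lborel)"
      by (rule integral_lebesgue_on_supported) (use \<Omega>b smooth_borel[OF sQ, of y] in auto)
    finally show ?thesis .
  qed
  have J0: "J 0 = (\<integral>x. of_real (indicator \<Omega> x * f x) \<partial>lborel)"
    unfolding J_def ind by (simp add: Qf scaleR_conv_of_real)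
  \<comment> \<open>Translating the variable fixes the bump at \<open>y0\<close> and moves the
    domain by \<open>s *\<^sub>R e\<close> instead, so that \<open>J 0\<close> and
    \<open>J s\<close> are compared under one weight \<open>f\<close>.\<close>
  have "J s = (\<integral>x. indicator \<Omega> ((x + s *\<^sub>R e) - s *\<^sub>R e) *\<^sub>R Q y0 (x + s *\<^sub>R e) \<partial>lborel)"
    unfolding J_def ind shift by simp
  also have "\<dots> = (\<integral>x. indicator \<Omega> (x - s *\<^sub>R e) *\<^sub>R Q y0 x \<partial>lborel)"
    by (rule lborel_integral_translate[of "\<lambda>x. indicator \<Omega> (x - s *\<^sub>R e) *\<^sub>R Q y0 x" "s *\<^sub>R e"])
       (use \<Omega>b smooth_borel[OF sQ, of y0] in measurable)
  finally have Js: "J s = (\<integral>x. of_real (indicator \<Omega> (x - s *\<^sub>R e) * f x) \<partial>lborel)"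
    by (simp add: Qf scaleR_conv_of_real)
  have i1: "integrable lborel (\<lambda>x. indicator \<Omega> x * f x)"
    by (rule Bochner_Integration.integrable_bound[OF fint]) (use fint \<Omega>b in \<open>auto simp: indicator_def\<close>)
  have i2: "integrable lborel (\<lambda>x. indicator \<Omega> (x - s *\<^sub>R e) * f x)"
    by (rule Bochner_Integration.integrable_bound[OF fint]) (use fint \<Omega>b in \<open>auto simp: indicator_def\<close>)
  define g where "g x = indicator \<Omega> x * f x - indicator \<Omega> (x - s *\<^sub>R e) * f x" for x
  have gint: "integrable lborel g" unfolding g_def[abs_def] using i1 i2 by simp
  have "complex_of_real (\<integral>x. g x \<partial>lborel) = J 0 - J s"
    unfolding J0 Js g_def integral_complex_of_real using i1 i2 by simp
  then have g0: "(\<integral>x. g x \<partial>lborel) = 0" using J by simp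
  have fpos: "f x \<ge> 0" for x by (simp add: f_def bump_nonneg)
  have inV: "x \<in> V" "x - s *\<^sub>R e \<in> V" if "norm (x - y0) < s" for x
  proof -
    have "norm (x - s *\<^sub>R e - y0) \<le> norm (x - y0) + s"
      using norm_triangle_ineq4[of "x - y0" "s *\<^sub>R e"] e1 s by (simp add: algebra_simps)
    then have "x \<in> ball y0 \<rho>" "x - s *\<^sub>R e \<in> ball y0 \<rho>"
      using that s by (auto simp: dist_norm norm_minus_commute)
    then show "x \<in> V" "x - s *\<^sub>R e \<in> V" using \<rho>(2) by auto
  qed
  have down: "x - s *\<^sub>R e \<in> \<Omega> \<longleftrightarrow> \<phi> (x - (x \<bullet> e) *\<^sub>R e) < x \<bullet> e - s" if "norm (x - y0) < s" for x
  proof -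
    have 1: "(x - s *\<^sub>R e) \<bullet> e = x \<bullet> e - s" using inner_add_e[of x "- s"] by simp
    have 2: "(x - s *\<^sub>R e) - ((x - s *\<^sub>R e) \<bullet> e) *\<^sub>R e = x - (x \<bullet> e) *\<^sub>R e"
      using proj_add[of x "- s"] by (simp only: scaleR_minus_left add_uminus_conv_diff)
    show ?thesis using epi[OF inV(2)[OF that]] unfolding 2 unfolding 1 .
  qed
  \<comment> \<open>Inside \<open>V\<close> the domain is an epigraph, so
    \<open>x - s *\<^sub>R e \<in> \<Omega>\<close> implies \<open>x \<in> \<Omega>\<close>.\<close>
  have gn: "g x \<ge> 0" for x
  proof (cases "norm (x - y0) < s")
    case True
    then have "x - s *\<^sub>R e \<in> \<Omega> \<Longrightarrow> x \<in> \<Omega>" using down[OF True] epi[OF inV(1)[OF True]] s by auto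
    then show ?thesis using fpos[of x] by (auto simp: g_def indicator_def)
  next
    case False
    then have "f x = 0" using Q0[of x y0] Qf[of x] by simp
    then show ?thesis by (simp add: g_def)
  qed
  \<comment> \<open>The layer of thickness s over the graph: its points lie in
    \<open>\<Omega>\<close>, but leave it when lowered by s, so \<open>g = f\<close> there. It
    contains \<open>y0 + (s/2) *\<^sub>R e\<close>, where \<open>f\<close> is positive.\<close>
  define W where "W = ball y0 s \<inter> {x. \<phi> (x - (x \<bullet> e) *\<^sub>R e) < x \<bullet> e} \<inter> {x. x \<bullet> e < \<phi> (x - (x \<bullet> e) *\<^sub>R e) + s}"
  have "open W" unfolding W_def
    by (intro open_Int open_ball open_Collect_less continuous_intros graph_continuous)
  have gW: "g x = f x" if "x \<in> W" for x
  proof -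
    have n: "norm (x - y0) < s" using that by (simp add: W_def dist_norm norm_minus_commute)
    have "x \<in> \<Omega>" "x - s *\<^sub>R e \<notin> \<Omega>" using epi[OF inV(1)[OF n]] down[OF n] that by (auto simp: W_def)
    then show ?thesis by (simp add: g_def)
  qed
  have y0V: "y0 \<in> V" using \<rho> by auto
  let ?x = "y0 + (s/2) *\<^sub>R e"
  have 1: "?x \<bullet> e = y0 \<bullet> e + s / 2" by (rule inner_add_e)
  have 2: "?x - (?x \<bullet> e) *\<^sub>R e = y0 - (y0 \<bullet> e) *\<^sub>R e" by (rule proj_add)
  have xW: "?x \<in> W"
    unfolding W_def Int_iff mem_Collect_eq unfolding 2 unfolding 1
    using s e1 frontier_height[OF y0 y0V] by (simp add: dist_norm)
  have "g ?x = 0"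
    by (rule nonneg_integral_zero_continuous[OF gint gn g0 \<open>open W\<close> _ xW])
       (use gW fc in \<open>simp cong: continuous_on_cong\<close>)
  moreover have "f ?x > 0" unfolding f_def using s e1 by (intro bump_pos) (simp add: power2_eq_square)
  ultimately show False using gW[OF xW] by simp
qed

text \<open>Write l for the function \<open>y \<bullet> e + k\<close>. Testing the constant c with q
  l and the linear function c l with q gives the same boundary integral of - \<beta> c l q. The
  first identity says that it is zero, since a constant has no gradient; the second says that it
  equals the integral of c times the derivative of q along e. This contradicts
  \<open>flux_nonzero\<close>.\<close>

lemma robin_not_affine:
  assumes bd: "bounded \<Omega>" and y0: "y0 \<in> frontier \<Omega>" and \<rho>: "\<rho> > 0" "ball y0 \<rho> \<subseteq> V" and c: "c \<noteq> 0"
    and u0: "has_normal_derivative \<Omega> u0 (\<lambda>z. - complex_of_real (\<beta> z) * u0 z)"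
    and u1: "has_normal_derivative \<Omega> u1 (\<lambda>z. - complex_of_real (\<beta> z) * u1 z)"
    and aff0: "\<And>y. y \<in> closure \<Omega> \<inter> ball y0 \<rho> \<Longrightarrow> u0 y = c"
    and aff1: "\<And>y. y \<in> closure \<Omega> \<inter> ball y0 \<rho> \<Longrightarrow> u1 y = c * complex_of_real (y \<bullet> e + k)"
  shows False
proof (rule flux_nonzero[OF bd y0 \<rho>])
  fix q assume q: "(\<lambda>x. complex_of_real (q x)) \<in> test_functions (ball y0 \<rho>)"
  have tr: "L2 (surface_measure \<Omega>) v" if "v \<in> test_functions (ball y0 \<rho>)" for v
    by (rule L2_surface_test[OF frontier_hausdorff_finite[OF \<rho>(2)] open_ball that])
  have sub: "\<Omega> \<subseteq> closure \<Omega>" by (rule closure_subset)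
  define q' where "q' x = q x * (x \<bullet> e + k)" for x
  have q': "(\<lambda>x. complex_of_real (q' x)) \<in> test_functions (ball y0 \<rho>)"
  proof -
    have "smooth (\<lambda>x. complex_of_real (x \<bullet> e) + complex_of_real k)" by (intro smooth_add smooth_inner smooth_const)
    from test_functions_mult(1)[OF q this] show ?thesis by (simp add: q'_def)
  qed
  \<comment> \<open>The constant is treated as an affine function with slope a = 0 and k = 1, so the
    left side is a derivative in the direction 0.\<close>
  have "(LINT x|lebesgue_on \<Omega>. c * pderiv_dir 0 (\<lambda>x. complex_of_real (q' x)) x) = (LINT z|surface_measure \<Omega>. - complex_of_real (\<beta> z) * u0 z * of_real (q' z))"
    by (rule normal_derivative_affine[where a=0 and k=1 and B="ball y0 \<rho>", OF bd op(1) u0 _ q' tr[OF q']])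
       (use aff0 sub in auto)
  moreover have "pderiv_dir 0 (\<lambda>x. complex_of_real (q' x)) x = 0" for x
    using linear_0[OF has_derivative_linear[OF smooth_has_derivative[OF test_functions_smooth[OF q']]]] .
  moreover have "(LINT z|surface_measure \<Omega>. - complex_of_real (\<beta> z) * u0 z * of_real (q' z)) =
     (LINT z|surface_measure \<Omega>. - complex_of_real (\<beta> z) * u1 z * of_real (q z))"
  proof (rule Bochner_Integration.integral_cong[OF refl])
    fix z assume "z \<in> space (surface_measure \<Omega>)"
    then have z: "z \<in> closure \<Omega>" by (simp add: surface_measure_def space_restrict_space frontier_def)
    show "- complex_of_real (\<beta> z) * u0 z * of_real (q' z) = - complex_of_real (\<beta> z) * u1 z * of_real (q z)"
    proof (cases "z \<in> ball y0 \<rho>")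
      case True
      then show ?thesis using aff0[of z] aff1[of z] z by (simp add: q'_def)
    next
      case False
      then have "q z = 0" using test_functions_zero[OF q] by simp
      then show ?thesis by (simp add: q'_def)
    qed
  qed
  moreover have "(LINT x|lebesgue_on \<Omega>. c * pderiv_dir e (\<lambda>x. complex_of_real (q x)) x) = (LINT z|surface_measure \<Omega>. - complex_of_real (\<beta> z) * u1 z * of_real (q z))"
    by (rule normal_derivative_affine[where a=e and k=k and B="ball y0 \<rho>", OF bd op(1) u1 _ q tr[OF q]])
       (use aff1 sub in auto)
  ultimately show "(LINT x|lebesgue_on \<Omega>. pderiv_dir e (\<lambda>x. complex_of_real (q x)) x) = 0"
    using c by simp
qed

end

subsection \<open>The structure of the operator\<close>

text \<open>This merges the case d = 1 into the general one: near an endpoint an interval is the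
  epigraph of a constant function on the trivial hyperplane, with e pointing inwards.\<close>

lemma box_lipschitz_boundary:
  assumes d: "DIM('a::euclidean_space) = 1" and ne: "box a b \<noteq> {}"
  shows "lipschitz_boundary (box a (b::'a))"
  unfolding lipschitz_boundary_def
proof
  fix z assume z: "z \<in> frontier (box a b)"
  obtain i :: 'a where B: "Basis = {i}" using d by (auto simp: card_1_singleton_iff)
  have i: "norm i = 1" using B by (metis insertI1 norm_Basis)
  have box: "y \<in> box a b \<longleftrightarrow> a \<bullet> i < y \<bullet> i \<and> y \<bullet> i < b \<bullet> i" for y by (simp add: mem_box B)
  have lt: "a \<bullet> i < b \<bullet> i" using ne box by (metis all_not_in_conv less_trans)
  have "z \<in> cbox a b" "z \<notin> box a b" using z ne by (auto simp: frontier_box)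
  then have "z \<bullet> i = a \<bullet> i \<or> z \<bullet> i = b \<bullet> i" by (auto simp: mem_box B)
  then show "\<exists>V e L \<phi>. open V \<and> z \<in> V \<and> norm e = 1 \<and> L-lipschitz_on {y. y \<bullet> e = 0} (\<phi> :: 'a \<Rightarrow> real) \<and>
      (\<forall>y\<in>V. y \<in> box a b \<longleftrightarrow> \<phi> (y - (y \<bullet> e) *\<^sub>R e) < y \<bullet> e)"
  proof
    assume "z \<bullet> i = a \<bullet> i"
    then show ?thesis
      by (intro exI[of _ "{y. y \<bullet> i < b \<bullet> i}"] exI[of _ i] exI[of _ 0] exI[of _ "\<lambda>_. a \<bullet> i"])
         (use lt i box in \<open>auto intro!: open_Collect_less continuous_intros simp: lipschitz_on_def\<close>)
  next
    assume "z \<bullet> i = b \<bullet> i"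
    then show ?thesis
      by (intro exI[of _ "{y. a \<bullet> i < y \<bullet> i}"] exI[of _ "- i"] exI[of _ 0] exI[of _ "\<lambda>_. - (b \<bullet> i)"])
         (use lt i box in \<open>auto intro!: open_Collect_less continuous_intros simp: lipschitz_on_def\<close>)
  qed
qed

lemma lipschitz_domainD:
  assumes "lipschitz_domain (\<Omega> :: 'a::euclidean_space set)"
  shows "\<Omega> \<noteq> {}" "open \<Omega>" "bounded \<Omega>" "connected \<Omega>" "lipschitz_boundary \<Omega>"
proof -
  show 1: "\<Omega> \<noteq> {}" "open \<Omega>" "bounded \<Omega>" using assms unfolding lipschitz_domain_def by auto
  show "connected \<Omega>" "lipschitz_boundary \<Omega>"
    using assms 1(1) box_lipschitz_boundary convex_connected[OF convex_box(2)]
    unfolding lipschitz_domain_def by (auto split: if_splits)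
qed

text \<open>Slits are excluded: below a boundary point there are always points outside the
  closure.\<close>

lemma lipschitz_boundary_interior_closure:
  assumes "open \<Omega>" "lipschitz_boundary \<Omega>"
  shows "interior (closure \<Omega>) \<subseteq> \<Omega>"
proof
  fix z assume z: "z \<in> interior (closure \<Omega>)"
  show "z \<in> \<Omega>"
  proof (rule ccontr)
    assume "z \<notin> \<Omega>"
    then have "z \<in> frontier \<Omega>" using z interior_subset assms(1) by (auto simp: frontier_def interior_open)
    then obtain V e L \<phi> where "open V" "z \<in> V" "norm e = 1" "L-lipschitz_on {y. y \<bullet> e = 0} (\<phi> :: 'a \<Rightarrow> real)"
      "\<And>y. y \<in> V \<Longrightarrow> y \<in> \<Omega> \<longleftrightarrow> \<phi> (y - (y \<bullet> e) *\<^sub>R e) < y \<bullet> e"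
      using assms(2) unfolding lipschitz_boundary_def by metis
    then show False using interior_closure_subset[OF assms(1), of V e L \<phi> z] z \<open>z \<notin> \<Omega>\<close> by blast
  qed
qed

text \<open>For fixed y in \<open>closure \<Omega>2\<close> the map \<open>f \<mapsto> U f y\<close>
  is a disjointness preserving functional; its support point is \<open>\<tau> y\<close>, and its
  value on the constant 1 is the weight. Where the weight is zero the point is arbitrary, so
  \<open>\<tau>\<close> carries information only off the zeros of the weight.\<close>

lemma weighted_composition:
  fixes U :: "('a::euclidean_space \<Rightarrow> complex) \<Rightarrow> ('a \<Rightarrow> complex)"
  assumes \<Omega>1: "bounded \<Omega>1" "\<Omega>1 \<noteq> {}" and \<Omega>2: "bounded \<Omega>2"
    and U: "bounded_linear_C \<Omega>1 \<Omega>2 U"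
    and a: "\<forall>f\<in>C_closure \<Omega>1. \<forall>g\<in>C_closure \<Omega>1.
      (\<forall>x\<in>closure \<Omega>1. f x * g x = 0) \<longrightarrow> (\<forall>y\<in>closure \<Omega>2. U f y * U g y = 0)"
  obtains \<tau> where "\<And>y. \<tau> y \<in> closure \<Omega>1"
    "\<And>f y. f \<in> C_closure \<Omega>1 \<Longrightarrow> U f y = U (zero_ext \<Omega>1 (\<lambda>_. 1)) y * f (\<tau> y)"
proof -
  have UC: "\<And>f. f \<in> C_closure \<Omega>1 \<Longrightarrow> U f \<in> C_closure \<Omega>2" using U unfolding bounded_linear_C_def by blast
  obtain K where K: "\<And>f. f \<in> C_closure \<Omega>1 \<Longrightarrow> sup_norm \<Omega>2 (U f) \<le> K * sup_norm \<Omega>1 f"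
    using U unfolding bounded_linear_C_def by blast
  have one: "zero_ext \<Omega>1 (\<lambda>_. 1) \<in> C_closure \<Omega>1" by (intro zero_ext_C_closure continuous_intros)
  have "\<exists>x\<in>closure \<Omega>1. \<forall>f\<in>C_closure \<Omega>1. U f y = U (zero_ext \<Omega>1 (\<lambda>_. 1)) y * f x" for y
  proof (cases "y \<in> closure \<Omega>2")
    case True
    obtain x where "x \<in> closure \<Omega>1" "\<And>f. f \<in> C_closure \<Omega>1 \<Longrightarrow> U f y = U (zero_ext \<Omega>1 (\<lambda>_. 1)) y * f x"
    proof (rule disjointness_preserving_functional[OF \<Omega>1, of "\<lambda>f. U f y" K])
      show "norm (U f y) \<le> K * sup_norm \<Omega>1 f" if "f \<in> C_closure \<Omega>1" for f
        using norm_le_sup_norm[OF \<Omega>2 UC[OF that] True] K[OF that] by linarith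
      show "U f y * U g y = 0" if "f \<in> C_closure \<Omega>1" "g \<in> C_closure \<Omega>1" "\<And>x. x \<in> closure \<Omega>1 \<Longrightarrow> f x * g x = 0" for f g
        using a that True by blast
    qed (use U in \<open>auto simp: bounded_linear_C_def\<close>)
    then show ?thesis by blast
  next
    case False
    \<comment> \<open>Off \<open>closure \<Omega>2\<close> every \<open>U f y\<close> is zero, so
      any point serves; this makes \<open>\<tau>\<close> total with values in
      \<open>closure \<Omega>1\<close>.\<close>
    obtain x where "x \<in> closure \<Omega>1" using \<Omega>1(2) closure_subset by blast
    then show ?thesis using False C_closure_zero[OF UC] one by (intro bexI[of _ x]) auto
  qed
  then show ?thesis using that by metis
qed

text \<open>By Vitali's theorem an open set is, up to a null set, a countable disjoint union of
  balls. Balls go to balls of the same radius, and the null set goes to a null set because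
  \<open>T\<close> is Lipschitz.\<close>

lemma emeasure_orthogonal_image_le:
  fixes T :: "'a::euclidean_space \<Rightarrow> 'a"
  assumes T: "orthogonal_transformation T" and C: "open C"
  shows "emeasure lebesgue (T ` C) \<le> emeasure lebesgue C"
proof -
  define K where "K = {i :: 'a \<times> real. ball (fst i) (snd i) \<subseteq> C}"
  have cov: "\<exists>i. i \<in> K \<and> x \<in> ball (fst i) (snd i) \<and> snd i < d" if "x \<in> C" "0 < d" for x d
  proof -
    obtain r where "r > 0" "ball x r \<subseteq> C" using C \<open>x \<in> C\<close> open_contains_ball by blast
    then show ?thesis using \<open>0 < d\<close> by (intro exI[of _ "(x, min r (d/2))"]) (auto simp: K_def)
  qed
  obtain D where D: "countable D" "D \<subseteq> K" "pairwise (\<lambda>i j. disjnt (ball (fst i) (snd i)) (ball (fst j) (snd j))) D"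
    "negligible (C - (\<Union>i\<in>D. ball (fst i) (snd i)))"
    by (rule Vitali_covering_theorem_balls[of C K fst snd, OF cov]) (assumption | rule that)+
  define N where "N = C - (\<Union>i\<in>D. ball (fst i) (snd i))"
  have iso: "norm (T x - T y) = norm (x - y)" for x y
    using orthogonal_transformation_norm[OF T, of "x - y"] linear_diff[OF orthogonal_transformation_linear[OF T], of x y] by simp
  have Tball: "T ` ball x r = ball (T x) r" for x r by (rule image_orthogonal_transformation_ball[OF T])
  have negN: "negligible (T ` N)"
  proof (rule negligible_locally_Lipschitz_image)
    show "negligible N" using D(4) by (simp add: N_def)
    show "\<exists>V B. open V \<and> x \<in> V \<and> (\<forall>y\<in>N \<inter> V. norm (T y - T x) \<le> B * norm (y - x))" for x
      by (intro exI[of _ UNIV] exI[of _ 1]) (simp add: iso)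
  qed simp
  have inj: "inj T" by (rule orthogonal_transformation_inj[OF T])
  have disj: "disjoint_family_on (\<lambda>i. ball (fst i) (snd i)) D"
    using D(3) by (auto simp: disjoint_family_on_def pairwise_def disjnt_def)
  then have disjT: "disjoint_family_on (\<lambda>i. T ` ball (fst i) (snd i)) D"
    using inj by (auto simp: disjoint_family_on_def image_Int[symmetric])
  have ball_eq: "emeasure lebesgue (T ` ball x r) = emeasure lebesgue (ball x r)" for x r
    unfolding Tball by (cases "r \<le> 0") (auto simp: emeasure_ball ball_empty)
  have "C \<subseteq> (\<Union>i\<in>D. ball (fst i) (snd i)) \<union> N" by (auto simp: N_def)
  from image_mono[OF this, of T] have "T ` C \<subseteq> (\<Union>i\<in>D. T ` ball (fst i) (snd i)) \<union> T ` N"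
    by (simp only: image_Un image_UN)
  then have "emeasure lebesgue (T ` C) \<le> emeasure lebesgue ((\<Union>i\<in>D. T ` ball (fst i) (snd i)) \<union> T ` N)"
    using D(1) negN by (intro emeasure_mono sets.Un sets.countable_UN') (auto simp: Tball negligible_iff_null_sets null_sets_def)
  also have "\<dots> = emeasure lebesgue (\<Union>i\<in>D. T ` ball (fst i) (snd i))"
    using D(1) negN by (intro emeasure_Un_null_set sets.countable_UN') (auto simp: Tball negligible_iff_null_sets)
  also have "\<dots> = (\<integral>\<^sup>+i. emeasure lebesgue (T ` ball (fst i) (snd i)) \<partial>count_space D)"
    using D(1) disjT by (intro emeasure_UN_countable) (auto simp: Tball)
  also have "\<dots> = (\<integral>\<^sup>+i. emeasure lebesgue (ball (fst i) (snd i)) \<partial>count_space D)"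
    unfolding ball_eq ..
  also have "\<dots> = emeasure lebesgue (\<Union>i\<in>D. ball (fst i) (snd i))"
    using D(1) disj by (intro emeasure_UN_countable[symmetric]) auto
  also have "\<dots> \<le> emeasure lebesgue C"
    using D(2) C by (intro emeasure_mono) (auto simp: K_def borel_open)
  finally show ?thesis .
qed

text \<open>From |u - v| < |w|/2 < |v| it follows that u/v lies in the open unit disc about
  1.\<close>

lemma Re_divide_pos:
  fixes u v w :: complex
  assumes "w \<noteq> 0" "dist w u < norm w / 4" "dist w v < norm w / 4"
  shows "Re (u / v) > 0"
proof -
  have "norm w \<le> norm v + norm (w - v)" using norm_triangle_ineq[of v "w - v"] by simp
  then have v: "norm v > 3/4 * norm w" using assms(3) by (simp add: dist_norm)
  have "norm (u - v) < norm w / 2" using assms(2,3) dist_triangle[of u v w] by (simp add: dist_norm norm_minus_commute)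
  moreover have "norm w > 0" using assms(1) by simp
  ultimately have "norm (u - v) < norm v" using v by linarith
  moreover have v0: "v \<noteq> 0" using v assms(1) by auto
  ultimately have "norm ((u - v) / v) < 1" by (simp add: norm_divide divide_less_eq)
  then have "\<bar>Re ((u - v) / v)\<bar> < 1" using abs_Re_le_cmod order_le_less_trans by blast
  moreover have "u / v = 1 + (u - v) / v" using v0 by (simp add: field_simps)
  ultimately show ?thesis by simp
qed

section \<open>Weight, symbol and regular set of the operator\<close>

context
  fixes \<Omega>1 \<Omega>2 :: "'a::euclidean_space set" and U :: "('a \<Rightarrow> complex) \<Rightarrow> ('a \<Rightarrow> complex)" and h :: "'a \<Rightarrow> complex" and \<tau> :: "'a \<Rightarrow> 'a"
  assumes bd1: "bounded \<Omega>1" and op1: "open \<Omega>1" and bd2: "bounded \<Omega>2" and op2: "open \<Omega>2"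
    and UC: "\<And>f. f \<in> C_closure \<Omega>1 \<Longrightarrow> U f \<in> C_closure \<Omega>2"
    and rep: "\<And>f y. f \<in> C_closure \<Omega>1 \<Longrightarrow> U f y = h y * f (\<tau> y)"
    and \<tau>in: "\<And>y. \<tau> y \<in> closure \<Omega>1"
    and inter: "\<And>f. f \<in> test_functions \<Omega>1 \<Longrightarrow> has_dist_laplacian \<Omega>2 (U f) (U (laplacian f))"
begin

lemma weight_times_C_closure:
  assumes "continuous_on (closure \<Omega>1) p"
  shows "(\<lambda>y. h y * p (\<tau> y)) \<in> C_closure \<Omega>2"
proof -
  have "U (zero_ext \<Omega>1 p) = (\<lambda>y. h y * p (\<tau> y))"
    using rep[OF zero_ext_C_closure[OF assms]] \<tau>in by (auto simp: fun_eq_iff zero_ext_def)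
  then show ?thesis using UC[OF zero_ext_C_closure[OF assms]] by simp
qed

lemma weight_C_closure: "h \<in> C_closure \<Omega>2"
  using weight_times_C_closure[of "\<lambda>_. 1"] by (simp add: continuous_on_const)

lemma weight_continuous: "continuous_on (closure \<Omega>2) h"
  using weight_C_closure C_closure_continuous by blast

text \<open>The operator applied to the coordinate functions gives continuous functions, the weight
  times the components of \<open>\<tau>\<close>; dividing by the weight is possible exactly off its
  zeros.\<close>

lemma symbol_continuous: "continuous_on {y \<in> closure \<Omega>2. h y \<noteq> 0} \<tau>"
  unfolding continuous_on_componentwise[of _ \<tau>]
proof
  fix i :: 'a
  let ?S = "{y \<in> closure \<Omega>2. h y \<noteq> 0}"
  have "(\<lambda>y. h y * complex_of_real (\<tau> y \<bullet> i)) \<in> C_closure \<Omega>2"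
    by (rule weight_times_C_closure) (intro continuous_intros)
  then have "continuous_on (closure \<Omega>2) (\<lambda>y. h y * complex_of_real (\<tau> y \<bullet> i))" by (rule C_closure_continuous)
  then have c: "continuous_on ?S (\<lambda>y. h y * complex_of_real (\<tau> y \<bullet> i))" by (rule continuous_on_subset) auto
  have "continuous_on ?S (\<lambda>y. Re (h y * complex_of_real (\<tau> y \<bullet> i) / h y))"
    by (intro continuous_on_Re continuous_on_divide c continuous_on_subset[OF weight_continuous]) auto
  then show "continuous_on ?S (\<lambda>y. \<tau> y \<bullet> i)"
    by (rule continuous_on_eq) auto
qed

definition regular_set :: "'a set" where
  "regular_set = {y \<in> \<Omega>2. h y \<noteq> 0 \<and> \<tau> y \<in> \<Omega>1}"

text \<open>The neighbourhood is relative to \<open>closure \<Omega>2\<close>, so that it serves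
  boundary points as well as charts. The quarter of \<open>norm (h y0)\<close> is what
  \<open>Re_divide_pos\<close> asks for.\<close>

lemma local_neighbourhood:
  assumes y0: "y0 \<in> closure \<Omega>2" "h y0 \<noteq> 0" and S: "open S" "\<tau> y0 \<in> S"
  obtains r where "r > 0" "\<And>y. y \<in> closure \<Omega>2 \<inter> ball y0 r \<Longrightarrow> \<tau> y \<in> S \<and> dist (h y0) (h y) < norm (h y0) / 4 \<and> h y \<noteq> 0"
proof -
  obtain r1 where r1: "r1 > 0" "\<And>y. y \<in> closure \<Omega>2 \<Longrightarrow> dist y y0 < r1 \<Longrightarrow> dist (h y) (h y0) < norm (h y0) / 4"
    using weight_continuous y0 unfolding continuous_on_iff by (metis divide_pos_pos zero_less_norm_iff zero_less_numeral)
  obtain s where s: "s > 0" "ball (\<tau> y0) s \<subseteq> S" using S open_contains_ball by blast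
  obtain r2 where r2: "r2 > 0" "\<And>y. y \<in> closure \<Omega>2 \<Longrightarrow> h y \<noteq> 0 \<Longrightarrow> dist y y0 < r2 \<Longrightarrow> dist (\<tau> y) (\<tau> y0) < s"
    using symbol_continuous y0 s(1) unfolding continuous_on_iff by blast
  have nz: "h y \<noteq> 0" if "dist (h y) (h y0) < norm (h y0) / 4" for y
    using that y0(2) by (auto simp: dist_norm)
  show ?thesis
  proof (rule that[of "min r1 r2"])
    fix y assume y: "y \<in> closure \<Omega>2 \<inter> ball y0 (min r1 r2)"
    then have d: "dist (h y) (h y0) < norm (h y0) / 4" by (intro r1(2)) (auto simp: dist_commute)
    moreover have "dist (\<tau> y) (\<tau> y0) < s" using y nz[OF d] by (intro r2(2)) (auto simp: dist_commute)
    ultimately show "\<tau> y \<in> S \<and> dist (h y0) (h y) < norm (h y0) / 4 \<and> h y \<noteq> 0"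
      using s(2) nz[OF d] by (auto simp: dist_commute)
  qed (use r1 r2 in auto)
qed

lemma chart_exists:
  assumes y0: "y0 \<in> regular_set"
  obtains r where "r > 0" "ball y0 r \<subseteq> regular_set" "harmonic_chart (ball y0 r) h \<tau>"
proof -
  have y: "y0 \<in> \<Omega>2" "h y0 \<noteq> 0" "\<tau> y0 \<in> \<Omega>1" using y0 by (auto simp: regular_set_def)
  obtain s \<eta> where s: "s > 0" "ball (\<tau> y0) s \<subseteq> \<Omega>1" and \<eta>: "\<eta> \<in> test_functions \<Omega>1" "\<And>x. x \<in> ball (\<tau> y0) s \<Longrightarrow> \<eta> x = 1"
    using local_cutoff[OF op1 y(3)] by metis
  obtain r1 where r1: "r1 > 0" "\<And>y. y \<in> closure \<Omega>2 \<inter> ball y0 r1 \<Longrightarrow> \<tau> y \<in> ball (\<tau> y0) s \<and> dist (h y0) (h y) < norm (h y0) / 4 \<and> h y \<noteq> 0"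
    using local_neighbourhood[of y0 "ball (\<tau> y0) s"] y s(1) closure_subset by (metis centre_in_ball open_ball subsetD)
  obtain r2 where r2: "r2 > 0" "ball y0 r2 \<subseteq> \<Omega>2" using op2 y(1) open_contains_ball by blast
  define r where "r = min r1 r2"
  have r: "r > 0" "ball y0 r \<subseteq> \<Omega>2" using r1 r2 by (auto simp: r_def)
  then have cl: "ball y0 r \<subseteq> closure \<Omega>2" using closure_subset by blast
  have near: "\<tau> y \<in> ball (\<tau> y0) s" "dist (h y0) (h y) < norm (h y0) / 4" "h y \<noteq> 0" if "y \<in> ball y0 r" for y
    using r1(2)[of y] that cl by (auto simp: r_def)
  have reg: "ball y0 r \<subseteq> regular_set" using r near s by (auto simp: regular_set_def)
  \<comment> \<open>On this ball \<open>\<tau>\<close> stays where \<open>\<eta>\<close> is 1, so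
    the cutoff disappears from the product \<open>\<eta> x * p x\<close> and from its
    Laplacian.\<close>
  have wl: "weak_laplacian (ball y0 r) (\<lambda>y. h y * p (\<tau> y)) (\<lambda>y. h y * laplacian p (\<tau> y))" if p: "smooth p" for p
  proof -
    let ?f = "\<lambda>x. \<eta> x * p x"
    have f: "?f \<in> test_functions \<Omega>1" by (rule test_functions_mult(1)[OF \<eta>(1) p])
    have "weak_laplacian (ball y0 r) (U ?f) (U (laplacian ?f))"
      by (rule has_dist_laplacian_weak[OF inter[OF f] op2 r(2)])
         (intro bounded_borel_C_closure[OF bd2] UC test_functions_C_closure f test_functions_laplacian)+
    then show ?thesis
    proof (rule weak_laplacian_cong)
      fix y assume "y \<in> ball y0 r"
      then have t: "\<tau> y \<in> ball (\<tau> y0) s" by (rule near)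
      show "U ?f y = h y * p (\<tau> y)" using rep[OF test_functions_C_closure[OF f]] \<eta>(2)[OF t] by simp
      have "laplacian ?f (\<tau> y) = laplacian p (\<tau> y)"
        by (rule laplacian_cong_open[OF open_ball t]) (use \<eta>(2) in auto)
      then show "U (laplacian ?f) y = h y * laplacian p (\<tau> y)"
        using rep[OF test_functions_C_closure[OF test_functions_laplacian[OF f]]] by simp
    qed
  qed
  have "harmonic_chart (ball y0 r) h \<tau>"
    unfolding harmonic_chart_def
  proof (intro conjI allI ballI)
    show "continuous_on (ball y0 r) h" by (rule continuous_on_subset[OF weight_continuous cl])
    show "continuous_on (ball y0 r) \<tau>" by (rule continuous_on_subset[OF symbol_continuous]) (use cl near in auto)
    show "Re (h z / h y) > 0" if "y \<in> ball y0 r" "z \<in> ball y0 r" for y z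
      using Re_divide_pos[OF y(2) near(2)[OF that(2)] near(2)[OF that(1)]] .
    show "bounded_borel h" by (rule bounded_borel_C_closure[OF bd2 weight_C_closure])
    show "bounded_borel (\<lambda>y. h y * complex_of_real (\<tau> y \<bullet> e))" for e
      by (intro bounded_borel_C_closure[OF bd2] weight_times_C_closure continuous_intros)
    show "bounded_borel (\<lambda>y. h y * complex_of_real ((\<tau> y \<bullet> e)\<^sup>2))" for e
      by (rule bounded_borel_C_closure[OF bd2 weight_times_C_closure]) (intro continuous_intros)
    show "weak_laplacian (ball y0 r) h (\<lambda>_. 0)" using wl[OF smooth_const, of 1] by (simp add: laplacian_const)
    show "weak_laplacian (ball y0 r) (\<lambda>y. h y * complex_of_real (\<tau> y \<bullet> e)) (\<lambda>_. 0)" for e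
      using wl[OF smooth_inner, of e] by (simp add: laplacian_inner)
    show "weak_laplacian (ball y0 r) (\<lambda>y. h y * complex_of_real ((\<tau> y \<bullet> e)\<^sup>2)) (\<lambda>y. of_real (2 * (e \<bullet> e)) * h y)" for e
      using wl[OF smooth_square_inner, of e] unfolding laplacian_square_inner by (simp only: mult.commute)
  qed
  with that r(1) reg show ?thesis by blast
qed

lemma open_regular_set: "open regular_set"
  unfolding open_contains_ball using chart_exists by metis

text \<open>Charts provide affine formulas on small balls. They are glued by noting that the triple
  \<open>P\<close> of linear part, translation part and weight is locally constant, hence constant
  on a connected set.\<close>

lemma regular_piece:
  assumes C: "connected C" "C \<subseteq> regular_set" "C \<noteq> {}"
  obtains T v c where "orthogonal_transformation T" "c \<noteq> 0" "\<And>y. y \<in> C \<Longrightarrow> \<tau> y = T y + v" "\<And>y. y \<in> C \<Longrightarrow> h y = c"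
proof -
  have loc: "\<exists>\<delta> T. \<delta> > 0 \<and> orthogonal_transformation T \<and> ball y0 \<delta> \<subseteq> regular_set \<and> (\<forall>z\<in>ball y0 \<delta>. \<tau> z = \<tau> y0 + T (z - y0))
      \<and> (h has_derivative (\<lambda>_. 0)) (at y0)" if y0: "y0 \<in> regular_set" for y0
  proof -
    obtain r where r: "r > 0" "ball y0 r \<subseteq> regular_set" "harmonic_chart (ball y0 r) h \<tau>" using chart_exists[OF y0] by blast
    obtain T where T: "orthogonal_transformation T" "\<And>z. z \<in> ball y0 (r/3) \<Longrightarrow> \<tau> z = \<tau> y0 + T (z - y0)" "(h has_derivative (\<lambda>_. 0)) (at y0)"
      using chart_affine[OF r(3,1)] by blast
    have "ball y0 (r/3) \<subseteq> ball y0 r" using r(1) by (intro subset_ball) simp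
    then have "ball y0 (r/3) \<subseteq> regular_set" using r(2) by blast
    moreover have "r/3 > 0" using r(1) by simp
    ultimately show ?thesis using T(1,3) by (intro exI[of _ "r/3"] exI[of _ T] conjI ballI T(2))
  qed
  define D where "D y = frechet_derivative \<tau> (at y)" for y
  define P where "P y = (D y, \<tau> y - D y y, h y)" for y
  have Ploc: "\<exists>\<delta>>0. orthogonal_transformation (D y0) \<and> (\<forall>z\<in>ball y0 \<delta>. P z = P y0)" if y0: "y0 \<in> regular_set" for y0
  proof -
    obtain \<delta> T where \<delta>: "\<delta> > 0" "ball y0 \<delta> \<subseteq> regular_set" and T: "orthogonal_transformation T" "\<And>z. z \<in> ball y0 \<delta> \<Longrightarrow> \<tau> z = \<tau> y0 + T (z - y0)"
      using loc[OF y0] by blast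
    have linT: "linear T" using T(1) by (rule orthogonal_transformation_linear)
    have Dz: "D z = T" if z: "z \<in> ball y0 \<delta>" for z
    proof -
      have "((\<lambda>z. z - y0) has_derivative (\<lambda>k. k)) (at z)" by (auto intro!: derivative_eq_intros)
      from has_derivative_add[OF has_derivative_const bounded_linear.has_derivative[OF linear_conv_bounded_linear[THEN iffD1, OF linT] this], of "\<tau> y0"]
      have "((\<lambda>z. \<tau> y0 + T (z - y0)) has_derivative T) (at z)" by simp
      then have "(\<tau> has_derivative T) (at z)"
        by (rule has_derivative_transform_within_open[OF _ open_ball z]) (rule T(2)[symmetric])
      then show ?thesis unfolding D_def by (rule frechet_derivative_at[symmetric])
    qed
    have hz: "h z = h y0" if z: "z \<in> ball y0 \<delta>" for z
    proof (rule has_derivative_zero_unique[OF convex_ball[of y0 \<delta>]])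
      show "(h has_derivative (\<lambda>_. 0)) (at x within ball y0 \<delta>)" if "x \<in> ball y0 \<delta>" for x
        using loc[of x] \<delta>(2) that by (blast intro: has_derivative_at_withinI)
    qed (use z \<delta> in auto)
    have "P z = P y0" if z: "z \<in> ball y0 \<delta>" for z
      using Dz[OF z] Dz[of y0] hz[OF z] T(2)[OF z] \<delta>(1) by (simp add: P_def linear_diff[OF linT])
    moreover have "orthogonal_transformation (D y0)" using Dz[of y0] T(1) \<delta>(1) by simp
    ultimately show ?thesis using \<delta>(1) by blast
  qed
  obtain y1 where y1: "y1 \<in> C" using C(3) by blast
  have Pc: "P y = P y1" if y: "y \<in> C" for y
  proof (rule connected_local_const[OF C(1) y y1])
    show "\<forall>a\<in>C. eventually (\<lambda>b. P a = P b) (at a within C)"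
    proof
      fix a assume "a \<in> C"
      then obtain \<delta> where \<delta>: "\<delta> > 0" "\<forall>z\<in>ball a \<delta>. P z = P a" using Ploc C(2) by blast
      have "P a = P x" if "dist x a < \<delta>" for x
        using bspec[OF \<delta>(2), of x] that by (metis dist_commute mem_ball)
      then show "eventually (\<lambda>b. P a = P b) (at a within C)"
        unfolding eventually_at using \<delta>(1) by blast
    qed
  qed
  show ?thesis
  proof (rule that[of "D y1" "h y1" "\<tau> y1 - D y1 y1"])
    show "orthogonal_transformation (D y1)" using Ploc y1 C(2) by blast
    show "h y1 \<noteq> 0" using y1 C(2) by (auto simp: regular_set_def)
    fix y assume "y \<in> C"
    from Pc[OF this] show "\<tau> y = D y1 y + (\<tau> y1 - D y1 y1)" "h y = h y1" by (auto simp: P_def algebra_simps)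
  qed
qed

text \<open>The weight has to be settled first: its limit value c is nonzero, and only then is
  \<open>\<tau>\<close> known to be continuous at y.\<close>

lemma affine_on_closure:
  assumes S: "S \<subseteq> closure \<Omega>2" and lin: "linear T" and c: "c \<noteq> 0"
    and \<tau>: "\<And>y. y \<in> S \<Longrightarrow> \<tau> y = T y + v" and h: "\<And>y. y \<in> S \<Longrightarrow> h y = c" and y: "y \<in> closure S"
  shows "\<tau> y = T y + v" "h y = c"
proof -
  have cl: "closure S \<subseteq> closure \<Omega>2" using S by (metis closure_closure closure_mono)
  obtain x where x: "\<And>n. x n \<in> S" "x \<longlonglongrightarrow> y" using y closure_sequential by blast
  have xc: "x n \<in> closure \<Omega>2" for n using S x(1) by blast
  have "(\<lambda>n. h (x n)) \<longlonglongrightarrow> h y"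
    by (rule continuous_on_tendsto_compose[OF weight_continuous x(2)]) (use xc y cl in auto)
  then show hy: "h y = c" using h[OF x(1)] by (simp add: LIMSEQ_const_iff)
  have "(\<lambda>n. \<tau> (x n)) \<longlonglongrightarrow> \<tau> y"
    by (rule continuous_on_tendsto_compose[OF symbol_continuous x(2)]) (use xc y cl hy c h[OF x(1)] in auto)
  moreover have "(\<lambda>n. T (x n) + v) \<longlonglongrightarrow> T y + v"
    by (intro tendsto_intros bounded_linear.tendsto[OF _ x(2)] linear_conv_bounded_linear[THEN iffD1, OF lin])
  ultimately show "\<tau> y = T y + v" using \<tau>[OF x(1)] LIMSEQ_unique by simp
qed

lemma boundary_to_boundary:
  assumes lb: "lipschitz_boundary \<Omega>2" and rob: "U ` test_functions \<Omega>1 \<subseteq> robin_domain \<Omega>2 \<beta>"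
    and y0: "y0 \<in> frontier \<Omega>2" and h0: "h y0 \<noteq> 0"
  shows "\<tau> y0 \<notin> \<Omega>1"
proof
  assume t0: "\<tau> y0 \<in> \<Omega>1"
  have cl0: "y0 \<in> closure \<Omega>2" using y0 by (simp add: frontier_def)
  obtain V e L \<phi> where V: "open V" "y0 \<in> V" "norm e = 1" "L-lipschitz_on {y. y \<bullet> e = 0} (\<phi> :: 'a \<Rightarrow> real)"
    "\<And>y. y \<in> V \<Longrightarrow> y \<in> \<Omega>2 \<longleftrightarrow> \<phi> (y - (y \<bullet> e) *\<^sub>R e) < y \<bullet> e"
    using lb y0 unfolding lipschitz_boundary_def by metis
  obtain s \<eta> where s: "s > 0" "ball (\<tau> y0) s \<subseteq> \<Omega>1" and \<eta>: "\<eta> \<in> test_functions \<Omega>1" "\<And>x. x \<in> ball (\<tau> y0) s \<Longrightarrow> \<eta> x = 1"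
    using local_cutoff[OF op1 t0] by metis
  obtain r1 where r1: "r1 > 0" "\<And>y. y \<in> closure \<Omega>2 \<inter> ball y0 r1 \<Longrightarrow> \<tau> y \<in> ball (\<tau> y0) s \<and> dist (h y0) (h y) < norm (h y0) / 4 \<and> h y \<noteq> 0"
    using local_neighbourhood[OF cl0 h0, of "ball (\<tau> y0) s"] s(1) by (metis centre_in_ball open_ball)
  obtain r2 where r2: "r2 > 0" "ball y0 r2 \<subseteq> V" using V open_contains_ball by blast
  define \<rho> where "\<rho> = min r1 r2"
  have \<rho>: "\<rho> > 0" "ball y0 \<rho> \<subseteq> V" using r1 r2 by (auto simp: \<rho>_def)
  \<comment> \<open>A connected piece guarantees one affine formula on all of
    \<open>\<Omega>2\<close> near \<open>y0\<close>; it then extends to the boundary by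
    continuity.\<close>
  obtain Q \<delta> where Q: "connected Q" "Q \<subseteq> \<Omega>2 \<inter> ball y0 \<rho>" "\<delta> > 0" "\<Omega>2 \<inter> ball y0 \<delta> \<subseteq> Q"
    using connected_piece[OF op2 V(1,3,4,5) y0 \<rho>] by blast
  define \<epsilon> where "\<epsilon> = min \<delta> \<rho>"
  have \<epsilon>: "\<epsilon> > 0" "ball y0 \<epsilon> \<subseteq> V" using Q(3) \<rho> by (auto simp: \<epsilon>_def)
  have "\<Omega>2 \<inter> ball y0 \<epsilon> \<noteq> {}"
    using cl0 \<epsilon>(1) open_Int_closure_eq_empty[OF open_ball, of y0 \<epsilon> \<Omega>2] by (metis IntI Int_commute centre_in_ball empty_iff)
  then have "Q \<noteq> {}" using Q(4) by (auto simp: \<epsilon>_def)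
  moreover have "Q \<subseteq> regular_set"
    using Q(2) r1(2) s(2) closure_subset[of \<Omega>2] by (fastforce simp: regular_set_def \<rho>_def)
  ultimately obtain T v c where T: "orthogonal_transformation T" and c: "c \<noteq> 0" and aff: "\<And>y. y \<in> Q \<Longrightarrow> \<tau> y = T y + v" "\<And>y. y \<in> Q \<Longrightarrow> h y = c"
    using regular_piece[OF Q(1)] by metis
  have affc: "\<tau> y = T y + v" "h y = c" "\<eta> (\<tau> y) = 1" if "y \<in> closure \<Omega>2 \<inter> ball y0 \<epsilon>" for y
  proof -
    have "y \<in> closure (\<Omega>2 \<inter> ball y0 \<epsilon>)"
      using that open_Int_closure_subset[OF open_ball, of y0 \<epsilon> \<Omega>2] by (auto simp: Int_commute)
    moreover have "\<Omega>2 \<inter> ball y0 \<epsilon> \<subseteq> Q" using Q(4) by (auto simp: \<epsilon>_def)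
    ultimately have "y \<in> closure Q" using closure_mono by blast
    moreover have "Q \<subseteq> closure \<Omega>2" using Q(2) closure_subset by blast
    ultimately show "\<tau> y = T y + v" "h y = c"
      using affine_on_closure[OF _ orthogonal_transformation_linear[OF T] c aff] by blast+
    show "\<eta> (\<tau> y) = 1" using r1(2)[of y] that by (intro \<eta>(2)) (auto simp: \<epsilon>_def \<rho>_def)
  qed
  \<comment> \<open>Since \<open>T y \<bullet> T e = y \<bullet> e\<close>, composition with
    \<open>\<tau>\<close> gives a linear function whose slope is exactly the epigraph direction
    e.\<close>
  let ?f = "\<lambda>x. \<eta> x * complex_of_real (x \<bullet> T e)"
  have f: "?f \<in> test_functions \<Omega>1" by (rule test_functions_mult(1)[OF \<eta>(1) smooth_inner])
  have nd: "has_normal_derivative \<Omega>2 (U g) (\<lambda>z. - complex_of_real (\<beta> z) * U g z)" if "g \<in> test_functions \<Omega>1" for g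
    using rob that unfolding robin_domain_def by blast
  show False
  proof (rule robin_not_affine[OF op2 V(1,3,4,5) bd2 y0 \<epsilon> c nd[OF \<eta>(1)] nd[OF f]])
    fix y assume y: "y \<in> closure \<Omega>2 \<inter> ball y0 \<epsilon>"
    show "U \<eta> y = c" using rep[OF test_functions_C_closure[OF \<eta>(1)]] affc[OF y] by simp
    have "T y \<bullet> T e = y \<bullet> e" using T unfolding orthogonal_transformation_def by blast
    then show "U ?f y = c * complex_of_real (y \<bullet> e + v \<bullet> T e)"
      using rep[OF test_functions_C_closure[OF f]] affc[OF y] by (simp add: inner_add_left)
  qed
qed

text \<open>The image of the component is open because \<open>T\<close> is invertible. It is
  relatively closed in \<open>\<Omega>1\<close> because \<open>closure C\<close> is compact and each
  of its points that is mapped into \<open>\<Omega>1\<close> already lies in \<open>C\<close>: it is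
  no boundary point by \<open>boundary_to_boundary\<close>, hence regular, and components are
  relatively closed. Connectedness of \<open>\<Omega>1\<close> finishes.\<close>

lemma component_onto:
  assumes cn1: "connected \<Omega>1" and lb: "lipschitz_boundary \<Omega>2" and rob: "U ` test_functions \<Omega>1 \<subseteq> robin_domain \<Omega>2 \<beta>"
    and C: "C \<in> components regular_set"
  obtains T v c where "orthogonal_transformation T" "c \<noteq> 0" "(\<lambda>y. T y + v) ` C = \<Omega>1"
    "\<And>y. y \<in> closure C \<Longrightarrow> \<tau> y = T y + v" "\<And>y. y \<in> closure C \<Longrightarrow> h y = c"
proof -
  have Cr: "C \<subseteq> regular_set" "connected C" "C \<noteq> {}"
    using C in_components_subset in_components_connected in_components_nonempty by blast+
  have opC: "open C" using open_components[OF open_regular_set C] .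
  have C2: "C \<subseteq> \<Omega>2" using Cr(1) by (auto simp: regular_set_def)
  then have C2c: "C \<subseteq> closure \<Omega>2" and cC2: "closure C \<subseteq> closure \<Omega>2" using closure_subset closure_mono by blast+
  obtain T v c where T: "orthogonal_transformation T" and c: "c \<noteq> 0" and aff: "\<And>y. y \<in> C \<Longrightarrow> \<tau> y = T y + v" "\<And>y. y \<in> C \<Longrightarrow> h y = c"
    using regular_piece[OF Cr(2,1,3)] by metis
  have linT: "linear T" by (rule orthogonal_transformation_linear[OF T])
  have affc: "\<tau> y = T y + v" "h y = c" if "y \<in> closure C" for y
    using affine_on_closure[OF C2c linT c aff that] by blast+
  let ?A = "\<lambda>y. T y + v"
  have contA: "continuous_on S ?A" for S
    by (intro continuous_intros linear_continuous_on linear_conv_bounded_linear[THEN iffD1, OF linT])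
  have inC: "y \<in> C" if y: "y \<in> closure C" "?A y \<in> \<Omega>1" for y
  proof -
    have "y \<in> \<Omega>2"
    proof (rule ccontr)
      assume "y \<notin> \<Omega>2"
      then have "y \<in> frontier \<Omega>2" using y(1) cC2 op2 by (auto simp: frontier_def interior_open)
      then show False using boundary_to_boundary[OF lb rob, of y] affc[OF y(1)] c y(2) by simp
    qed
    then have "y \<in> regular_set" using affc[OF y(1)] c y(2) by (simp add: regular_set_def)
    have "closedin (top_of_set regular_set) C" using closedin_component[OF C] .
    then obtain F where "closed F" "C = regular_set \<inter> F" unfolding closedin_closed by blast
    moreover from this have "closure C \<subseteq> F" by (intro closure_minimal) auto
    ultimately show "y \<in> C" using y(1) \<open>y \<in> regular_set\<close> by blast
  qed
  have sub: "?A ` C \<subseteq> \<Omega>1" using Cr(1) aff(1) by (force simp: regular_set_def)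
  have "open (?A ` C)"
  proof -
    have "?A ` C = (+) v ` (T ` C)" by (auto simp: image_image add.commute)
    moreover have "open (T ` C)"
      by (rule open_surjective_linear_image[OF opC linT orthogonal_transformation_surj[OF T]])
    ultimately show ?thesis using open_translation by metis
  qed
  then have opn: "openin (top_of_set \<Omega>1) (?A ` C)" using sub by (simp add: openin_open_eq op1)
  have "closedin (top_of_set \<Omega>1) (?A ` C)"
  proof -
    have "bounded C" using bd2 C2 bounded_subset by blast
    then have "compact (?A ` closure C)"
      by (intro compact_continuous_image contA) (simp add: compact_closure)
    then have "closed (?A ` closure C)" by (rule compact_imp_closed)
    moreover have "?A ` C = \<Omega>1 \<inter> ?A ` closure C"
      using sub inC closure_subset[of C] by blast
    ultimately show ?thesis unfolding closedin_closed by blast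
  qed
  then have "?A ` C = \<Omega>1" using cn1 opn Cr(3) unfolding connected_clopen by blast
  then show ?thesis using that[OF T c _ affc] by blast
qed

text \<open>Off the regular set either the weight vanishes or \<open>\<tau>\<close> leaves
  \<open>\<Omega>1\<close>, where test functions are zero; an open subset of
  \<open>\<Omega>2\<close> of such points is what (c) excludes.\<close>

lemma regular_set_dense:
  assumes "\<forall>\<omega>. open \<omega> \<and> \<omega> \<subseteq> \<Omega>2 \<and> (\<forall>f\<in>test_functions \<Omega>1. \<forall>y\<in>\<omega>. U f y = 0) \<longrightarrow> \<omega> = {}"
  shows "\<Omega>2 \<subseteq> closure regular_set"
proof -
  let ?O = "\<Omega>2 - closure regular_set"
  have "open ?O" using op2 by (simp add: open_Diff)
  moreover have "U f y = 0" if f: "f \<in> test_functions \<Omega>1" and y: "y \<in> ?O" for f y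
  proof -
    have "y \<notin> regular_set" "y \<in> \<Omega>2" using y closure_subset by blast+
    then have "h y = 0 \<or> \<tau> y \<notin> \<Omega>1" by (auto simp: regular_set_def)
    then show ?thesis using rep[OF test_functions_C_closure[OF f]] test_functions_zero[OF f] by auto
  qed
  ultimately have "?O = {}" using assms by blast
  then show ?thesis by blast
qed

text \<open>If \<open>\<tau>\<close> identifies y and y', every function in the range satisfies
  \<open>h y' * U f y = h y * U f y'\<close>. This relation passes to uniform limits, but the
  distance from y' violates it.\<close>

lemma dense_range_separates:
  assumes dense: "dense_range_C \<Omega>1 \<Omega>2 U" and y: "y \<in> closure \<Omega>2" "y' \<in> closure \<Omega>2" "h y' \<noteq> 0" "\<tau> y = \<tau> y'"
  shows "y = y'"
proof (rule ccontr)
  assume ne: "y \<noteq> y'"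
  define g where "g = zero_ext \<Omega>2 (\<lambda>z. complex_of_real (dist z y'))"
  have g: "g \<in> C_closure \<Omega>2" unfolding g_def by (intro zero_ext_C_closure continuous_intros)
  define N where "N = norm (h y) + norm (h y')"
  have N: "N > 0" using y(3) by (simp add: N_def add_nonneg_pos)
  \<comment> \<open>With this choice the approximation error \<open>N * \<epsilon>\<close> equals
    the defect \<open>norm (h y') * dist y y'\<close>, and the inequality is strict because
    \<open>h y' \<noteq> 0\<close>.\<close>
  define \<epsilon> where "\<epsilon> = norm (h y') * dist y y' / N"
  have "\<epsilon> > 0" using N y(3) ne by (simp add: \<epsilon>_def)
  then obtain f where f: "f \<in> C_closure \<Omega>1" "sup_norm \<Omega>2 (\<lambda>y. U f y - g y) < \<epsilon>"
    using dense g unfolding dense_range_C_def by blast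
  have "(\<lambda>z. U f z - g z) \<in> C_closure \<Omega>2"
    using C_closure_add[OF UC[OF f(1)] C_closure_cmult[OF g, of "-1"]] by simp
  then have close: "norm (U f z - g z) < \<epsilon>" if "z \<in> closure \<Omega>2" for z
    using norm_le_sup_norm[OF bd2 _ that] f(2) by fastforce
  have "h y' * U f y = h y * U f y'" using rep[OF f(1)] y(4) by simp
  then have "h y' * g y - h y * g y' = h y * (U f y' - g y') - h y' * (U f y - g y)" by (simp add: algebra_simps)
  then have "norm (h y' * g y - h y * g y') \<le> norm (h y * (U f y' - g y')) + norm (h y' * (U f y - g y))"
    by (metis norm_triangle_ineq4)
  also have "\<dots> = norm (h y) * norm (U f y' - g y') + norm (h y') * norm (U f y - g y)" by (simp add: norm_mult)
  also have "\<dots> < norm (h y) * \<epsilon> + norm (h y') * \<epsilon>"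
    using close[OF y(1)] close[OF y(2)] y(3) by (intro add_le_less_mono mult_left_mono mult_strict_left_mono) auto
  also have "\<dots> = N * \<epsilon>" by (simp add: N_def distrib_right)
  also have "\<dots> = norm (h y') * dist y y'" using N by (simp add: \<epsilon>_def)
  finally have "norm (h y' * g y - h y * g y') < norm (h y') * dist y y'" .
  then show False using y by (simp add: g_def zero_ext_def norm_mult)
qed

end

theorem theorem5p6:
  fixes \<Omega>1 \<Omega>2 :: "'a::euclidean_space set"
    and U :: "('a \<Rightarrow> complex) \<Rightarrow> ('a \<Rightarrow> complex)"
  assumes dom1: "lipschitz_domain \<Omega>1"
    and dom2: "lipschitz_domain \<Omega>2"
    and U: "bounded_linear_C \<Omega>1 \<Omega>2 U"
    and a: "\<forall>f\<in>C_closure \<Omega>1. \<forall>g\<in>C_closure \<Omega>1.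
      (\<forall>x\<in>closure \<Omega>1. f x * g x = 0) \<longrightarrow> (\<forall>y\<in>closure \<Omega>2. U f y * U g y = 0)"
    and b_domain: "\<exists>\<beta>::'a \<Rightarrow> real. continuous_on (frontier \<Omega>2) \<beta> \<and>
      U ` test_functions \<Omega>1 \<subseteq> robin_domain \<Omega>2 \<beta>"
    and b_intertwine: "\<forall>f\<in>test_functions \<Omega>1. has_dist_laplacian \<Omega>2 (U f) (U (laplacian f))"
    and c: "\<forall>\<omega>. open \<omega> \<and> \<omega> \<subseteq> \<Omega>2 \<and> (\<forall>f\<in>test_functions \<Omega>1. \<forall>y\<in>\<omega>. U f y = 0) \<longrightarrow> \<omega> = {}"
    and d_or_e: "emeasure lebesgue \<Omega>1 = emeasure lebesgue \<Omega>2 \<or> dense_range_C \<Omega>1 \<Omega>2 U"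
  shows "(\<exists>(\<tau>::'a \<Rightarrow> 'a) (c::complex). isometry \<tau> \<and> \<tau> ` \<Omega>2 = \<Omega>1 \<and> c \<noteq> 0 \<and>
      (\<forall>f\<in>C_closure \<Omega>1. \<forall>y\<in>closure \<Omega>2. U f y = c * f (\<tau> y))) \<and>
    congruent_sets \<Omega>1 \<Omega>2"
proof -
  note D1 = lipschitz_domainD[OF dom1] and D2 = lipschitz_domainD[OF dom2]
  define h where "h = U (zero_ext \<Omega>1 (\<lambda>_. 1))"
  obtain \<tau> where \<tau>: "\<And>y. \<tau> y \<in> closure \<Omega>1"
    and "\<And>f y. f \<in> C_closure \<Omega>1 \<Longrightarrow> U f y = U (zero_ext \<Omega>1 (\<lambda>_. 1)) y * f (\<tau> y)"
    by (rule weighted_composition[OF D1(3,1) D2(3) U a]) (rule that)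
  then have rep: "\<And>f y. f \<in> C_closure \<Omega>1 \<Longrightarrow> U f y = h y * f (\<tau> y)" by (simp only: h_def)
  have UC: "\<And>f. f \<in> C_closure \<Omega>1 \<Longrightarrow> U f \<in> C_closure \<Omega>2" using U unfolding bounded_linear_C_def by blast
  have inter: "\<And>f. f \<in> test_functions \<Omega>1 \<Longrightarrow> has_dist_laplacian \<Omega>2 (U f) (U (laplacian f))" using b_intertwine by blast
  obtain \<beta> where rob: "U ` test_functions \<Omega>1 \<subseteq> robin_domain \<Omega>2 \<beta>" using b_domain by blast
  note X = D1(3,2) D2(3,2) UC rep \<tau> inter
  define R where "R = regular_set \<Omega>1 \<Omega>2 h \<tau>"
  have opR: "open R" unfolding R_def using open_regular_set[OF X] .
  have RD: "\<Omega>2 \<subseteq> closure R" unfolding R_def using regular_set_dense[OF X c] .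
  have R2: "R \<subseteq> \<Omega>2" by (auto simp: R_def regular_set_def[OF X])
  have onto: "\<exists>T v c. orthogonal_transformation T \<and> c \<noteq> 0 \<and> (\<lambda>y. T y + v) ` C = \<Omega>1 \<and>
      (\<forall>y\<in>closure C. \<tau> y = T y + v \<and> h y = c)" if "C \<in> components R" for C
    using component_onto[OF X D1(4) D2(5) rob that[unfolded R_def]] by metis
  have meas: "measure lebesgue \<Omega>1 \<le> measure lebesgue C" if C: "C \<in> components R" for C
  proof -
    obtain T v where T: "orthogonal_transformation T" "(\<lambda>y. T y + v) ` C = \<Omega>1" using onto[OF C] by blast
    have "(\<lambda>y. T y + v) ` C = (+) v ` (T ` C)" by (auto simp: image_image add.commute)
    then have "measure lebesgue \<Omega>1 = measure lebesgue (T ` C)" using T(2) measure_translation by metis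
    moreover have "open C" by (rule open_components[OF opR C])
    moreover from this have "C \<in> lmeasurable"
      using in_components_subset[OF C] R2 D2(3) by (intro lmeasurable_open) (auto intro: bounded_subset)
    ultimately show ?thesis
      using emeasure_orthogonal_image_le[OF T(1)] unfolding measure_def
      by (auto intro!: enn2real_mono simp: fmeasurable_def)
  qed
  have unique: "C = C'" if C: "C \<in> components R" and C': "C' \<in> components R" for C C'
  proof (rule ccontr)
    assume ne: "C \<noteq> C'"
    then have disj: "C \<inter> C' = {}" using components_nonoverlap[OF C C'] by blast
    have sub: "C \<subseteq> \<Omega>2" "C' \<subseteq> \<Omega>2" using in_components_subset C C' R2 by blast+
    have op: "open C" "open C'" using open_components[OF opR] C C' by blast+
    show False using d_or_e
    proof
      \<comment> \<open>Each component has at least the volume of \<open>\<Omega>1\<close>, and two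
        disjoint ones would have to fit into \<open>\<Omega>2\<close>, which has just that volume;
        the second would be an open null set.\<close>
      assume eq: "emeasure lebesgue \<Omega>1 = emeasure lebesgue \<Omega>2"
      have lm: "C \<in> lmeasurable" "C' \<in> lmeasurable" "\<Omega>2 \<in> lmeasurable"
        using sub op D2(2,3) bounded_subset by (blast intro: lmeasurable_open)+
      have "measure lebesgue C + measure lebesgue C' = measure lebesgue (C \<union> C')"
        using measure_Un3[OF lm(1,2)] disj by simp
      also have "\<dots> \<le> measure lebesgue \<Omega>2"
        using sub lm by (intro measure_mono_fmeasurable) (auto intro: fmeasurableD)
      also have "\<dots> = measure lebesgue \<Omega>1" using eq by (simp add: measure_def)
      finally have "measure lebesgue C' = 0" using meas[OF C] measure_nonneg[of lebesgue C'] by linarith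
      then have "negligible C'" using lm(2) negligible_iff_measure by blast
      then show False using open_not_negligible[OF op(2)] in_components_nonempty[OF C'] by blast
    next
      assume dense: "dense_range_C \<Omega>1 \<Omega>2 U"
      obtain T v c where T: "(\<lambda>y. T y + v) ` C = \<Omega>1" "c \<noteq> 0" "\<forall>y\<in>closure C. \<tau> y = T y + v \<and> h y = c" using onto[OF C] by blast
      obtain T' v' c' where T': "(\<lambda>y. T' y + v') ` C' = \<Omega>1" "c' \<noteq> 0" "\<forall>y\<in>closure C'. \<tau> y = T' y + v' \<and> h y = c'" using onto[OF C'] by blast
      \<comment> \<open>Both components are mapped onto \<open>\<Omega>1\<close>, so a point of one
        shares its image with a point of the other.\<close>
      obtain y where y: "y \<in> C" using in_components_nonempty[OF C] by blast
      then have "T y + v \<in> (\<lambda>y. T' y + v') ` C'" using T(1) T'(1) by blast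
      then obtain y' where y': "y' \<in> C'" "T y + v = T' y' + v'" by blast
      have "y \<in> closure C" "y' \<in> closure C'" using y y' closure_subset by blast+
      then have "\<tau> y = \<tau> y'" "h y' \<noteq> 0" using T(3) T'(2,3) y'(2) by auto
      moreover have "y \<in> closure \<Omega>2" "y' \<in> closure \<Omega>2" using y y' sub closure_subset by blast+
      ultimately have "y = y'" using dense_range_separates[OF X dense] by blast
      then show False using y y' disj by blast
    qed
  qed
  have "R \<noteq> {}" using RD D2(1) by auto
  then obtain C where C: "C \<in> components R" using components_eq_empty by blast
  have "components R = {C}" using unique C by blast
  then have CR: "C = R" using Union_components[of R] by simp
  obtain T v c where T: "orthogonal_transformation T" "c \<noteq> 0" "(\<lambda>y. T y + v) ` R = \<Omega>1" "\<forall>y\<in>closure R. \<tau> y = T y + v \<and> h y = c"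
    using onto[OF C] CR by blast
  have clR: "closure \<Omega>2 \<subseteq> closure R" using RD by (metis closure_closure closure_mono)
  let ?A = "\<lambda>y. T y + v"
  have linT: "linear T" by (rule orthogonal_transformation_linear[OF T(1)])
  have isoA: "isometry ?A"
    unfolding isometry_def dist_norm
    using orthogonal_transformation_norm[OF T(1)] by (simp add: linear_diff[OF linT, symmetric])
  have "?A ` \<Omega>2 = \<Omega>1"
  proof
    show "\<Omega>1 \<subseteq> ?A ` \<Omega>2" using T(3) R2 by blast
    have "?A ` \<Omega>2 = (+) v ` (T ` \<Omega>2)" by (auto simp: image_image add.commute)
    moreover have "open (T ` \<Omega>2)"
      by (rule open_surjective_linear_image[OF D2(2) linT orthogonal_transformation_surj[OF T(1)]])
    ultimately have "open (?A ` \<Omega>2)" using open_translation by metis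
    \<comment> \<open>A point of \<open>\<Omega>2\<close> outside \<open>R\<close> is still in its
      closure, where \<open>\<tau>\<close> agrees with the affine map, and \<open>\<tau>\<close> has
      values in \<open>closure \<Omega>1\<close> by construction.\<close>
    moreover have "?A ` \<Omega>2 \<subseteq> closure \<Omega>1"
    proof
      fix x assume "x \<in> ?A ` \<Omega>2"
      then obtain y where y: "y \<in> \<Omega>2" "x = T y + v" by blast
      then have "\<tau> y = x" using T(4) RD by blast
      then show "x \<in> closure \<Omega>1" using \<tau>[of y] by simp
    qed
    ultimately have "?A ` \<Omega>2 \<subseteq> interior (closure \<Omega>1)" by (rule interior_maximal[rotated])
    then show "?A ` \<Omega>2 \<subseteq> \<Omega>1" using lipschitz_boundary_interior_closure[OF D1(2,5)] by blast
  qed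
  moreover have "U f y = c * f (?A y)" if "f \<in> C_closure \<Omega>1" "y \<in> closure \<Omega>2" for f y
    using rep[OF that(1)] T(4) clR that(2) by auto
  moreover have "congruent_sets \<Omega>1 \<Omega>2"
  proof -
    let ?B = "\<lambda>x. inv T (x - v)"
    have oi: "orthogonal_transformation (inv T)" by (rule orthogonal_transformation_inv[OF T(1)])
    have "isometry ?B"
      unfolding isometry_def dist_norm
      using orthogonal_transformation_norm[OF oi]
      by (simp add: linear_diff[OF orthogonal_transformation_linear[OF oi], symmetric])
    moreover have "?B (?A y) = y" for y
      using orthogonal_transformation_inj[OF T(1)] by simp
    then have "?B ` \<Omega>1 = \<Omega>2"
      unfolding \<open>?A ` \<Omega>2 = \<Omega>1\<close>[symmetric] by (simp add: image_image)
    ultimately show ?thesis unfolding congruent_sets_def by blast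
  qed
  ultimately show ?thesis using isoA T(2) by blast
qed

end
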